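(* Let $\omega$ be an $\mathcal{A}_2$ weight on $\mathbb{D}$. Then there exist $\epsilon\in(0,1)$ and an $\epsilon$-lattice $\{a_n\}_{n=1}^{\infty}\subset\mathbb{D}$ such that any $f\in L_h^2(\omega)$ has the form $$f(z)=\sum_{n=1}^\infty c_n K^{\omega}_{a_n}(z)\, |D(a_n, \epsilon)|_\omega^{\frac{1}{2}}$$ for some sequence $\{c_n\}$ in $\ell^2(\mathbb{N})$, where $K^\omega_{a_n}$ is the reproducing kernel of $L_h^2(\omega)$ at $a_n$.
   Context: $\mathbb{D}$ is the open unit disk in $\mathbb{C}$, $dA$ is Lebesgue area measure on $\mathbb{D}$ normalized so that $\mathbb{D}$ has measure $1$, and $|E|$ is the $dA$-measure of $E$. For a weight $\omega$ put $|E|_\omega=\int_E\omega\,dA$. A function $\omega$ with $0<\omega\in L^1(\mathbb{D},dA)$ is an $\mathcal{A}_2$ weight if $$[\omega]_{\mathcal{A}_2}:=\sup_{a\in\mathbb{D},\,0<r<1}\frac{|B(a,r)|_\omega\,|B(a,r)|_{\omega^{-1}}}{|B(a,r)|^2}<\infty,\qquad B(a,r)=\{z\in\mathbb{D}:|z-a|<r\}.$$ $L_h^2(\omega)$ is the space of complex-valued harmonic functions $f$ on $\mathbb{D}$ with $\|f\|_{L^2(\omega)}^2=\int_{\mathbb{D}}|f|^2\omega\,dA<\infty$; for $\omega\in\mathcal{A}_2$ it is a reproducing kernel Hilbert space with the inner product of $L^2(\omega)$, and its reproducing kernel $K_z^\omega$ is characterized by $f(z)=\langle f,K_z^\omega\rangle_{L^2(\omega)}$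 for all $f\in L_h^2(\omega)$, $z\in\mathbb{D}$. The pseudohyperbolic disk is $D(a,r)=\{z\in\mathbb{D}:|\frac{z-a}{1-\overline{a}z}|<r\}$. For $\epsilon\in(0,1)$, a sequence $\{a_n\}_{n\ge1}\subset\mathbb{D}$ is an $\epsilon$-lattice if $\mathbb{D}=\bigcup_{n}D(a_n,\epsilon)$ and $\inf_{n\neq m}\left|\frac{a_n-a_m}{1-\overline{a_n}a_m}\right|\ge\frac{\epsilon}{2}$. *)

theory Defs
  imports "HOL-Analysis.Analysis"
begin

definition disc :: "complex set" where
  "disc = ball 0 1"

definition dA :: "complex measure" where
  "dA = uniform_measure (lebesgue_on disc) disc"

definition weighted_area :: "(complex \<Rightarrow> real) \<Rightarrow> complex set \<Rightarrow> ennreal" where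
  "weighted_area \<omega> E = (\<integral>\<^sup>+z\<in>E. ennreal (\<omega> z) \<partial>dA)"

definition euclid_disc :: "complex \<Rightarrow> real \<Rightarrow> complex set" where
  "euclid_disc a r = {z \<in> disc. cmod (z - a) < r}"

(* The supremum lives in ennreal, so finiteness of the characteristic includes the finiteness
   of every |B(a,r)|_{1/\<omega>}. *)
definition A2_characteristic :: "(complex \<Rightarrow> real) \<Rightarrow> ennreal" where
  "A2_characteristic \<omega> =
     (SUP (a, r) \<in> disc \<times> {0<..<1}.
        weighted_area \<omega> (euclid_disc a r) * weighted_area (\<lambda>z. inverse (\<omega> z)) (euclid_disc a r)
        / (emeasure dA (euclid_disc a r))\<^sup>2)"

(* A weight is an element of L^1, so positivity is required only almost everywhere. *)
definition A2_weight :: "(complex \<Rightarrow> real) \<Rightarrow> bool" where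
  "A2_weight \<omega> \<longleftrightarrow>
     integrable dA \<omega> \<and> (AE z in dA. 0 < \<omega> z) \<and> A2_characteristic \<omega> < \<infinity>"

(* f is C^2 in the real sense, with first derivative f' and second derivative f'';
   f'' z 1 1 and f'' z \<i> \<i> are the pure second partial derivatives in x and y. *)
definition harmonic_on :: "(complex \<Rightarrow> complex) \<Rightarrow> complex set \<Rightarrow> bool" where
  "harmonic_on f S \<longleftrightarrow>
     (\<exists>(f' :: complex \<Rightarrow> complex \<Rightarrow>\<^sub>L complex)
        (f'' :: complex \<Rightarrow> complex \<Rightarrow>\<^sub>L complex \<Rightarrow>\<^sub>L complex).
        (\<forall>z\<in>S. (f has_derivative blinfun_apply (f' z)) (at z)) \<and>
        (\<forall>z\<in>S. (f' has_derivative blinfun_apply (f'' z)) (at z)) \<and>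
        continuous_on S f'' \<and>
        (\<forall>z\<in>S. blinfun_apply (blinfun_apply (f'' z) 1) 1
               + blinfun_apply (blinfun_apply (f'' z) \<i>) \<i> = 0))"

(* Functions on the disc are represented by total functions on the plane; membership depends
   only on the values on the disc. *)
definition L2h :: "(complex \<Rightarrow> real) \<Rightarrow> (complex \<Rightarrow> complex) set" where
  "L2h \<omega> = {f. harmonic_on f disc \<and> integrable dA (\<lambda>z. (cmod (f z))\<^sup>2 * \<omega> z)}"

definition inner_L2 ::
  "(complex \<Rightarrow> real) \<Rightarrow> (complex \<Rightarrow> complex) \<Rightarrow> (complex \<Rightarrow> complex) \<Rightarrow> complex" where
  "inner_L2 \<omega> f g = (\<integral>z. f z * cnj (g z) * complex_of_real (\<omega> z) \<partial>dA)"

(* repr_kernel \<omega> z w is K_z(w). The defining property determines K_z on the disc only. *)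
definition repr_kernel :: "(complex \<Rightarrow> real) \<Rightarrow> complex \<Rightarrow> complex \<Rightarrow> complex" where
  "repr_kernel \<omega> z = (SOME k. k \<in> L2h \<omega> \<and> (\<forall>f\<in>L2h \<omega>. f z = inner_L2 \<omega> f k))"

definition pseudohyperbolic :: "complex \<Rightarrow> complex \<Rightarrow> real" where
  "pseudohyperbolic a z = cmod ((z - a) / (1 - cnj a * z))"

definition pseudo_disc :: "complex \<Rightarrow> real \<Rightarrow> complex set" where
  "pseudo_disc a r = {z \<in> disc. pseudohyperbolic a z < r}"

definition is_lattice :: "real \<Rightarrow> (nat \<Rightarrow> complex) \<Rightarrow> bool" where
  "is_lattice \<epsilon> a \<longleftrightarrow>
     range a \<subseteq> disc \<and>
     disc = (\<Union>n. pseudo_disc (a n) \<epsilon>) \<and>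
     (INF (n, m) \<in> {(n, m). n \<noteq> m}. pseudohyperbolic (a n) (a m)) \<ge> \<epsilon> / 2"

end

theory Submission
  imports Defs "HOL-Complex_Analysis.Complex_Analysis"
begin

text \<open>
  Write \<open>d n = |D(a n, \<epsilon>)|\<^sub>\<omega>\<close>. The \<open>A\<^sub>2\<close> condition turns the mean value property of harmonic functions
  into weighted pointwise bounds, and the weighted Lipschitz bound shows that for small \<open>\<epsilon>\<close> an
  \<open>\<epsilon>\<close>-lattice is sampling: \<open>\<parallel>f\<parallel>\<^sup>2\<close> is comparable to \<open>\<Sum>n. |f (a n)|\<^sup>2 d n\<close>. So
  \<open>[f, g] = \<Sum>n. f (a n) * cnj (g (a n)) * d n\<close> is an equivalent inner product on the harmonic space. Given \<open>f\<close>,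
  Riesz representation of \<open>g \<mapsto> \<langle>g, f\<rangle>\<close> with respect to \<open>[_, _]\<close> yields \<open>F\<close>, and
  evaluating at \<open>g = K z\<close> gives \<open>f z = \<Sum>n. F (a n) * d n * K (a n) z\<close>, that is,
  \<open>c n = F (a n) * sqrt (d n)\<close>.
\<close>

section \<open>Harmonic functions as sums of holomorphic and antiholomorphic functions\<close>

text \<open>The A2 condition only compares averages over Euclidean balls, so the estimates start
  from the mean value property over solid discs. Cauchy-Schwarz splits \<open>u\<close> into
  \<open>u * sqrt \<omega>\<close> and \<open>1 / sqrt \<omega>\<close>, and A2 pays for the second
  factor. Oscillation is likewise measured by comparing averages over two nearby balls. The delicate
  half of sampling is the lower bound. To control the oscillation of \<open>f\<close> on a lattice
  cell of relative size \<open>\<epsilon>\<close> one needs a ball whose size relative to the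
  distance from the boundary is fixed, and more and more of these balls meet a given point as
  \<open>\<epsilon>\<close> shrinks. The gain \<open>\<epsilon>^2\<close> survives because each ball
  is counted only with the share of its weight that lies in its cell. Oscillation and overlap each
  cost a factor \<open>A\<close>, so \<open>\<epsilon>\<close> is taken proportional to
  \<open>1 / (A + 1)\<close>. The kernel is given by a choice operator and harmonicity by second
  derivatives. Its existence therefore requires completeness of the harmonic space, and limits are
  taken through holomorphic and antiholomorphic parts. The Riesz theorem is proved for an abstract
  complete space because it serves twice: once for the kernel, once for the sampled form.\<close>

lemma second_difference_bound:
  fixes f :: "'a::real_normed_vector \<Rightarrow> 'b::real_normed_vector" and f' :: "'a \<Rightarrow> 'a \<Rightarrow>\<^sub>L 'b"
  assumes "open S" "x \<in> S"
    and f: "\<And>y. y \<in> S \<Longrightarrow> (f has_derivative blinfun_apply (f' y)) (at y)"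
    and f': "(f' has_derivative blinfun_apply (F :: 'a \<Rightarrow>\<^sub>L 'a \<Rightarrow>\<^sub>L 'b)) (at x)"
    and "e > 0"
  shows "\<exists>d>0. \<forall>h. 0 < h \<and> h < d \<longrightarrow>
    norm (f (x + h *\<^sub>R u + h *\<^sub>R v) - f (x + h *\<^sub>R u) - f (x + h *\<^sub>R v) + f x - h\<^sup>2 *\<^sub>R F v u) \<le> e * h\<^sup>2"
proof -
  define K where "K = (norm u + norm v + 1)"
  have K: "K > 0" "norm u \<le> K" "norm v \<le> K" "norm u + norm v \<le> K" by (auto simp: K_def add_nonneg_pos)
  \<comment> \<open>Two linearization errors of \<open>f'\<close> at \<open>x\<close>, each at most
    \<open>e' * (h * K)\<close>, are applied to \<open>u\<close> and integrated over a segment of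
    length \<open>h\<close>; the total \<open>2 * e' * K * K * h^2\<close> is to be
    \<open>e * h^2\<close>.\<close>
  define e' where "e' = e / (2 * K * K)"
  have e': "e' > 0" using \<open>e > 0\<close> K by (auto simp: e'_def)
  obtain s where s: "s > 0" "ball x s \<subseteq> S" using assms by (meson openE)
  obtain d0 where d0: "d0 > 0" "\<And>y. norm (y - x) < d0 \<Longrightarrow> norm (f' y - f' x - F (y - x)) \<le> e' * norm (y - x)"
    using f' e' unfolding has_derivative_at_alt by blast
  define d where "d = min s d0 / K"
  have d: "d > 0" using s d0 K by (auto simp: d_def)
  show ?thesis
  proof (intro exI[of _ d] conjI allI impI d)
    fix h :: real assume "0 < h \<and> h < d"
    then have h: "0 < h" "h * K < s" "h * K < d0" using K by (auto simp: d_def field_simps)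
    have small: "norm (t *\<^sub>R u + c *\<^sub>R v) \<le> h * K" if "0 \<le> t" "t \<le> h" "0 \<le> c" "c \<le> h" for t c
    proof -
      have "norm (t *\<^sub>R u + c *\<^sub>R v) \<le> t * norm u + c * norm v"
        using that norm_triangle_ineq[of "t *\<^sub>R u" "c *\<^sub>R v"] by simp
      also have "\<dots> \<le> h * norm u + h * norm v" using that by (intro add_mono mult_right_mono) auto
      also have "\<dots> \<le> h * K" using K h by (simp flip: distrib_left)
      finally show ?thesis .
    qed
    have inS: "x + t *\<^sub>R u + c *\<^sub>R v \<in> S" if "0 \<le> t" "t \<le> h" "0 \<le> c" "c \<le> h" for t c
      using small[OF that] h s by (auto simp: subset_iff dist_norm norm_minus_commute add.assoc)
    \<comment> \<open>With the expected linear growth subtracted, the derivative of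
      \<open>\<psi>\<close> is a difference of two linearization errors of \<open>f'\<close> at
      \<open>x\<close>, hence small.\<close>
    define \<psi> where "\<psi> t = f (x + t *\<^sub>R u + h *\<^sub>R v) - f (x + t *\<^sub>R u) - t *\<^sub>R (h *\<^sub>R F v u)" for t :: real
    have der: "(\<psi> has_derivative (\<lambda>k. k *\<^sub>R (f' (x + t *\<^sub>R u + h *\<^sub>R v) u - f' (x + t *\<^sub>R u) u - h *\<^sub>R F v u)))
        (at t within {0..h})" if t: "t \<in> {0..h}" for t
    proof -
      have 1: "((\<lambda>t. f (x + t *\<^sub>R u + h *\<^sub>R v)) has_derivative (\<lambda>k. f' (x + t *\<^sub>R u + h *\<^sub>R v) (k *\<^sub>R u))) (at t within {0..h})"
        by (rule has_derivative_compose[OF _ f]) (use inS[of t h] t h in \<open>auto intro!: derivative_eq_intros\<close>)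
      have 2: "((\<lambda>t. f (x + t *\<^sub>R u)) has_derivative (\<lambda>k. f' (x + t *\<^sub>R u) (k *\<^sub>R u))) (at t within {0..h})"
        by (rule has_derivative_compose[OF _ f]) (use inS[of t 0] t h in \<open>auto intro!: derivative_eq_intros\<close>)
      show ?thesis unfolding \<psi>_def
        by (rule derivative_eq_intros 1 2 refl)+ (simp add: fun_eq_iff blinfun.bilinear_simps scaleR_diff_right)
    qed
    have "norm (\<psi> h - \<psi> 0) \<le> (2 * e' * (h * K) * K) * norm (h - 0)"
    proof (rule differentiable_bound[OF _ der])
      fix t assume t: "t \<in> {0..h}"
      let ?A = "f' (x + t *\<^sub>R u + h *\<^sub>R v) - f' x - F (t *\<^sub>R u + h *\<^sub>R v)"
      let ?B = "f' (x + t *\<^sub>R u) - f' x - F (t *\<^sub>R u)"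
      have "norm ?A \<le> e' * norm (t *\<^sub>R u + h *\<^sub>R v)"
        using d0(2)[of "x + (t *\<^sub>R u + h *\<^sub>R v)"] small[of t h] t h by (auto simp: add.assoc)
      also have "\<dots> \<le> e' * (h * K)" using small[of t h] t h e' by (intro mult_left_mono) auto
      finally have A: "norm ?A \<le> e' * (h * K)" .
      have "norm ?B \<le> e' * norm (t *\<^sub>R u)"
        using d0(2)[of "x + (t *\<^sub>R u)"] small[of t 0] t h by auto
      also have "\<dots> \<le> e' * (h * K)" using small[of t 0] t h e' by (intro mult_left_mono) auto
      finally have B: "norm ?B \<le> e' * (h * K)" .
      have eq: "f' (x + t *\<^sub>R u + h *\<^sub>R v) u - f' (x + t *\<^sub>R u) u - h *\<^sub>R F v u = (?A - ?B) u"
        by (simp add: blinfun.bilinear_simps)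
      have "norm ((?A - ?B) u) \<le> norm (?A - ?B) * norm u" by (rule norm_blinfun)
      also have "\<dots> \<le> (e' * (h * K) + e' * (h * K)) * K"
        by (intro mult_mono norm_triangle_le_diff add_mono A B K(2)) (use e' h K in auto)
      finally have le: "norm ((?A - ?B) u) \<le> 2 * e' * (h * K) * K" by (simp add: algebra_simps)
      show "onorm (\<lambda>k. k *\<^sub>R (f' (x + t *\<^sub>R u + h *\<^sub>R v) u - f' (x + t *\<^sub>R u) u - h *\<^sub>R F v u)) \<le> 2 * e' * (h * K) * K"
        unfolding eq by (rule onorm_bound) (use le e' h K in \<open>auto simp: mult_left_mono mult.commute\<close>)
    qed (use h in auto)
    also have "\<dots> = e * h\<^sup>2" using h K by (simp add: e'_def power2_eq_square field_simps)
    finally show "norm (f (x + h *\<^sub>R u + h *\<^sub>R v) - f (x + h *\<^sub>R u) - f (x + h *\<^sub>R v) + f x - h\<^sup>2 *\<^sub>R F v u) \<le> e * h\<^sup>2"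
      by (simp add: \<psi>_def power2_eq_square algebra_simps)
  qed
qed

text \<open>The second difference of \<open>f\<close> does not change when \<open>u\<close> and
  \<open>v\<close> are exchanged, while after division by \<open>h^2\<close> it is close both to
  \<open>F v u\<close> and to \<open>F u v\<close>.\<close>

lemma second_derivative_symmetric:
  fixes f :: "'a::real_normed_vector \<Rightarrow> 'b::real_normed_vector" and f' :: "'a \<Rightarrow> 'a \<Rightarrow>\<^sub>L 'b"
  assumes "open S" "x \<in> S"
    and f: "\<And>y. y \<in> S \<Longrightarrow> (f has_derivative blinfun_apply (f' y)) (at y)"
    and f': "(f' has_derivative blinfun_apply (F :: 'a \<Rightarrow>\<^sub>L 'a \<Rightarrow>\<^sub>L 'b)) (at x)"
  shows "F u v = F v u"
proof -
  have "norm (F v u - F u v) \<le> e" if "e > 0" for e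
  proof -
    from that have e2: "e/2 > 0" by simp
    obtain d1 where d1: "d1 > 0" "\<And>h. 0 < h \<and> h < d1 \<Longrightarrow>
      norm (f (x + h *\<^sub>R u + h *\<^sub>R v) - f (x + h *\<^sub>R u) - f (x + h *\<^sub>R v) + f x - h\<^sup>2 *\<^sub>R F v u) \<le> e/2 * h\<^sup>2"
      using second_difference_bound[OF assms e2] by blast
    obtain d2 where d2: "d2 > 0" "\<And>h. 0 < h \<and> h < d2 \<Longrightarrow>
      norm (f (x + h *\<^sub>R v + h *\<^sub>R u) - f (x + h *\<^sub>R v) - f (x + h *\<^sub>R u) + f x - h\<^sup>2 *\<^sub>R F u v) \<le> e/2 * h\<^sup>2"
      using second_difference_bound[OF assms e2] by blast
    define h where "h = min d1 d2 / 2"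
    have h: "0 < h" "h < d1" "h < d2" using d1(1) d2(1) by (auto simp: h_def)
    let ?X = "f (x + h *\<^sub>R u + h *\<^sub>R v) - f (x + h *\<^sub>R u) - f (x + h *\<^sub>R v) + f x"
    have eq: "f (x + h *\<^sub>R v + h *\<^sub>R u) - f (x + h *\<^sub>R v) - f (x + h *\<^sub>R u) + f x = ?X"
      by (simp add: algebra_simps)
    have "norm ((?X - h\<^sup>2 *\<^sub>R F u v) - (?X - h\<^sup>2 *\<^sub>R F v u)) \<le> e/2 * h\<^sup>2 + e/2 * h\<^sup>2"
      using d1(2)[of h] d2(2)[of h] h eq by (intro norm_triangle_le_diff) auto
    then have "h\<^sup>2 * norm (F v u - F u v) \<le> h\<^sup>2 * e"
      by (simp add: mult.commute flip: scaleR_diff_right)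
    then show ?thesis using h by simp
  qed
  then have "norm (F v u - F u v) = 0"
    by (metis field_sum_of_halves linorder_not_less norm_ge_zero order.antisym dense less_le)
  then show ?thesis by simp
qed

lemma complex_linear_by_basis:
  fixes L :: "complex \<Rightarrow>\<^sub>L complex"
  shows "L v = of_real (Re v) * L 1 + of_real (Im v) * L \<i>"
proof -
  have "v = Re v *\<^sub>R 1 + Im v *\<^sub>R \<i>" by (simp add: complex_eq_iff)
  then have "L v = L (Re v *\<^sub>R 1 + Im v *\<^sub>R \<i>)" by (rule arg_cong)
  also have "\<dots> = Re v *\<^sub>R L 1 + Im v *\<^sub>R L \<i>" by (simp only: blinfun.add_right blinfun.scaleR_right)
  finally show ?thesis by (simp only: scaleR_conv_of_real)
qed

lemma open_disc: "open disc" and convex_disc: "convex disc"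
  by (auto simp: disc_def)

text \<open>The Laplace equation together with symmetry of the second derivative says exactly that
  \<open>p\<close>, the Wirtinger derivative of \<open>f\<close> in \<open>z\<close>, satisfies the
  Cauchy-Riemann equations. It has a primitive \<open>g\<close> on the convex disc, and
  \<open>f - g\<close> then has vanishing derivative in \<open>z\<close>, so its conjugate
  \<open>h\<close> is holomorphic.\<close>

lemma harmonic_decomposition:
  assumes "harmonic_on f disc"
  obtains g h where "g holomorphic_on disc" "h holomorphic_on disc" "\<And>z. z \<in> disc \<Longrightarrow> f z = g z + cnj (h z)"
proof -
  obtain f' :: "complex \<Rightarrow> complex \<Rightarrow>\<^sub>L complex" and f'' :: "complex \<Rightarrow> complex \<Rightarrow>\<^sub>L complex \<Rightarrow>\<^sub>L complex"
    where f: "\<And>z. z \<in> disc \<Longrightarrow> (f has_derivative f' z) (at z)"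
      and f': "\<And>z. z \<in> disc \<Longrightarrow> (f' has_derivative f'' z) (at z)"
      and lap: "\<And>z. z \<in> disc \<Longrightarrow> f'' z 1 1 + f'' z \<i> \<i> = 0"
    using assms unfolding harmonic_on_def by blast
  have sym: "f'' z u v = f'' z v u" if "z \<in> disc" for z u v
    by (rule second_derivative_symmetric[OF open_disc that f f'[OF that]])
  define p where "p z = (f' z 1 - \<i> * f' z \<i>) / 2" for z
  have "(p has_field_derivative (f'' z 1 1 - \<i> * f'' z 1 \<i>) / 2) (at z)" if z: "z \<in> disc" for z
  proof -
    have "(p has_derivative (\<lambda>v. (f'' z v 1 - \<i> * f'' z v \<i>) / 2)) (at z)"
      unfolding p_def by (rule derivative_eq_intros f'[OF z] refl | simp)+
    moreover have "(\<lambda>v. (f'' z v 1 - \<i> * f'' z v \<i>) / 2) = (*) ((f'' z 1 1 - \<i> * f'' z 1 \<i>) / 2)"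
    proof
      fix v
      have i: "f'' z \<i> 1 = f'' z 1 \<i>" using sym[OF z] by blast
      have ii: "f'' z \<i> \<i> = - f'' z 1 1" using lap[OF z] by (simp add: add_eq_0_iff)
      \<comment> \<open>Composing \<open>f'' z\<close> with evaluation at \<open>w\<close> gives a
        real-linear map in the first argument, to which the expansion in the basis \<open>1\<close>,
        \<open>\<i>\<close> applies.\<close>
      have "f'' z v w = of_real (Re v) * f'' z 1 w + of_real (Im v) * f'' z \<i> w" for w
        using complex_linear_by_basis[of "blinfun_compose (Blinfun (\<lambda>T. blinfun_apply T w)) (f'' z)" v]
        by (simp add: bounded_linear_Blinfun_apply blinfun.bounded_linear_left)
      then have "(f'' z v 1 - \<i> * f'' z v \<i>) / 2 = ((of_real (Re v) + \<i> * of_real (Im v)) * f'' z 1 1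
          - \<i> * (of_real (Re v) + \<i> * of_real (Im v)) * f'' z 1 \<i>) / 2"
        by (simp add: i ii algebra_simps)
      also have "of_real (Re v) + \<i> * of_real (Im v) = v" by (simp add: complex_eq_iff)
      finally show "(f'' z v 1 - \<i> * f'' z v \<i>) / 2 = (f'' z 1 1 - \<i> * f'' z 1 \<i>) / 2 * v"
        by (simp add: algebra_simps)
    qed
    ultimately show ?thesis by (simp add: has_field_derivative_def)
  qed
  then have "p holomorphic_on disc" using holomorphic_on_open open_disc by blast
  then obtain g where g: "\<And>z. z \<in> disc \<Longrightarrow> (g has_field_derivative p z) (at z within disc)"
    using holomorphic_convex_primitive' convex_disc open_disc by blast
  have g': "(g has_field_derivative p z) (at z)" if "z \<in> disc" for z
    using g[OF that] at_within_open[OF that open_disc] by simp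
  define h where "h z = cnj (f z - g z)" for z
  have "(h has_field_derivative cnj ((f' z 1 + \<i> * f' z \<i>) / 2)) (at z)" if z: "z \<in> disc" for z
  proof -
    have "((\<lambda>z. f z - g z) has_derivative (\<lambda>v. f' z v - p z * v)) (at z)"
      using has_derivative_diff[OF f[OF z]] g'[OF z] by (simp add: has_field_derivative_def)
    then have "(h has_derivative (\<lambda>v. cnj (f' z v - p z * v))) (at z)"
      unfolding h_def by (rule has_derivative_cnj)
    moreover have "(\<lambda>v. cnj (f' z v - p z * v)) = (*) (cnj ((f' z 1 + \<i> * f' z \<i>) / 2))"
    proof
      fix v
      have "f' z v - p z * (of_real (Re v) + \<i> * of_real (Im v)) = (f' z 1 + \<i> * f' z \<i>) / 2 * (of_real (Re v) - \<i> * of_real (Im v))"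
        by (subst complex_linear_by_basis) (simp add: p_def field_simps)
      moreover have "of_real (Re v) + \<i> * of_real (Im v) = v" "of_real (Re v) - \<i> * of_real (Im v) = cnj v"
        by (simp_all add: complex_eq_iff)
      ultimately show "cnj (f' z v - p z * v) = cnj ((f' z 1 + \<i> * f' z \<i>) / 2) * v"
        by (metis complex_cnj_cnj complex_cnj_mult)
    qed
    ultimately show ?thesis by (simp add: has_field_derivative_def)
  qed
  then have "h holomorphic_on disc" using holomorphic_on_open open_disc by blast
  moreover have "g holomorphic_on disc" using g' holomorphic_on_open open_disc by blast
  moreover have "f z = g z + cnj (h z)" for z by (simp add: h_def)
  ultimately show ?thesis using that by blast
qed

text \<open>The converse of the decomposition, and the way harmonicity is established for sums,
  multiples and limits. The derivatives have to be exhibited as bounded linear maps: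
  \<open>M c\<close> is multiplication by \<open>c\<close>, and \<open>N c\<close> is multiplication
  followed by conjugation. The Laplace equation reduces to \<open>\<i> * \<i> = -1\<close>.\<close>

lemma harmonic_on_holomorphic_plus_cnj:
  assumes "g holomorphic_on disc" "h holomorphic_on disc" "\<And>z. z \<in> disc \<Longrightarrow> f z = g z + cnj (h z)"
  shows "harmonic_on f disc"
proof -
  define M :: "complex \<Rightarrow> complex \<Rightarrow>\<^sub>L complex" where "M = blinfun_mult_right"
  define C :: "complex \<Rightarrow>\<^sub>L complex" where "C = Blinfun cnj"
  have C [simp]: "blinfun_apply C = cnj" unfolding C_def by (rule bounded_linear_Blinfun_apply[OF bounded_linear_cnj])
  define N where "N c = C o\<^sub>L M c" for c
  have Mb: "bounded_linear M" unfolding M_def by (rule bounded_linear_blinfun_mult_right)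
  have Nb: "bounded_linear N" unfolding N_def
    using bounded_linear_compose[OF bounded_bilinear.bounded_linear_right[OF bounded_bilinear_blinfun_compose] Mb] .
  have Ms [simp]: "M c v = c * v" for c v by (simp add: M_def)
  have Ns [simp]: "N c v = cnj (c * v)" for c v by (simp add: N_def)
  define MM where "MM = Blinfun M"
  define NN where "NN = Blinfun N"
  have MM [simp]: "blinfun_apply MM = M" by (simp add: MM_def bounded_linear_Blinfun_apply Mb)
  have NN [simp]: "blinfun_apply NN = N" by (simp add: NN_def bounded_linear_Blinfun_apply Nb)
  have g1: "deriv g holomorphic_on disc" "deriv h holomorphic_on disc"
    using assms open_disc by (auto intro: holomorphic_deriv)
  then have g2: "deriv (deriv g) holomorphic_on disc" "deriv (deriv h) holomorphic_on disc"
    using open_disc by (auto intro: holomorphic_deriv)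
  have d: "(k has_derivative (*) (deriv k z)) (at z)" if "k holomorphic_on disc" "z \<in> disc" for k z
    using holomorphic_derivI[OF that(1) open_disc that(2)] by (simp add: has_field_derivative_def)
  define f' where "f' z = M (deriv g z) + N (deriv h z)" for z
  define f'' where "f'' z = (MM o\<^sub>L M (deriv (deriv g) z)) + (NN o\<^sub>L M (deriv (deriv h) z))" for z
  have 1: "(f has_derivative f' z) (at z)" if z: "z \<in> disc" for z
  proof -
    have "((\<lambda>z. g z + cnj (h z)) has_derivative (\<lambda>v. deriv g z * v + cnj (deriv h z * v))) (at z)"
      by (rule derivative_intros has_derivative_cnj d assms z)+
    then have "(f has_derivative (\<lambda>v. deriv g z * v + cnj (deriv h z * v))) (at z)"
      by (rule has_derivative_transform_within_open[OF _ open_disc z]) (simp add: assms)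
    then show ?thesis by (simp add: f'_def blinfun.bilinear_simps[abs_def])
  qed
  have 2: "(f' has_derivative f'' z) (at z)" if z: "z \<in> disc" for z
  proof -
    have "(f' has_derivative (\<lambda>v. M (deriv (deriv g) z * v) + N (deriv (deriv h) z * v))) (at z)"
      unfolding f'_def
      by (intro has_derivative_add bounded_linear.has_derivative[OF Mb] bounded_linear.has_derivative[OF Nb] d g1 z)
    moreover have "blinfun_apply (f'' z) = (\<lambda>v. M (deriv (deriv g) z * v) + N (deriv (deriv h) z * v))"
      by (rule ext) (simp add: f''_def blinfun.bilinear_simps)
    ultimately show ?thesis by simp
  qed
  have 3: "continuous_on disc f''" unfolding f''_def
    by (intro continuous_intros bounded_linear.continuous_on[OF Mb]
        bounded_linear.continuous_on[OF bounded_bilinear.bounded_linear_right[OF bounded_bilinear_blinfun_compose]]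
        holomorphic_on_imp_continuous_on g2)
  have 4: "f'' z 1 1 + f'' z \<i> \<i> = 0" for z
    by (simp add: f''_def blinfun.bilinear_simps mult.assoc)
  show ?thesis unfolding harmonic_on_def using 1 2 3 4 by blast
qed

section \<open>Rotation invariance and the mean value property\<close>

text \<open>Uniqueness of Haar measure: apply Fubini to \<open>1\<^sub>A y * 1\<^sub>B x\<close>, shifting first \<open>y\<close> by \<open>x\<close>
  and then \<open>x\<close> by \<open>- y\<close>.\<close>

lemma lborel_invariant_unique:
  fixes M :: "'a::euclidean_space measure"
  assumes [measurable_cong]: "sets M = sets borel" and "sigma_finite_measure M"
    and inv: "\<And>a. distr M borel ((+) a) = M"
    and B [measurable]: "B \<in> sets borel" "uminus ` B = B" "emeasure M B = emeasure lborel B"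
    and pos: "0 < emeasure lborel B" "emeasure lborel B < \<infinity>"
  shows "M = lborel"
proof (rule measure_eqI)
  fix A assume "A \<in> sets M"
  then have A [measurable]: "A \<in> sets borel" using assms by simp
  interpret M: sigma_finite_measure M by fact
  interpret P: pair_sigma_finite M lborel ..
  have sh: "(\<integral>\<^sup>+y. F (x + y) \<partial>M) = (\<integral>\<^sup>+y. F y \<partial>M)" if [measurable]: "F \<in> borel_measurable borel" for F x
    by (subst (2) inv[of x, symmetric]) (simp add: nn_integral_distr)
  have shl: "(\<integral>\<^sup>+y. F (x + y) \<partial>lborel) = (\<integral>\<^sup>+y. F y \<partial>lborel)" if [measurable]: "F \<in> borel_measurable borel" for F :: "'a \<Rightarrow> ennreal" and x
    by (subst (2) lborel_distr_plus[of x, symmetric]) (simp add: nn_integral_distr)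
  have Bneg: "- x \<in> B \<longleftrightarrow> x \<in> B" for x
    by (metis B(2) imageI minus_minus)
  have "emeasure M A * emeasure lborel B = (\<integral>\<^sup>+x. \<integral>\<^sup>+y. indicator A y * indicator B x \<partial>M \<partial>lborel)"
    by (simp add: nn_integral_cmult nn_integral_multc)
  also have "\<dots> = (\<integral>\<^sup>+x. \<integral>\<^sup>+y. indicator A (x + y) * indicator B x \<partial>M \<partial>lborel)"
    using sh[of "indicator A"] by (simp add: nn_integral_multc)
  also have "\<dots> = (\<integral>\<^sup>+y. \<integral>\<^sup>+x. indicator A (x + y) * indicator B x \<partial>lborel \<partial>M)"
    by (rule P.Fubini') simp
  also have "\<dots> = (\<integral>\<^sup>+y. \<integral>\<^sup>+x. indicator A x * indicator B (x - y) \<partial>lborel \<partial>M)"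
  proof (rule nn_integral_cong)
    fix y
    show "(\<integral>\<^sup>+x. indicator A (x + y) * indicator B x \<partial>lborel) = (\<integral>\<^sup>+x. indicator A x * indicator B (x - y) \<partial>lborel)"
      using shl[of "\<lambda>x. indicator A x * indicator B (x - y)" y] by (simp add: add.commute)
  qed
  also have "\<dots> = (\<integral>\<^sup>+x. \<integral>\<^sup>+y. indicator A x * indicator B (x - y) \<partial>M \<partial>lborel)"
    by (rule P.Fubini'[symmetric]) simp
  also have "\<dots> = (\<integral>\<^sup>+x. indicator A x * emeasure M B \<partial>lborel)"
  proof (rule nn_integral_cong)
    fix x
    \<comment> \<open>Symmetry of \<open>B\<close> turns the reflected set into a translate, to
      which invariance of \<open>M\<close> applies.\<close>
    have "(\<integral>\<^sup>+y. indicator B (x - y) \<partial>M) = (\<integral>\<^sup>+y. indicator B (- x + y) \<partial>M)"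
      using Bneg by (intro nn_integral_cong) (metis (no_types) indicator_simps minus_diff_eq uminus_add_conv_diff)
    also have "\<dots> = emeasure M B"
      using sh[of "indicator B" "- x"] by simp
    finally show "(\<integral>\<^sup>+y. indicator A x * indicator B (x - y) \<partial>M) = indicator A x * emeasure M B"
      by (simp add: nn_integral_cmult)
  qed
  also have "\<dots> = emeasure lborel A * emeasure lborel B"
    using B by (simp add: nn_integral_multc)
  finally have eq: "emeasure M A * emeasure lborel B = emeasure lborel A * emeasure lborel B" .
  have "X = X * emeasure lborel B / emeasure lborel B" for X
    by (rule mult_divide_eq_ennreal[symmetric]) (use pos in auto)
  then show "emeasure M A = emeasure lborel A"
    by (metis eq)
qed (use assms in auto)

text \<open>The image measure is again translation invariant, because
  \<open>a + c * x = c * (a / c + x)\<close>. Uniqueness applies with the unit ball as normalizing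
  set, since a rotation maps it to itself.\<close>

lemma lborel_distr_rotation:
  fixes c :: complex
  assumes c: "cmod c = 1"
  shows "distr lborel borel ((*) c) = lborel"
proof (rule lborel_invariant_unique[where B = "ball 0 1"])
  have c0: "c \<noteq> 0" using c by auto
  have pre: "((*) c) -` ball 0 1 = ball 0 1" using c by (auto simp: norm_mult)
  show "sigma_finite_measure (distr lborel borel ((*) c))"
  proof
    show "\<exists>A::complex set set. countable A \<and> A \<subseteq> sets (distr lborel borel ((*) c)) \<and>
       \<Union>A = space (distr lborel borel ((*) c)) \<and> (\<forall>a\<in>A. emeasure (distr lborel borel ((*) c)) a \<noteq> \<infinity>)"
    proof (intro exI[of _ "range (\<lambda>n::nat. ball 0 (real n))"] conjI ballI)
      show "\<Union> (range (\<lambda>n::nat. ball 0 (real n))) = space (distr lborel borel ((*) c))"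
        by (auto intro: reals_Archimedean2)
      fix a assume "a \<in> range (\<lambda>n::nat. ball (0::complex) (real n))"
      then obtain n where a: "a = ball 0 (real n)" by auto
      have "((*) c) -` a = a" using c by (auto simp: norm_mult a)
      moreover have "emeasure lborel a < \<infinity>" unfolding a by (rule emeasure_bounded_finite) auto
      ultimately show "emeasure (distr lborel borel ((*) c)) a \<noteq> \<infinity>"
        by (simp add: emeasure_distr a)
    qed auto
  qed
  show "distr (distr lborel borel ((*) c)) borel ((+) a) = distr lborel borel ((*) c)" for a
  proof -
    have "(+) a \<circ> (*) c = (*) c \<circ> (+) (a / c)" using c0 by (auto simp: field_simps)
    then have "distr (distr lborel borel ((*) c)) borel ((+) a) = distr (distr lborel borel ((+) (a/c))) borel ((*) c)"
      by (simp add: distr_distr)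
    then show ?thesis by (simp add: lborel_distr_plus)
  qed
  show "emeasure (distr lborel borel ((*) c)) (ball 0 1) = emeasure lborel (ball (0::complex) 1)"
    by (subst emeasure_distr) (auto simp: pre)
  show "uminus ` ball 0 1 = ball (0::complex) 1"
    by (auto simp: image_iff intro!: bexI[of _ "- _"])
  show "0 < emeasure lborel (ball (0::complex) 1)" "emeasure lborel (ball (0::complex) 1) < \<infinity>"
    by (simp_all add: emeasure_ball unit_ball_vol_2)
qed auto

text \<open>Rotation by an \<open>n\<close>-th root of \<open>-1\<close> preserves the centred ball
  and the measure but changes the sign of \<open>z ^ n\<close>, so the integral equals its own
  negative.\<close>

lemma integral_ball_monomial:
  assumes "n > 0"
  shows "(LINT z:ball a r|lborel. (z - a) ^ n) = (0::complex)"
proof -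
  define I :: complex where "I = (LINT z|lborel. indicator (ball 0 r) z *\<^sub>R z ^ n)"
  have "(LINT z:ball a r|lborel. (z - a) ^ n) = (LINT z|distr lborel borel ((+) a). indicator (ball a r) z *\<^sub>R (z - a) ^ n)"
    unfolding set_lebesgue_integral_def lborel_distr_plus ..
  also have "\<dots> = I" unfolding I_def
    by (subst integral_distr) (auto intro!: Bochner_Integration.integral_cong simp: indicator_def dist_norm)
  finally have eq: "(LINT z:ball a r|lborel. (z - a) ^ n) = I" .
  define c where "c = cis (pi / n)"
  have "c ^ n = cis (real n * (pi / real n))" unfolding c_def by (rule Complex.DeMoivre)
  also have "\<dots> = -1" using assms by simp
  finally have c: "c ^ n = -1" "cmod c = 1" by (assumption, simp only: c_def norm_cis)
  have "I = (LINT z|distr lborel borel ((*) c). indicator (ball 0 r) z *\<^sub>R z ^ n)"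
    unfolding I_def lborel_distr_rotation[OF c(2)] ..
  also have "\<dots> = (LINT z|lborel. indicator (ball 0 r) z *\<^sub>R (- (z ^ n)))"
    by (subst integral_distr) (auto intro!: Bochner_Integration.integral_cong simp: indicator_def dist_norm norm_mult c power_mult_distrib)
  also have "\<dots> = - I" by (simp add: I_def)
  finally show ?thesis using eq by simp
qed

lemma content_ball_complex: "r \<ge> 0 \<Longrightarrow> measure lborel (ball (a::complex) r) = pi * r\<^sup>2"
  by (simp add: content_ball unit_ball_vol_2)

text \<open>Integrate the Taylor series at the centre term by term; only the constant term survives
  \<open>integral_ball_monomial\<close>.\<close>

lemma holomorphic_mean_value:
  fixes f :: "complex \<Rightarrow> complex"
  assumes hol: "f holomorphic_on ball a R" and R: "r < R" and "r > 0"
  shows "(LINT z:ball a r|lborel. f z) = pi * r\<^sup>2 * f a"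
proof -
  define c where "c n = (deriv ^^ n) f a / fact n" for n
  have sums: "(\<lambda>n. c n * (w - a) ^ n) sums f w" if "w \<in> ball a R" for w
    unfolding c_def by (rule holomorphic_power_series[OF hol that])
  have summ: "summable (\<lambda>n. norm (c n) * r ^ n)"
  proof -
    \<comment> \<open>Convergence at a radius strictly between \<open>r\<close> and \<open>R\<close>
      yields absolute convergence at \<open>r\<close>, which dominates the series on the whole
      ball.\<close>
    define \<rho> where "\<rho> = (r + R) / 2"
    have \<rho>: "r < \<rho>" "\<rho> < R" using R by (auto simp: \<rho>_def)
    then have "summable (\<lambda>n. c n * of_real \<rho> ^ n)"
      using sums[of "a + of_real \<rho>"] \<open>r > 0\<close> by (auto simp: dist_norm sums_iff)
    then have "summable (\<lambda>n. norm (c n * of_real r ^ n))"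
      by (rule powser_insidea) (use \<rho> \<open>r > 0\<close> in auto)
    then show ?thesis using \<open>r > 0\<close> by (simp add: norm_mult norm_power)
  qed
  have int0: "set_integrable lborel (ball a r) (\<lambda>z. c n * (z - a) ^ n)" for n
    by (rule set_integrable_subset[OF borel_integrable_compact[of "cball a r", folded set_integrable_def]])
      (auto intro!: continuous_intros)
  have bd: "norm (indicator (ball a r) z *\<^sub>R (c n * (z - a) ^ n)) \<le> norm (c n) * r ^ n" for n z
    using \<open>r > 0\<close> by (auto simp: indicator_def norm_mult norm_power dist_norm norm_minus_commute intro!: mult_left_mono power_mono)
  have bd2: "norm (LINT z:ball a r|lborel. norm (c n * (z - a) ^ n)) \<le> norm (c n) * r ^ n * (pi * r\<^sup>2)" for n
  proof -
    have "(LINT z:ball a r|lborel. norm (c n * (z - a) ^ n)) \<le> (LINT z:ball a r|lborel. norm (c n) * r ^ n)"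
      by (rule set_integral_mono[OF set_integrable_norm[OF int0]])
        (use \<open>r > 0\<close> in \<open>auto simp: set_integrable_def norm_mult norm_power dist_norm norm_minus_commute intro!: mult_left_mono power_mono integrable_real_indicator
            emeasure_bounded_finite\<close>)
    also have "(LINT z:ball a r|lborel. norm (c n) * r ^ n) = norm (c n) * r ^ n * (pi * r\<^sup>2)"
      using \<open>r > 0\<close> by (simp add: set_lebesgue_integral_def content_ball_complex)
    finally have "(LINT z:ball a r|lborel. norm (c n * (z - a) ^ n)) \<le> norm (c n) * r ^ n * (pi * r\<^sup>2)" .
    moreover have "(LINT z:ball a r|lborel. norm (c n * (z - a) ^ n)) \<ge> 0"
      unfolding set_lebesgue_integral_def by (intro integral_nonneg_AE) auto
    ultimately show ?thesis by simp
  qed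
  have "(LINT z:ball a r|lborel. f z) = (LINT z|lborel. (\<Sum>n. indicator (ball a r) z *\<^sub>R (c n * (z - a) ^ n)))"
    unfolding set_lebesgue_integral_def
  proof (intro Bochner_Integration.integral_cong refl)
    fix z show "indicator (ball a r) z *\<^sub>R f z = (\<Sum>n. indicator (ball a r) z *\<^sub>R (c n * (z - a) ^ n))"
      using sums[of z] R by (auto simp: indicator_def sums_iff)
  qed
  also have "\<dots> = (\<Sum>n. LINT z|lborel. indicator (ball a r) z *\<^sub>R (c n * (z - a) ^ n))"
  proof (rule integral_suminf)
    show "integrable lborel (\<lambda>z. indicator (ball a r) z *\<^sub>R (c n * (z - a) ^ n))" for n
      using int0 by (simp add: set_integrable_def)
    show "AE z in lborel. summable (\<lambda>n. norm (indicator (ball a r) z *\<^sub>R (c n * (z - a) ^ n)))"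
      using bd by (intro AE_I2 summable_comparison_test'[OF summ]) auto
    show "summable (\<lambda>n. LINT z|lborel. norm (indicator (ball a r) z *\<^sub>R (c n * (z - a) ^ n)))"
      using bd2 by (intro summable_comparison_test'[OF summable_mult2[OF summ, of "pi * r\<^sup>2"]])
        (auto simp: set_lebesgue_integral_def)
  qed
  also have "\<dots> = (\<Sum>n. if n = 0 then pi * r\<^sup>2 * f a else 0)"
  proof (intro suminf_cong)
    fix n
    have "(LINT z|lborel. indicator (ball a r) z *\<^sub>R (c n * (z - a) ^ n)) = c n * (LINT z:ball a r|lborel. (z - a) ^ n)"
      unfolding set_lebesgue_integral_def by (subst integral_mult_right_zero[symmetric]) (simp add: mult.left_commute mult_scaleR_right)
    also have "\<dots> = (if n = 0 then pi * r\<^sup>2 * f a else 0)"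
    proof (cases "n = 0")
      case True
      then show ?thesis using \<open>r > 0\<close>
        by (simp add: set_lebesgue_integral_def content_ball_complex c_def scaleR_conv_of_real)
    qed (simp add: integral_ball_monomial)
    finally show "(LINT z|lborel. indicator (ball a r) z *\<^sub>R (c n * (z - a) ^ n)) = (if n = 0 then pi * r\<^sup>2 * f a else 0)" .
  qed
  also have "\<dots> = pi * r\<^sup>2 * f a"
    using sums_single[of 0 "\<lambda>n. pi * r\<^sup>2 * f a :: complex"] by (simp add: sums_iff)
  finally show ?thesis .
qed

section \<open>The normalized area measure on the disc\<close>

lemma space_dA [simp]: "space dA = disc"
  by (simp add: dA_def)

lemma sets_dA: "sets dA = sets (lebesgue_on disc)"
  by (simp add: dA_def)

lemma sets_dA_borel: "A \<in> sets borel \<Longrightarrow> A \<subseteq> disc \<Longrightarrow> A \<in> sets dA"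
  by (auto simp: sets_dA sets_restrict_space image_iff intro!: bexI[of _ A])

lemma emeasure_lebesgue_on_disc: "emeasure (lebesgue_on disc) disc = ennreal pi"
proof -
  have "emeasure (lebesgue_on disc) disc = emeasure lebesgue disc"
    by (subst emeasure_restrict_space) (auto simp: disc_def)
  also have "\<dots> = ennreal pi" by (simp add: disc_def emeasure_ball unit_ball_vol_2)
  finally show ?thesis .
qed

lemma sets_lebesgue_disc [simp]: "disc \<in> sets lebesgue" "disc \<in> sets (lebesgue_on disc)"
  by (auto simp: disc_def sets_restrict_space)

lemma dA_eq_density: "dA = density (lebesgue_on disc) (\<lambda>_. ennreal (1 / pi))"
  unfolding dA_def uniform_measure_def
proof (rule density_cong)
  show "AE x in lebesgue_on disc. indicator disc x / emeasure (lebesgue_on disc) disc = ennreal (1 / pi)"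
    by (auto simp: emeasure_lebesgue_on_disc divide_ennreal intro!: AE_I2 simp flip: ennreal_1)
qed (simp_all add: divide_ennreal_def emeasure_lebesgue_on_disc borel_measurable_times_ennreal borel_measurable_indicator)

lemma emeasure_dA_disc: "emeasure dA disc = 1"
  by (simp add: dA_def emeasure_lebesgue_on_disc ennreal_divide_self)

lemma finite_measure_dA: "finite_measure dA"
  by (rule finite_measureI) (simp add: emeasure_dA_disc)

lemma emeasure_dA_ball:
  assumes "ball a r \<subseteq> disc" "r \<ge> 0"
  shows "emeasure dA (ball a r) = ennreal (r\<^sup>2)"
proof -
  have s: "ball a r \<in> sets (lebesgue_on disc)" using sets_dA_borel[of "ball a r"] assms by (simp add: sets_dA)
  have "emeasure dA (ball a r) = emeasure (lebesgue_on disc) (disc \<inter> ball a r) / ennreal pi"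
    unfolding dA_def using s by (simp add: emeasure_lebesgue_on_disc)
  also have "disc \<inter> ball a r = ball a r" using assms by auto
  also have "emeasure (lebesgue_on disc) (ball a r) = ennreal (pi * r\<^sup>2)"
    using assms by (subst emeasure_restrict_space) (auto simp: emeasure_ball unit_ball_vol_2)
  finally show ?thesis by (simp add: divide_ennreal)
qed

lemma set_integral_dA_ball:
  fixes f :: "complex \<Rightarrow> complex"
  assumes "ball a r \<subseteq> disc" "continuous_on (ball a r) f"
  shows "(LINT z:ball a r|dA. f z) = (LINT z:ball a r|lborel. f z) / pi"
proof -
  have m: "(\<lambda>z. indicator (ball a r) z *\<^sub>R f z) \<in> borel_measurable borel"
    using borel_measurable_continuous_on_indicator[OF _ assms(2)] by simp
  then have m': "(\<lambda>z. indicator (ball a r) z *\<^sub>R f z) \<in> borel_measurable lebesgue"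
    by (simp add: measurable_completion)
  have "(LINT z:ball a r|dA. f z) = (1/pi) *\<^sub>R (LINT z|lebesgue_on disc. indicator (ball a r) z *\<^sub>R f z)"
    unfolding set_lebesgue_integral_def dA_eq_density
    by (subst integral_density) (auto intro: measurable_restrict_space1 m' simp del: scaleR_scaleR)
  also have "(LINT z|lebesgue_on disc. indicator (ball a r) z *\<^sub>R f z) = (LINT z|lebesgue. indicator disc z *\<^sub>R indicator (ball a r) z *\<^sub>R f z)"
    by (rule integral_restrict_space) auto
  also have "\<dots> = (LINT z|lebesgue. indicator (ball a r) z *\<^sub>R f z)"
    using assms by (intro Bochner_Integration.integral_cong) (auto simp: indicator_def)
  also have "\<dots> = (LINT z|lborel. indicator (ball a r) z *\<^sub>R f z)"
    by (rule integral_completion) (use m in simp)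
  finally show ?thesis by (simp add: set_lebesgue_integral_def scaleR_conv_of_real)
qed

lemma harmonic_continuous_on: "harmonic_on f disc \<Longrightarrow> continuous_on disc f"
  unfolding harmonic_on_def
  by (meson continuous_at_imp_continuous_on has_derivative_continuous)

text \<open>Apply the holomorphic case to both parts of the decomposition, as conjugation commutes
  with integration. The normalization of \<open>dA\<close> cancels the factor
  \<open>pi\<close>.\<close>

lemma harmonic_mean_value:
  assumes "harmonic_on f disc" "cmod a + r < 1" "r > 0"
  shows "(LINT z:ball a r|dA. f z) = r\<^sup>2 * f a"
proof -
  obtain g h where gh: "g holomorphic_on disc" "h holomorphic_on disc" "\<And>z. z \<in> disc \<Longrightarrow> f z = g z + cnj (h z)"
    using harmonic_decomposition[OF assms(1)] by metis
  \<comment> \<open>The largest ball about \<open>a\<close> inside the disc provides the holomorphy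
    on a radius beyond \<open>r\<close> that the holomorphic mean value property asks for.\<close>
  have sub': "ball a (1 - cmod a) \<subseteq> disc"
  proof
    fix z assume "z \<in> ball a (1 - cmod a)"
    then show "z \<in> disc" using norm_triangle_sub[of z a] by (auto simp: disc_def dist_norm norm_minus_commute)
  qed
  have csub: "cball a r \<subseteq> ball a (1 - cmod a)" using assms by auto
  then have sub: "ball a r \<subseteq> disc" "a \<in> disc" "cball a r \<subseteq> disc" using assms sub' by auto
  have int: "set_integrable lborel (ball a r) k" if "continuous_on disc k" for k :: "complex \<Rightarrow> complex"
    by (rule set_integrable_subset[OF borel_integrable_compact[of "cball a r", folded set_integrable_def]])
      (use that sub continuous_on_subset in auto)
  have cont: "continuous_on disc g" "continuous_on disc h" "continuous_on disc (\<lambda>z. cnj (h z))"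
    using gh holomorphic_on_imp_continuous_on continuous_on_cnj by auto
  have "(LINT z:ball a r|lborel. f z) = (LINT z:ball a r|lborel. g z + cnj (h z))"
    by (rule set_lebesgue_integral_cong) (use gh sub in auto)
  also have "\<dots> = (LINT z:ball a r|lborel. g z) + (LINT z:ball a r|lborel. cnj (h z))"
    by (rule set_integral_add) (intro int cont)+
  also have "(LINT z:ball a r|lborel. cnj (h z)) = cnj (LINT z:ball a r|lborel. h z)"
    unfolding set_lebesgue_integral_def
    by (simp add: scaleR_conv_of_real flip: Bochner_Integration.integral_cnj)
  finally have "(LINT z:ball a r|lborel. f z) = pi * r\<^sup>2 * f a"
    using holomorphic_mean_value[OF holomorphic_on_subset[OF gh(1) sub']] holomorphic_mean_value[OF holomorphic_on_subset[OF gh(2) sub']] assms gh(3)[OF sub(2)]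
    by (simp add: algebra_simps)
  moreover have "(LINT z:ball a r|dA. f z) = (LINT z:ball a r|lborel. f z) / pi"
    using set_integral_dA_ball[OF sub(1)] harmonic_continuous_on[OF assms(1)] continuous_on_subset sub(1) by blast
  ultimately show ?thesis by simp
qed

section \<open>Weighted estimates\<close>

lemma ball_subset_disc: "cmod a + r \<le> 1 \<Longrightarrow> ball a r \<subseteq> disc"
proof
  fix z assume "cmod a + r \<le> 1" "z \<in> ball a r"
  then show "z \<in> disc" using norm_triangle_sub[of z a] by (auto simp: disc_def dist_norm norm_minus_commute)
qed

lemma sets_dA_ball: "cmod a + r \<le> 1 \<Longrightarrow> ball a r \<in> sets dA"
  using sets_dA_borel[OF _ ball_subset_disc] by auto

lemma emeasure_dA_ball': "cmod a + r \<le> 1 \<Longrightarrow> r \<ge> 0 \<Longrightarrow> emeasure dA (ball a r) = ennreal (r\<^sup>2)"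
  using emeasure_dA_ball[OF ball_subset_disc] .

lemma measure_dA_ball: "cmod a + r \<le> 1 \<Longrightarrow> r \<ge> 0 \<Longrightarrow> measure dA (ball a r) = r\<^sup>2"
  by (simp add: measure_def emeasure_dA_ball')

lemma measurable_dA_continuous:
  fixes f :: "complex \<Rightarrow> 'b::real_normed_vector"
  assumes "continuous_on disc f"
  shows "f \<in> borel_measurable dA"
proof -
  have "f \<in> borel_measurable (restrict_space borel disc)"
    using assms by (rule borel_measurable_continuous_on_restrict)
  then have "f \<in> borel_measurable (restrict_space lebesgue disc)"
    using measurable_restrict_mono measurable_completion
    by (simp add: borel_measurable_continuous_on_restrict measurable_def space_restrict_space sets_restrict_space) force
  then show ?thesis by (simp add: measurable_cong_sets[OF sets_dA refl])
qed

lemma set_integrable_dA_ball: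
  fixes f :: "complex \<Rightarrow> complex"
  assumes "continuous_on disc f" "cmod a + r < 1" "r > 0"
  shows "set_integrable dA (ball a r) f"
proof -
  have sub: "cball a r \<subseteq> disc"
  proof
    fix z assume "z \<in> cball a r"
    then show "z \<in> disc" using assms(2) norm_triangle_sub[of z a] by (auto simp: disc_def dist_norm norm_minus_commute)
  qed
  have "compact (f ` cball a r)" using assms sub by (meson compact_cball compact_continuous_image continuous_on_subset)
  then obtain K where K: "\<And>z. z \<in> cball a r \<Longrightarrow> cmod (f z) \<le> K"
    by (meson bounded_iff compact_imp_bounded image_eqI)
  have m: "f \<in> borel_measurable dA" by (rule measurable_dA_continuous) fact
  have b: "ball a r \<in> sets dA" using assms by (intro sets_dA_ball) simp
  show ?thesis unfolding set_integrable_def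
    by (rule finite_measure.integrable_const_bound[OF finite_measure_dA, of _ "max K 0"])
      (use K m b in \<open>auto simp: le_max_iff_disj indicator_simps split: split_indicator intro!: AE_I2 borel_measurable_scaleR\<close>)
qed

lemma harmonic_bound_average:
  assumes "harmonic_on f disc" "cmod a + r < 1" "r > 0"
  shows "ennreal (r\<^sup>2 * cmod (f a)) \<le> (\<integral>\<^sup>+z\<in>ball a r. ennreal (cmod (f z)) \<partial>dA)"
proof -
  have int: "integrable dA (\<lambda>z. indicator (ball a r) z *\<^sub>R f z)"
    using set_integrable_dA_ball[OF harmonic_continuous_on[OF assms(1)] assms(2,3)] by (simp add: set_integrable_def)
  have "ennreal (r\<^sup>2 * cmod (f a)) = ennreal (norm (LINT z:ball a r|dA. f z))"
    by (simp add: harmonic_mean_value[OF assms] norm_mult norm_power)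
  also have "\<dots> \<le> (\<integral>\<^sup>+z. ennreal (norm (indicator (ball a r) z *\<^sub>R f z)) \<partial>dA)"
    unfolding set_lebesgue_integral_def by (rule integral_norm_bound_ennreal[OF int])
  also have "\<dots> = (\<integral>\<^sup>+z\<in>ball a r. ennreal (cmod (f z)) \<partial>dA)"
    by (intro nn_integral_cong) (auto simp: indicator_def)
  finally show ?thesis .
qed

lemma set_nn_integral_mono_set:
  assumes "A \<subseteq> B" shows "(\<integral>\<^sup>+z\<in>A. f z \<partial>M) \<le> (\<integral>\<^sup>+z\<in>B. f z \<partial>M)"
  by (rule nn_integral_mono) (use assms in \<open>auto simp: indicator_def\<close>)

text \<open>The mean values over \<open>ball z \<rho>\<close> and \<open>ball a \<rho>\<close> differ only by the
  integral over the symmetric difference of the two balls, whose area is at most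
  \<open>4 \<rho> |z - a|\<close>.\<close>

lemma harmonic_lipschitz_average:
  assumes f: "harmonic_on f disc" and \<rho>: "\<rho> > 0" "cmod a + 4 * \<rho> \<le> 1" and z: "cmod (z - a) < \<rho>"
  shows "ennreal (\<rho> ^ 4 * cmod (f z - f a))
    \<le> ennreal (4 * \<rho> * cmod (z - a)) * (\<integral>\<^sup>+w\<in>ball a (4 * \<rho>). ennreal (cmod (f w)) \<partial>dA)"
    (is "_ \<le> _ * ?I")
\<comment> \<open>In the extended reals \<open>0 * \<infinity> = 0\<close>. For \<open>z = a\<close>
  the left side vanishes; otherwise an infinite integral makes the right side infinite.\<close>
proof (cases "z = a \<or> ?I = \<infinity>")
  case True
  then show ?thesis using \<rho> by (auto simp: ennreal_mult_top)
next
  case False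
  then obtain I where I: "?I = ennreal I" "I \<ge> 0" by (cases ?I) auto
  define d where "d = cmod (z - a)"
  have d: "0 \<le> d" "d < \<rho>" using z by (auto simp: d_def)
  \<comment> \<open>The symmetric difference lies in \<open>ball a (2 * \<rho>)\<close>. There
    \<open>f\<close> is bounded pointwise by its average over a ball of radius
    \<open>\<rho>\<close>, which stays inside \<open>ball a (4 * \<rho>)\<close>.\<close>
  have bd: "\<rho>\<^sup>2 * cmod (f w) \<le> I" if "w \<in> ball a (2 * \<rho>)" for w
  proof -
    have w: "cmod w + \<rho> < 1" using that \<rho> norm_triangle_sub[of w a] by (simp add: dist_norm norm_minus_commute)
    have "ball w \<rho> \<subseteq> ball a (4 * \<rho>)"
    proof
      fix v assume "v \<in> ball w \<rho>"
      then show "v \<in> ball a (4 * \<rho>)" using that \<rho>(1) dist_triangle[of a v w] by simp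
    qed
    then have "ennreal (\<rho>\<^sup>2 * cmod (f w)) \<le> ?I"
      by (rule order_trans[OF harmonic_bound_average[OF f w \<rho>(1)] set_nn_integral_mono_set])
    then show ?thesis using I by simp
  qed
  have za: "cmod z + \<rho> < 1" "cmod a + \<rho> < 1"
    using z \<rho> norm_triangle_sub[of z a] by (simp_all add: norm_minus_commute)
  have zd: "cmod z + (\<rho> - d) \<le> 1" "\<rho> - d \<ge> 0" using za d by auto
  note mz = measure_dA_ball[of z \<rho>] measure_dA_ball[of a \<rho>] measure_dA_ball[OF zd]
  note sz = sets_dA_ball[of z \<rho>] sets_dA_ball[of a \<rho>] sets_dA_ball[OF zd(1)]
  \<comment> \<open>Both balls contain \<open>ball z (\<rho> - d)\<close>, so \<open>?i\<close>
    dominates the indicator of the symmetric difference. Its integral is explicit: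
    \<open>2 * \<rho>^2 - 2 * (\<rho> - d)^2 \<le> 4 * \<rho> * d\<close>.\<close>
  let ?i = "\<lambda>w. indicator (ball z \<rho>) w + indicator (ball a \<rho>) w - 2 * indicator (ball z (\<rho> - d)) w :: real"
  have intf: "integrable dA (\<lambda>w. indicator (ball z \<rho>) w *\<^sub>R f w)" "integrable dA (\<lambda>w. indicator (ball a \<rho>) w *\<^sub>R f w)"
    using set_integrable_dA_ball[OF harmonic_continuous_on[OF f]] za \<rho> unfolding set_integrable_def by blast+
  interpret finite_measure dA by (rule finite_measure_dA)
  have ind: "integrable dA (\<lambda>w. indicator B w :: real)" if "B \<in> sets dA" for B
    using that by (simp add: integrable_real_indicator emeasure_finite less_top[symmetric])
  have "of_real (\<rho>\<^sup>2) * (f z - f a) = (LINT w|dA. indicator (ball z \<rho>) w *\<^sub>R f w - indicator (ball a \<rho>) w *\<^sub>R f w)"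
    using harmonic_mean_value[OF f za(1) \<rho>(1)] harmonic_mean_value[OF f za(2) \<rho>(1)] intf
    by (simp add: set_lebesgue_integral_def algebra_simps)
  \<comment> \<open>The additional factor \<open>\<rho>^2\<close> matches the one in
    \<open>bd\<close>, so that the integrand is bounded by \<open>I\<close> itself.\<close>
  then have "\<rho>\<^sup>2 * (\<rho>\<^sup>2 * cmod (f z - f a)) = \<rho>\<^sup>2 * norm (LINT w|dA. indicator (ball z \<rho>) w *\<^sub>R f w - indicator (ball a \<rho>) w *\<^sub>R f w)"
    by (metis abs_of_nonneg norm_mult norm_of_real zero_le_power2)
  also have "\<dots> = norm (LINT w|dA. \<rho>\<^sup>2 *\<^sub>R (indicator (ball z \<rho>) w *\<^sub>R f w - indicator (ball a \<rho>) w *\<^sub>R f w))"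
    by (subst integral_scaleR_right) simp
  also have "\<dots> \<le> (LINT w|dA. I * ?i w)"
  proof (rule Bochner_Integration.integral_norm_bound_integral)
    show "integrable dA (\<lambda>w. \<rho>\<^sup>2 *\<^sub>R (indicator (ball z \<rho>) w *\<^sub>R f w - indicator (ball a \<rho>) w *\<^sub>R f w))"
      by (intro integrable_scaleR_right Bochner_Integration.integrable_diff intf)
    show "integrable dA (\<lambda>w. I * ?i w)"
      using sz za by (intro integrable_mult_right Bochner_Integration.integrable_diff Bochner_Integration.integrable_add ind) auto
    fix w
    have b1: "w \<in> ball a (2 * \<rho>)" if "w \<in> ball z \<rho>"
      using that z dist_triangle[of a w z] by (auto simp: dist_norm norm_minus_commute)
    have b2: "w \<in> ball z \<rho> \<and> w \<in> ball a \<rho>" if "w \<in> ball z (\<rho> - d)"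
    proof -
      have "d = dist a z" by (simp add: d_def dist_norm norm_minus_commute)
      then show ?thesis using that d dist_triangle[of a w z] zero_le_dist[of a z] unfolding mem_ball by linarith
    qed
    have b3: "w \<in> ball a (2 * \<rho>)" if "w \<in> ball a \<rho>" using that \<rho> by auto
    consider "w \<in> ball z \<rho>" "w \<in> ball a \<rho>" | "w \<in> ball z \<rho>" "w \<notin> ball a \<rho>" "w \<notin> ball z (\<rho> - d)"
      | "w \<notin> ball z \<rho>" "w \<in> ball a \<rho>" "w \<notin> ball z (\<rho> - d)" | "w \<notin> ball z \<rho>" "w \<notin> ball a \<rho>" "w \<notin> ball z (\<rho> - d)"
      using b2 by blast
    then show "norm (\<rho>\<^sup>2 *\<^sub>R (indicator (ball z \<rho>) w *\<^sub>R f w - indicator (ball a \<rho>) w *\<^sub>R f w)) \<le> I * ?i w"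
    proof cases
      case 1 then show ?thesis using I by (auto simp: indicator_def)
    next
      case 2 then show ?thesis using bd[OF b1] by (simp add: indicator_simps del: mem_ball)
    next
      case 3 then show ?thesis using bd[OF b3] by (simp add: indicator_simps del: mem_ball)
    next
      case 4 then show ?thesis by (simp add: indicator_simps del: mem_ball)
    qed
  qed
  also have "(LINT w|dA. I * ?i w) = I * (\<rho>\<^sup>2 + \<rho>\<^sup>2 - 2 * (\<rho> - d)\<^sup>2)"
    using sz za mz \<rho> Int_absorb2[OF ball_subset_disc, of z \<rho>] Int_absorb2[OF ball_subset_disc, of a \<rho>]
      Int_absorb2[OF ball_subset_disc, OF zd(1)] by (simp add: ind)
  also have "\<dots> \<le> I * (4 * \<rho> * d)"
    using I by (intro mult_left_mono) (auto simp: power2_eq_square algebra_simps)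
  finally have "\<rho> ^ 4 * cmod (f z - f a) \<le> 4 * \<rho> * d * I"
    by (simp add: power2_eq_square power4_eq_xxxx algebra_simps)
  then show ?thesis using I \<rho> by (simp add: d_def ennreal_mult[symmetric])
qed

text \<open>Once zero and infinite factors are removed, integrate
  \<open>2 * f * g \<le> t * f^2 + g^2 / t\<close> and choose the best \<open>t\<close>.\<close>

lemma nn_integral_Cauchy_Schwarz:
  fixes f g :: "'a \<Rightarrow> real"
  assumes [measurable]: "f \<in> borel_measurable M" "g \<in> borel_measurable M"
    and nn: "\<And>x. f x \<ge> 0" "\<And>x. g x \<ge> 0"
  shows "(\<integral>\<^sup>+x. ennreal (f x * g x) \<partial>M)\<^sup>2 \<le> (\<integral>\<^sup>+x. ennreal ((f x)\<^sup>2) \<partial>M) * (\<integral>\<^sup>+x. ennreal ((g x)\<^sup>2) \<partial>M)"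
    (is "?L\<^sup>2 \<le> ?P * ?Q")
proof (cases "?P = 0 \<or> ?Q = 0")
  case True
  then have "AE x in M. f x * g x = 0"
  proof
    assume "?P = 0"
    then have "AE x in M. ennreal ((f x)\<^sup>2) = 0" by (subst (asm) nn_integral_0_iff_AE) auto
    then show ?thesis by eventually_elim simp
  next
    assume "?Q = 0"
    then have "AE x in M. ennreal ((g x)\<^sup>2) = 0" by (subst (asm) nn_integral_0_iff_AE) auto
    then show ?thesis by eventually_elim simp
  qed
  then have "?L = 0" by (subst nn_integral_0_iff_AE) auto
  then show ?thesis by simp
next
  case pos: False
  show ?thesis
  proof (cases "?P = \<infinity> \<or> ?Q = \<infinity>")
    case True
    then have "?P * ?Q = \<infinity>" using pos by (auto simp: ennreal_mult_top ennreal_top_mult)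
    then show ?thesis by simp
  next
    case False
    then obtain P Q where PQ: "?P = ennreal P" "?Q = ennreal Q" "P > 0" "Q > 0"
      using pos by (cases ?P; cases ?Q) (auto simp: less_le)
    \<comment> \<open>This \<open>t\<close> balances the two terms: \<open>t * P\<close> and
      \<open>Q / t\<close> both become \<open>sqrt (P * Q)\<close>.\<close>
    define t where "t = sqrt (Q / P)"
    have t: "t > 0" using PQ by (simp add: t_def)
    have "2 * ?L = (\<integral>\<^sup>+x. ennreal (2 * (f x * g x)) \<partial>M)"
      using nn by (simp add: ennreal_mult nn_integral_cmult)
    also have "\<dots> \<le> (\<integral>\<^sup>+x. ennreal t * ennreal ((f x)\<^sup>2) + ennreal (1 / t) * ennreal ((g x)\<^sup>2) \<partial>M)"
    proof (rule nn_integral_mono)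
      fix x
      have "0 \<le> (sqrt t * f x - g x / sqrt t)\<^sup>2" by simp
      also have "\<dots> = t * (f x)\<^sup>2 + (1 / t) * (g x)\<^sup>2 - 2 * (f x * g x)"
        using t by (simp add: power2_diff power_mult_distrib power_divide)
      finally show "ennreal (2 * (f x * g x)) \<le> ennreal t * ennreal ((f x)\<^sup>2) + ennreal (1 / t) * ennreal ((g x)\<^sup>2)"
        using t by (simp flip: ennreal_mult ennreal_plus)
    qed
    also have "\<dots> = ennreal t * ?P + ennreal (1 / t) * ?Q"
      by (simp add: nn_integral_add nn_integral_cmult)
    also have "\<dots> = ennreal (t * P + Q / t)"
      using PQ t by (simp flip: ennreal_mult ennreal_plus)
    also have "t * P + Q / t = 2 * sqrt (P * Q)"
    proof -
      have "t * P = sqrt (P * Q)" using PQ by (simp add: t_def real_sqrt_divide real_sqrt_mult field_simps)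
      moreover have "Q / t = sqrt (P * Q)" using PQ by (simp add: t_def real_sqrt_divide real_sqrt_mult field_simps)
      ultimately show ?thesis by simp
    qed
    finally have "2 * ?L \<le> 2 * ennreal (sqrt (P * Q))" using PQ by (simp add: ennreal_mult)
    then have "?L \<le> ennreal (sqrt (P * Q))"
      by (subst (asm) ennreal_mult_le_mult_iff) auto
    then have "?L\<^sup>2 \<le> (ennreal (sqrt (P * Q)))\<^sup>2" by (rule power_mono) simp
    also have "\<dots> = ?P * ?Q" using PQ by (simp add: ennreal_power ennreal_mult)
    finally show ?thesis .
  qed
qed

section \<open>Estimates that follow from the A2 condition\<close>

locale A2 =
  fixes \<omega> :: "complex \<Rightarrow> real"
  assumes weight: "A2_weight \<omega>"
begin

definition A :: real where "A = enn2real (A2_characteristic \<omega>)"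

abbreviation W :: "complex set \<Rightarrow> ennreal" where "W \<equiv> weighted_area \<omega>"

abbreviation W_inv :: "complex set \<Rightarrow> ennreal" where "W_inv \<equiv> weighted_area (\<lambda>z. inverse (\<omega> z))"

abbreviation mass :: "(complex \<Rightarrow> complex) \<Rightarrow> complex set \<Rightarrow> ennreal"
  where "mass f E \<equiv> (\<integral>\<^sup>+z\<in>E. ennreal ((cmod (f z))\<^sup>2 * \<omega> z) \<partial>dA)"

lemma A_nonneg: "A \<ge> 0" by (simp add: A_def)

lemma integrable_weight: "integrable dA \<omega>"
  and weight_pos: "AE z in dA. 0 < \<omega> z"
  and weight_measurable [measurable]: "\<omega> \<in> borel_measurable dA"
  using weight by (auto simp: A2_weight_def)

lemma W_eq_emeasure: "E \<in> sets dA \<Longrightarrow> W E = emeasure (density dA (\<lambda>z. ennreal (\<omega> z))) E"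
  by (simp add: weighted_area_def emeasure_density)

lemma W_mono: "E \<subseteq> F \<Longrightarrow> W E \<le> W F"
  unfolding weighted_area_def by (rule set_nn_integral_mono_set)

lemma W_finite: "W E < \<infinity>"
proof -
  have "W E \<le> (\<integral>\<^sup>+z. ennreal (\<omega> z) \<partial>dA)"
    unfolding weighted_area_def by (rule nn_integral_mono) (auto simp: indicator_def)
  also have "\<dots> \<le> (\<integral>\<^sup>+z. ennreal (norm (\<omega> z)) \<partial>dA)" by (rule nn_integral_mono) (auto intro: ennreal_leI)
  also have "\<dots> < \<infinity>" using integrable_weight unfolding integrable_iff_bounded by blast
  finally show ?thesis .
qed

lemma W_pos:
  assumes "E \<in> sets dA" "emeasure dA E > 0"
  shows "W E > 0"
proof (rule ccontr)
  assume "\<not> W E > 0"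
  then have "W E = 0" by simp
  then have "AE z in dA. ennreal (\<omega> z) * indicator E z = 0"
    using assms(1) unfolding weighted_area_def by (subst (asm) nn_integral_0_iff_AE) auto
  then have "AE z in dA. z \<notin> E" using weight_pos
    by eventually_elim (auto simp: indicator_def split: if_splits)
  then have "emeasure dA E = 0"
    using assms by (subst (asm) AE_iff_measurable[of E]) (use sets.sets_into_space[OF assms(1)] in auto)
  then show False using assms by simp
qed

text \<open>For a ball contained in the disc, \<open>euclid_disc\<close> is the full ball of
  \<open>dA\<close>-measure \<open>r^2\<close>; this clears the denominator of the
  characteristic.\<close>

lemma A2_ineq:
  assumes "0 < r" "r < 1" "cmod a + r \<le> 1"
  shows "W (ball a r) * W_inv (ball a r) \<le> ennreal (A * r ^ 4)"
proof -
  let ?q = "W (ball a r) * W_inv (ball a r) / (emeasure dA (ball a r))\<^sup>2"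
  have a: "a \<in> disc" using assms by (simp add: disc_def)
  have eb: "euclid_disc a r = ball a r"
    using ball_subset_disc[OF assms(3)] by (auto simp: euclid_disc_def dist_norm norm_minus_commute)
  have "?q \<le> A2_characteristic \<omega>"
    unfolding A2_characteristic_def using a assms eb
    by (intro SUP_upper2[of "(a, r)"]) auto
  also have "\<dots> = ennreal A" using weight by (simp add: A2_weight_def A_def)
  finally have q: "?q \<le> ennreal A" .
  have e: "(emeasure dA (ball a r))\<^sup>2 = ennreal (r ^ 4)"
    using assms by (simp add: emeasure_dA_ball' ennreal_power flip: power_mult)
  have "W (ball a r) * W_inv (ball a r) = ?q * ennreal (r ^ 4)"
    unfolding e using assms by (simp add: ennreal_divide_times ennreal_divide_self)
  also have "\<dots> \<le> ennreal A * ennreal (r ^ 4)" by (rule mult_right_mono[OF q]) simp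
  also have "\<dots> = ennreal (A * r ^ 4)" using A_nonneg by (simp add: ennreal_mult)
  finally show ?thesis .
qed

lemma Cauchy_Schwarz_weight:
  assumes u[measurable]: "u \<in> borel_measurable dA" "\<And>z. u z \<ge> 0" and E[measurable]: "E \<in> sets dA"
  shows "(\<integral>\<^sup>+z\<in>E. ennreal (u z) \<partial>dA)\<^sup>2 \<le> (\<integral>\<^sup>+z\<in>E. ennreal ((u z)\<^sup>2 * \<omega> z) \<partial>dA) * W_inv E"
proof -
  \<comment> \<open>The weight is positive only almost everywhere, whereas Cauchy-Schwarz asks for
    functions that are nonnegative at every point; hence the absolute values under the
    roots.\<close>
  let ?f = "\<lambda>z. u z * sqrt \<bar>\<omega> z\<bar> * indicator E z" and ?g = "\<lambda>z. indicator E z / sqrt \<bar>\<omega> z\<bar>"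
  have "(\<integral>\<^sup>+z\<in>E. ennreal (u z) \<partial>dA) = (\<integral>\<^sup>+z. ennreal (?f z * ?g z) \<partial>dA)"
    using weight_pos by (intro nn_integral_cong_AE) (auto elim!: eventually_mono simp: indicator_def)
  also have "\<dots>\<^sup>2 \<le> (\<integral>\<^sup>+z. ennreal ((?f z)\<^sup>2) \<partial>dA) * (\<integral>\<^sup>+z. ennreal ((?g z)\<^sup>2) \<partial>dA)"
    by (rule nn_integral_Cauchy_Schwarz) (use u in auto)
  also have "(\<integral>\<^sup>+z. ennreal ((?f z)\<^sup>2) \<partial>dA) = (\<integral>\<^sup>+z\<in>E. ennreal ((u z)\<^sup>2 * \<omega> z) \<partial>dA)"
    using weight_pos by (intro nn_integral_cong_AE) (auto elim!: eventually_mono simp: indicator_def power_mult_distrib)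
  also have "(\<integral>\<^sup>+z. ennreal ((?g z)\<^sup>2) \<partial>dA) = W_inv E"
    unfolding weighted_area_def
    using weight_pos by (intro nn_integral_cong_AE) (auto elim!: eventually_mono simp: indicator_def power_divide inverse_eq_divide)
  finally show ?thesis .
qed

text \<open>The form in which A2 enters the later local estimates: the factor \<open>W_inv\<close>
  produced by Cauchy-Schwarz on \<open>E\<close> is absorbed by the weight of a larger ball. Letting
  \<open>E\<close> be smaller than the ball is what gives doubling and estimates in terms of small
  balls.\<close>

lemma A2_average:
  assumes u: "u \<in> borel_measurable dA" "\<And>z. u z \<ge> 0" and E: "E \<in> sets dA" "E \<subseteq> ball a r"
    and r: "0 < r" "r < 1" "cmod a + r \<le> 1"
  shows "(\<integral>\<^sup>+z\<in>E. ennreal (u z) \<partial>dA)\<^sup>2 * W (ball a r) \<le> ennreal (A * r ^ 4) * (\<integral>\<^sup>+z\<in>E. ennreal ((u z)\<^sup>2 * \<omega> z) \<partial>dA)"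
    (is "?L\<^sup>2 * _ \<le> _ * ?P")
proof -
  have "?L\<^sup>2 * W (ball a r) \<le> ?P * W_inv E * W (ball a r)"
    by (intro mult_right_mono Cauchy_Schwarz_weight u E) simp
  also have "\<dots> \<le> ?P * W_inv (ball a r) * W (ball a r)"
    unfolding weighted_area_def by (intro mult_right_mono mult_left_mono set_nn_integral_mono_set E) auto
  also have "\<dots> = ?P * (W (ball a r) * W_inv (ball a r))" by (simp add: ac_simps)
  also have "\<dots> \<le> ?P * ennreal (A * r ^ 4)" by (intro mult_left_mono A2_ineq r) simp
  finally show ?thesis by (simp add: mult.commute)
qed

text \<open>\<open>A2_average\<close> for the constant function \<open>1\<close> and
  \<open>E\<close> the smaller ball.\<close>

lemma W_doubling:
  assumes "ball c s \<subseteq> ball a r" "0 \<le> s" "0 < r" "r < 1" "cmod a + r \<le> 1"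
  shows "ennreal (s ^ 4) * W (ball a r) \<le> ennreal (A * r ^ 4) * W (ball c s)"
proof -
  have sub: "ball c s \<subseteq> disc" using assms ball_subset_disc by blast
  have "(\<integral>\<^sup>+z\<in>ball c s. ennreal 1 \<partial>dA)\<^sup>2 * W (ball a r) \<le> ennreal (A * r ^ 4) * (\<integral>\<^sup>+z\<in>ball c s. ennreal (1\<^sup>2 * \<omega> z) \<partial>dA)"
    using A2_average[of "\<lambda>_. 1"] assms sets_dA_borel[OF _ sub] by auto
  moreover have "(\<integral>\<^sup>+z\<in>ball c s. ennreal 1 \<partial>dA)\<^sup>2 = ennreal (s ^ 4)"
    using sets_dA_borel[OF _ sub] assms(2) by (simp add: emeasure_dA_ball[OF sub] ennreal_power flip: power_mult)
  ultimately show ?thesis by (simp add: weighted_area_def)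
qed

lemma harmonic_measurable: "harmonic_on f disc \<Longrightarrow> f \<in> borel_measurable dA"
  using measurable_dA_continuous harmonic_continuous_on by blast

text \<open>Mean value property on the small ball, then \<open>A2_average\<close>. Two radii are
  kept apart because the mass is later summed over disjoint small balls, while the weight has to
  cover a whole pseudohyperbolic disc.\<close>

lemma harmonic_pointwise_mass:
  assumes f: "harmonic_on f disc" and "cmod b + s < 1" "s > 0" and sub: "ball b s \<subseteq> ball a r"
    and r: "0 < r" "r < 1" "cmod a + r \<le> 1"
  shows "ennreal (s ^ 4 * (cmod (f b))\<^sup>2) * W (ball a r) \<le> ennreal (A * r ^ 4) * mass f (ball b s)"
proof -
  have m: "(\<lambda>z. cmod (f z)) \<in> borel_measurable dA" using harmonic_measurable[OF f] by measurable
  have b: "ball b s \<in> sets dA" using assms by (intro sets_dA_ball) auto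
  have "ennreal (s ^ 4 * (cmod (f b))\<^sup>2) = (ennreal (s\<^sup>2 * cmod (f b)))\<^sup>2"
    using assms by (simp add: ennreal_power power_mult_distrib flip: power_mult)
  also have "\<dots> * W (ball a r) \<le> (\<integral>\<^sup>+z\<in>ball b s. ennreal (cmod (f z)) \<partial>dA)\<^sup>2 * W (ball a r)"
    by (intro mult_right_mono power_mono harmonic_bound_average assms) auto
  also have "\<dots> \<le> ennreal (A * r ^ 4) * mass f (ball b s)"
    by (rule A2_average[OF m _ b sub r]) simp
  finally show ?thesis .
qed

text \<open>Square the Lipschitz estimate for averages and apply \<open>A2_average\<close> to
  \<open>cmod (f z)\<close>. The constant is \<open>4^2 * 4^4\<close>: the first factor from the
  Lipschitz constant, the second from the radius \<open>4 * \<rho>\<close>.\<close>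

lemma harmonic_oscillation_mass:
  assumes f: "harmonic_on f disc" and \<rho>: "\<rho> > 0" "cmod a + 4 * \<rho> \<le> 1" "4 * \<rho> < 1" and z: "cmod (z - a) < \<rho>"
  shows "ennreal ((cmod (f z - f a))\<^sup>2) * W (ball a (4 * \<rho>))
    \<le> ennreal (4096 * A * (cmod (z - a) / \<rho>)\<^sup>2) * mass f (ball a (4 * \<rho>))"
proof -
  let ?B = "ball a (4 * \<rho>)" and ?d = "cmod (z - a)"
  let ?I = "\<integral>\<^sup>+w\<in>?B. ennreal (cmod (f w)) \<partial>dA"
  have m: "(\<lambda>z. cmod (f z)) \<in> borel_measurable dA" using harmonic_measurable[OF f] by measurable
  have "ennreal ((cmod (f z - f a))\<^sup>2) = ennreal (1 / \<rho> ^ 8) * (ennreal (\<rho> ^ 4 * cmod (f z - f a)))\<^sup>2"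
    using \<rho> by (simp add: ennreal_power power_mult_distrib flip: power_mult ennreal_mult)
  also have "\<dots> \<le> ennreal (1 / \<rho> ^ 8) * (ennreal (4 * \<rho> * ?d) * ?I)\<^sup>2"
    by (intro mult_left_mono power_mono harmonic_lipschitz_average f \<rho> z) auto
  also have "\<dots> = ennreal (16 * ?d\<^sup>2 / \<rho> ^ 6) * ?I\<^sup>2"
  proof -
    have "ennreal (1 / \<rho> ^ 8) * (ennreal (4 * \<rho> * ?d) * ?I)\<^sup>2 = (ennreal (1 / \<rho> ^ 8) * (ennreal (4 * \<rho> * ?d))\<^sup>2) * ?I\<^sup>2"
      by (simp add: power_mult_distrib mult.assoc)
    also have "ennreal (1 / \<rho> ^ 8) * (ennreal (4 * \<rho> * ?d))\<^sup>2 = ennreal (1 / \<rho> ^ 8 * (4 * \<rho> * ?d)\<^sup>2)"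
      using \<rho> by (subst ennreal_power) (auto simp: ennreal_mult[symmetric] simp del: ennreal_power)
    also have "1 / \<rho> ^ 8 * (4 * \<rho> * ?d)\<^sup>2 = 16 * ?d\<^sup>2 / \<rho> ^ 6"
      using \<rho> by (simp add: field_simps power_mult_distrib eval_nat_numeral)
    finally show ?thesis .
  qed
  finally have "ennreal ((cmod (f z - f a))\<^sup>2) * W ?B \<le> ennreal (16 * ?d\<^sup>2 / \<rho> ^ 6) * (?I\<^sup>2 * W ?B)"
    by (simp add: mult_right_mono flip: mult.assoc)
  also have "\<dots> \<le> ennreal (16 * ?d\<^sup>2 / \<rho> ^ 6) * (ennreal (A * (4 * \<rho>) ^ 4) * mass f ?B)"
    by (intro mult_left_mono A2_average m sets_dA_ball) (use \<rho> in auto)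
  also have "\<dots> = ennreal (16 * ?d\<^sup>2 / \<rho> ^ 6 * (A * (4 * \<rho>) ^ 4)) * mass f ?B"
    by (subst mult.assoc[symmetric], subst ennreal_mult[symmetric]) (use \<rho> A_nonneg in auto)
  also have "16 * ?d\<^sup>2 / \<rho> ^ 6 * (A * (4 * \<rho>) ^ 4) = 4096 * A * (?d / \<rho>)\<^sup>2"
    using \<rho> by (simp add: field_simps power_mult_distrib eval_nat_numeral)
  finally show ?thesis .
qed

text \<open>Point evaluations are bounded, uniformly on compact subsets. This gives both
  completeness of the space and existence of the kernel. One fixed ball \<open>ball 0 t\<close>
  suffices, since all the averaging balls lie in it and its \<open>W_inv\<close> is finite.\<close>

lemma harmonic_locally_bounded_mass:
  assumes s: "0 \<le> s" "s < 1"
  obtains C where "C > 0" "\<And>f z. harmonic_on f disc \<Longrightarrow> cmod z \<le> s \<Longrightarrow> ennreal ((cmod (f z))\<^sup>2) \<le> ennreal C * mass f disc"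
proof -
  define t where "t = (1 + s) / 2"
  define r where "r = (1 - s) / 4"
  have t: "0 < t" "t < 1" "s + 2 * r = t" "r > 0" "s + r < 1" using s by (auto simp: t_def r_def field_simps)
  have "W (ball 0 t) > 0" using t by (intro W_pos sets_dA_ball) (auto simp: emeasure_dA_ball')
  \<comment> \<open>The A2 product is finite and its factor \<open>W\<close> is positive, so the
    factor \<open>W_inv\<close> cannot be infinite.\<close>
  then have "W_inv (ball 0 t) \<noteq> \<infinity>"
    using A2_ineq[of t 0] t by (auto simp: ennreal_mult_top top_unique split: if_splits)
  then obtain V where V: "W_inv (ball 0 t) = ennreal V" "V \<ge> 0" by (cases "W_inv (ball 0 t)") auto
  \<comment> \<open>\<open>V + 1\<close> in place of \<open>V\<close> makes \<open>C\<close>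
    strictly positive, which permits division by it later.\<close>
  define C where "C = (V + 1) / r ^ 4"
  show ?thesis
  proof
    show "C > 0" using V t by (simp add: C_def)
    fix f z assume f: "harmonic_on f disc" and z: "cmod z \<le> s"
    have m: "(\<lambda>z. cmod (f z)) \<in> borel_measurable dA" using harmonic_measurable[OF f] by measurable
    have zr: "cmod z + r < 1" using z t by simp
    have sub: "ball z r \<subseteq> ball 0 t"
    proof
      fix w assume "w \<in> ball z r"
      then show "w \<in> ball 0 t" using z t norm_triangle_sub[of w z] by (auto simp: dist_norm norm_minus_commute)
    qed
    have "ennreal (r ^ 4 * (cmod (f z))\<^sup>2) = (ennreal (r\<^sup>2 * cmod (f z)))\<^sup>2"
      using t by (simp add: ennreal_power power_mult_distrib flip: power_mult)
    also have "\<dots> \<le> (\<integral>\<^sup>+z\<in>ball z r. ennreal (cmod (f z)) \<partial>dA)\<^sup>2"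
      by (intro power_mono harmonic_bound_average f zr t) auto
    also have "\<dots> \<le> mass f (ball z r) * W_inv (ball z r)"
      using zr by (intro Cauchy_Schwarz_weight m sets_dA_ball) auto
    also have "\<dots> \<le> mass f disc * W_inv (ball 0 t)"
      unfolding weighted_area_def
      by (intro mult_mono set_nn_integral_mono_set sub ball_subset_disc) (use zr in auto)
    also have "\<dots> \<le> mass f disc * ennreal (V + 1)" unfolding V using V by (intro mult_left_mono ennreal_leI) auto
    finally have "ennreal (1 / r ^ 4) * ennreal (r ^ 4 * (cmod (f z))\<^sup>2) \<le> ennreal (1 / r ^ 4) * (mass f disc * ennreal (V + 1))"
      by (rule mult_left_mono) simp
    also have "ennreal (1 / r ^ 4) * ennreal (r ^ 4 * (cmod (f z))\<^sup>2) = ennreal ((cmod (f z))\<^sup>2)"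
      using t by (simp flip: ennreal_mult)
    also have "ennreal (1 / r ^ 4) * (mass f disc * ennreal (V + 1)) = ennreal C * mass f disc"
    proof -
      have "C = 1 / r ^ 4 * (V + 1)" by (simp add: C_def)
      then have "ennreal C = ennreal (1 / r ^ 4) * ennreal (V + 1)" using ennreal_mult[of "1 / r ^ 4" "V + 1"] V t by simp
      then show ?thesis by (simp only: ac_simps)
    qed
    finally show "ennreal ((cmod (f z))\<^sup>2) \<le> ennreal C * mass f disc" .
  qed
qed

end

section \<open>Riesz representation and locally uniform limits\<close>

text \<open>The discriminant criterion. The leading coefficient may vanish, as happens for elements
  of norm zero in a semidefinite form; then \<open>b\<close> must vanish as well.\<close>

lemma real_quadratic_nonneg_imp:
  fixes a b c :: real
  assumes "\<And>t. 0 \<le> a * t\<^sup>2 + 2 * b * t + c"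
  shows "b\<^sup>2 \<le> a * c"
proof (cases "a = 0")
  case False
  have "a \<ge> 0"
  proof (rule ccontr)
    assume "\<not> a \<ge> 0"
    then have "a < 0" by simp
    define t where "t = (2 * \<bar>b\<bar> + \<bar>c\<bar> + 1) / (- a) + 1"
    have t: "t \<ge> 1" "- a * t \<ge> 2 * \<bar>b\<bar> + \<bar>c\<bar> + 1" using \<open>a < 0\<close> by (auto simp: t_def field_simps)
    have "(2 * \<bar>b\<bar> + \<bar>c\<bar> + 1) * t \<le> - a * t * t" using t by (intro mult_right_mono) auto
    moreover have "2 * b * t \<le> 2 * \<bar>b\<bar> * t" using t by (intro mult_right_mono) auto
    moreover have "c \<le> \<bar>c\<bar> * t" using t by (metis abs_ge_self abs_ge_zero mult.right_neutral mult_left_mono order_trans)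
    moreover have "(2 * \<bar>b\<bar> + \<bar>c\<bar> + 1) * t = 2 * \<bar>b\<bar> * t + \<bar>c\<bar> * t + t" "a * t\<^sup>2 = - (- a * t * t)"
      by (simp_all add: power2_eq_square algebra_simps)
    ultimately have "a * t\<^sup>2 + 2 * b * t + c < 0" using t by linarith
    then show False using assms[of t] by simp
  qed
  with False have "a > 0" by simp
  have "0 \<le> a * (- b / a)\<^sup>2 + 2 * b * (- b / a) + c" by (rule assms)
  also have "\<dots> = c - b\<^sup>2 / a" using \<open>a > 0\<close> by (simp add: power2_eq_square field_simps)
  finally show ?thesis using \<open>a > 0\<close> by (simp add: field_simps)
next
  case True
  have "b = 0"
  proof (rule ccontr)
    assume "b \<noteq> 0"
    \<comment> \<open>At this point the remaining linear polynomial takes the value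
      \<open>-1\<close>.\<close>
    then show False using assms[of "- (c + 1) / (2 * b)"] True by simp
  qed
  then show ?thesis using True by simp
qed

text \<open>Elements of \<open>V\<close> are total functions, so \<open>ip\<close> is only positive semidefinite: functions
  agreeing on the domain of interest have distance \<open>0\<close>.\<close>

locale complete_function_space =
  fixes V :: "('b \<Rightarrow> complex) set" and ip :: "('b \<Rightarrow> complex) \<Rightarrow> ('b \<Rightarrow> complex) \<Rightarrow> complex"
  assumes zero: "(\<lambda>_. 0) \<in> V"
    and add: "f \<in> V \<Longrightarrow> g \<in> V \<Longrightarrow> (\<lambda>z. f z + g z) \<in> V"
    and scale: "f \<in> V \<Longrightarrow> (\<lambda>z. c * f z) \<in> V"
    and ip_add: "f \<in> V \<Longrightarrow> g \<in> V \<Longrightarrow> h \<in> V \<Longrightarrow> ip (\<lambda>z. f z + g z) h = ip f h + ip g h"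
    and ip_scale: "f \<in> V \<Longrightarrow> h \<in> V \<Longrightarrow> ip (\<lambda>z. c * f z) h = c * ip f h"
    and ip_cnj: "f \<in> V \<Longrightarrow> g \<in> V \<Longrightarrow> ip g f = cnj (ip f g)"
    and ip_nonneg: "f \<in> V \<Longrightarrow> 0 \<le> Re (ip f f)"
    and complete: "(\<And>n. X n \<in> V) \<Longrightarrow>
      (\<And>e. e > 0 \<Longrightarrow> \<exists>N. \<forall>m\<ge>N. \<forall>n\<ge>N. Re (ip (\<lambda>z. X m z - X n z) (\<lambda>z. X m z - X n z)) < e) \<Longrightarrow>
      \<exists>f\<in>V. (\<lambda>n. Re (ip (\<lambda>z. X n z - f z) (\<lambda>z. X n z - f z))) \<longlonglongrightarrow> 0"
begin

abbreviation Q :: "('b \<Rightarrow> complex) \<Rightarrow> real" where "Q f \<equiv> Re (ip f f)"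

abbreviation R :: "('b \<Rightarrow> complex) \<Rightarrow> ('b \<Rightarrow> complex) \<Rightarrow> real" where "R f g \<equiv> Re (ip f g)"

lemma diff: "f \<in> V \<Longrightarrow> g \<in> V \<Longrightarrow> (\<lambda>z. f z - g z) \<in> V"
  using add[of f "\<lambda>z. (-1) * g z"] scale[of g "-1"] by simp

lemma R_sym: "f \<in> V \<Longrightarrow> g \<in> V \<Longrightarrow> R g f = R f g"
  using ip_cnj[of f g] by simp

lemma R_combine_left:
  "f \<in> V \<Longrightarrow> g \<in> V \<Longrightarrow> h \<in> V \<Longrightarrow> R (\<lambda>z. of_real s * f z + of_real t * g z) h = s * R f h + t * R g h"
  by (simp add: ip_add ip_scale scale)

lemma Q_combine:
  assumes "f \<in> V" "g \<in> V"
  shows "Q (\<lambda>z. of_real s * f z + of_real t * g z) = s\<^sup>2 * Q f + 2 * s * t * R f g + t\<^sup>2 * Q g"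
proof -
  let ?h = "\<lambda>z. of_real s * f z + of_real t * g z"
  have h: "?h \<in> V" by (intro add scale assms)
  have "Q ?h = s * R ?h f + t * R ?h g"
    using R_combine_left[OF assms h] R_sym[OF h] assms by simp
  also have "\<dots> = s * (s * Q f + t * R g f) + t * (s * R f g + t * Q g)"
    using R_combine_left[OF assms] assms by simp
  finally show ?thesis using R_sym[OF assms] by (simp add: algebra_simps power2_eq_square)
qed

lemma Cauchy_Schwarz:
  assumes "f \<in> V" "g \<in> V" shows "(R f g)\<^sup>2 \<le> Q f * Q g"
proof (rule real_quadratic_nonneg_imp)
  fix t
  have "0 \<le> Q (\<lambda>z. of_real t * f z + of_real 1 * g z)" by (intro ip_nonneg add scale assms)
  then show "0 \<le> Q f * t\<^sup>2 + 2 * R f g * t + Q g" using Q_combine[OF assms, of t 1] by (simp add: ac_simps)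
qed

text \<open>Minimize \<open>J\<close>. If \<open>k\<close> represents \<open>L\<close>, then
  \<open>J f = Q (f - k) - Q k\<close>, so a representing element is a minimizer. Conversely, the
  parallelogram law makes minimizing sequences Cauchy, and the first variation at the limit gives
  the real part of the representation.\<close>

theorem Riesz_representation:
  assumes L_add: "\<And>f g. f \<in> V \<Longrightarrow> g \<in> V \<Longrightarrow> L (\<lambda>z. f z + g z) = L f + L g"
    and L_scale: "\<And>f c. f \<in> V \<Longrightarrow> L (\<lambda>z. c * f z) = c * L f"
    and L_bounded: "\<And>f. f \<in> V \<Longrightarrow> (cmod (L f))\<^sup>2 \<le> C * Q f"
  shows "\<exists>k\<in>V. \<forall>f\<in>V. L f = ip f k"
proof -
  have L_combine: "L (\<lambda>z. of_real s * f z + of_real t * g z) = of_real s * L f + of_real t * L g"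
    if "f \<in> V" "g \<in> V" for f g s t
    using that by (simp add: L_add L_scale scale)
  define J where "J f = Q f - 2 * Re (L f)" for f
  have J_lower: "- \<bar>C\<bar> \<le> J f" if f: "f \<in> V" for f
  proof -
    have "(Re (L f))\<^sup>2 \<le> (cmod (L f))\<^sup>2"
      using abs_Re_le_cmod[of "L f"] by (simp add: abs_le_square_iff[symmetric])
    \<comment> \<open>The constant \<open>C\<close> carries no sign condition, so its absolute value
      is used under the root.\<close>
    also have "\<dots> \<le> \<bar>C\<bar> * Q f" using L_bounded[OF f] ip_nonneg[OF f] by (metis abs_ge_self mult_right_mono order_trans)
    finally have "\<bar>Re (L f)\<bar> \<le> sqrt (\<bar>C\<bar> * Q f)" by (simp add: real_le_rsqrt)
    also have "\<dots> \<le> (\<bar>C\<bar> + Q f) / 2"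
      using arith_geo_mean_sqrt[of "\<bar>C\<bar>" "Q f"] ip_nonneg[OF f] by simp
    finally show ?thesis by (simp add: J_def)
  qed
  define m where "m = (INF f\<in>V. J f)"
  have bdd: "bdd_below (J ` V)" using J_lower by (intro bdd_belowI2)
  have m_le: "m \<le> J f" if "f \<in> V" for f unfolding m_def using bdd that by (rule cINF_lower)
  have "\<exists>f\<in>V. J f < m + inverse (real (Suc n))" for n
  proof -
    have "m < m + inverse (real (Suc n))" by simp
    then show ?thesis unfolding m_def using zero bdd by (subst (asm) cINF_less_iff) auto
  qed
  then obtain X where X: "\<And>n. X n \<in> V" "\<And>n. J (X n) < m + inverse (real (Suc n))" by metis
  \<comment> \<open>Parallelogram law:
    \<open>Q (f - g) = 2 * J f + 2 * J g - 4 * J ((f + g) / 2)\<close>, and the value at the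
    midpoint is at least \<open>m\<close>.\<close>
  have para: "Q (\<lambda>z. f z - g z) \<le> 2 * (J f - m) + 2 * (J g - m)" if fg: "f \<in> V" "g \<in> V" for f g
  proof -
    let ?h = "\<lambda>z. of_real (1/2) * f z + of_real (1/2) * g z"
    have "m \<le> J ?h" by (intro m_le add scale fg)
    also have "J ?h = (Q f + 2 * R f g + Q g) / 4 - (Re (L f) + Re (L g))"
      unfolding J_def by (subst Q_combine[OF fg], subst L_combine[OF fg]) (simp add: field_simps)
    finally have "4 * m \<le> Q f + 2 * R f g + Q g - 4 * (Re (L f) + Re (L g))" by (simp add: field_simps)
    moreover have "Q (\<lambda>z. f z - g z) = Q f - 2 * R f g + Q g"
      using Q_combine[OF fg, of 1 "-1"] by simp
    ultimately show ?thesis by (simp add: J_def field_simps)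
  qed
  have "\<exists>k\<in>V. (\<lambda>n. Q (\<lambda>z. X n z - k z)) \<longlonglongrightarrow> 0"
  proof (rule complete)
    fix e :: real assume "e > 0"
    then obtain N where N: "inverse (real (Suc N)) < e / 4" using reals_Archimedean[of "e / 4"] by auto
    show "\<exists>N. \<forall>m\<ge>N. \<forall>n\<ge>N. Q (\<lambda>z. X m z - X n z) < e"
    proof (intro exI[of _ N] allI impI)
      fix i j assume ij: "i \<ge> N" "j \<ge> N"
      have *: "J (X i) - m < e / 4" if "i \<ge> N" for i
      proof -
        have "inverse (real (Suc i)) \<le> inverse (real (Suc N))" using that by (simp add: le_imp_inverse_le)
        then show ?thesis using X(2)[of i] N by linarith
      qed
      have "Q (\<lambda>z. X i z - X j z) \<le> 2 * (J (X i) - m) + 2 * (J (X j) - m)" by (intro para X)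
      also have "\<dots> < 2 * (e / 4) + 2 * (e / 4)"
        by (intro add_strict_mono mult_strict_left_mono * ij) simp_all
      finally show "Q (\<lambda>z. X i z - X j z) < e" by simp
    qed
  qed fact
  then obtain k where k: "k \<in> V" "(\<lambda>n. Q (\<lambda>z. X n z - k z)) \<longlonglongrightarrow> 0" by blast
  have Re_eq: "Re (L f) = R f k" if f: "f \<in> V" for f
  proof -
    have lim: "(\<lambda>n. R f (X n)) \<longlonglongrightarrow> R f k"
    proof -
      have "R f (X n) - R f k = R (\<lambda>z. X n z - k z) f" for n
        using R_combine_left[OF X(1)[of n] k(1) f, of 1 "-1"] R_sym[OF f] k X(1) by simp
      then have le: "(R f (X n) - R f k)\<^sup>2 \<le> Q f * Q (\<lambda>z. X n z - k z)" for n
        using Cauchy_Schwarz[OF diff[OF X(1) k(1)] f] by (simp add: mult.commute)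
      have "(\<lambda>n. (R f (X n) - R f k)\<^sup>2) \<longlonglongrightarrow> 0"
      proof (rule Lim_null_comparison)
        show "\<forall>\<^sub>F n in sequentially. norm ((R f (X n) - R f k)\<^sup>2) \<le> Q f * Q (\<lambda>z. X n z - k z)"
          using le by (intro always_eventually allI) simp
        show "(\<lambda>n. Q f * Q (\<lambda>z. X n z - k z)) \<longlonglongrightarrow> 0" by (rule tendsto_mult_right_zero[OF k(2)])
      qed
      then have "(\<lambda>n. R f (X n) - R f k) \<longlonglongrightarrow> 0" by (simp add: power_tendsto_0_iff)
      then show ?thesis using LIM_zero_iff by blast
    qed
    \<comment> \<open>Compare \<open>J (X n + t * f) \<ge> m\<close> with
      \<open>J (X n) < m + 1 / (n + 1)\<close> and let \<open>n\<close> grow. The limiting quadratic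
      has no constant term, so the discriminant criterion forces its linear coefficient to be
      zero.\<close>
    have "0 \<le> Q f * t\<^sup>2 + 2 * (R f k - Re (L f)) * t + 0" for t
    proof (rule tendsto_lowerbound)
      show "(\<lambda>n. Q f * t\<^sup>2 + 2 * (R f (X n) - Re (L f)) * t + inverse (real (Suc n)))
          \<longlonglongrightarrow> Q f * t\<^sup>2 + 2 * (R f k - Re (L f)) * t + 0"
        by (rule lim LIMSEQ_inverse_real_of_nat tendsto_const tendsto_add tendsto_mult tendsto_diff)+
      show "\<forall>\<^sub>F n in sequentially. 0 \<le> Q f * t\<^sup>2 + 2 * (R f (X n) - Re (L f)) * t + inverse (real (Suc n))"
      proof (intro always_eventually allI)
        fix n
        let ?h = "\<lambda>z. of_real t * f z + of_real 1 * X n z"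
        have "m \<le> J ?h" by (intro m_le add scale f X)
        also have "J ?h = t\<^sup>2 * Q f + 2 * t * R f (X n) - 2 * t * Re (L f) + J (X n)"
          unfolding J_def by (subst Q_combine[OF f X(1)], subst L_combine[OF f X(1)]) simp
        finally show "0 \<le> Q f * t\<^sup>2 + 2 * (R f (X n) - Re (L f)) * t + inverse (real (Suc n))"
          using X(2)[of n] by (simp add: algebra_simps)
      qed
    qed simp
    then have "(R f k - Re (L f))\<^sup>2 \<le> Q f * 0" by (rule real_quadratic_nonneg_imp)
    then show ?thesis by simp
  qed
  have "L f = ip f k" if f: "f \<in> V" for f
  proof -
    \<comment> \<open>The real identity applied to \<open>- \<i> * f\<close> is the identity of
      imaginary parts.\<close>
    have "Re (- \<i> * L f) = Re (- \<i> * ip f k)"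
      using Re_eq[OF scale[OF f, of "- \<i>"]] L_scale[OF f, of "- \<i>"] ip_scale[OF f k(1), of "- \<i>"] by simp
    then show ?thesis using Re_eq[OF f] by (simp add: complex_eq_iff)
  qed
  with k show ?thesis by blast
qed

end

section \<open>Algebra and locally uniform limits of harmonic functions\<close>

lemma harmonic_add:
  assumes "harmonic_on f disc" "harmonic_on g disc" shows "harmonic_on (\<lambda>z. f z + g z) disc"
proof -
  obtain f1 f2 where 1: "f1 holomorphic_on disc" "f2 holomorphic_on disc" "\<And>z. z \<in> disc \<Longrightarrow> f z = f1 z + cnj (f2 z)"
    using harmonic_decomposition[OF assms(1)] by metis
  obtain g1 g2 where 2: "g1 holomorphic_on disc" "g2 holomorphic_on disc" "\<And>z. z \<in> disc \<Longrightarrow> g z = g1 z + cnj (g2 z)"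
    using harmonic_decomposition[OF assms(2)] by metis
  show ?thesis
    by (rule harmonic_on_holomorphic_plus_cnj[where g = "\<lambda>z. f1 z + g1 z" and h = "\<lambda>z. f2 z + g2 z"])
      (use 1 2 in \<open>auto intro!: holomorphic_intros\<close>)
qed

lemma harmonic_scale:
  assumes "harmonic_on f disc" shows "harmonic_on (\<lambda>z. c * f z) disc"
proof -
  obtain f1 f2 where 1: "f1 holomorphic_on disc" "f2 holomorphic_on disc" "\<And>z. z \<in> disc \<Longrightarrow> f z = f1 z + cnj (f2 z)"
    using harmonic_decomposition[OF assms(1)] by metis
  show ?thesis
    by (rule harmonic_on_holomorphic_plus_cnj[where g = "\<lambda>z. c * f1 z" and h = "\<lambda>z. cnj c * f2 z"])
      (use 1 in \<open>auto intro!: holomorphic_intros simp: algebra_simps\<close>)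
qed

lemma harmonic_diff:
  "harmonic_on f disc \<Longrightarrow> harmonic_on g disc \<Longrightarrow> harmonic_on (\<lambda>z. f z - g z) disc"
  using harmonic_add[of f "\<lambda>z. (-1) * g z"] harmonic_scale[of g "-1"] by simp

lemma harmonic_zero: "harmonic_on (\<lambda>_. 0) disc"
  by (rule harmonic_on_holomorphic_plus_cnj[where g = "\<lambda>_. 0" and h = "\<lambda>_. 0"]) auto

text \<open>Serves as an interior gradient estimate. The integral of \<open>cmod (f w)\<close> is at
  most \<open>16 * \<rho>^2 * B\<close>, and the Lipschitz constant contributes the remaining factor
  \<open>4\<close>.\<close>

lemma harmonic_lipschitz_sup:
  assumes f: "harmonic_on f disc" and \<rho>: "\<rho> > 0" "cmod a + 4 * \<rho> \<le> 1" and z: "cmod (z - a) < \<rho>"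
    and B: "\<And>w. w \<in> ball a (4 * \<rho>) \<Longrightarrow> cmod (f w) \<le> B"
  shows "cmod (f z - f a) \<le> 64 * B / \<rho> * cmod (z - a)"
proof -
  have B0: "B \<ge> 0" using B[of a] \<rho> by (auto intro: order_trans[OF norm_ge_zero])
  have "(\<integral>\<^sup>+w\<in>ball a (4 * \<rho>). ennreal (cmod (f w)) \<partial>dA) \<le> (\<integral>\<^sup>+w\<in>ball a (4 * \<rho>). ennreal B \<partial>dA)"
    using B by (intro nn_integral_mono) (auto simp: indicator_def ennreal_leI)
  also have "\<dots> = ennreal (B * (4 * \<rho>)\<^sup>2)"
    using \<rho> B0 by (simp add: nn_integral_cmult_indicator sets_dA_ball emeasure_dA_ball' ennreal_mult)
  finally have I: "(\<integral>\<^sup>+w\<in>ball a (4 * \<rho>). ennreal (cmod (f w)) \<partial>dA) \<le> ennreal (B * (4 * \<rho>)\<^sup>2)" .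
  have "ennreal (\<rho> ^ 4 * cmod (f z - f a)) \<le> ennreal (4 * \<rho> * cmod (z - a)) * ennreal (B * (4 * \<rho>)\<^sup>2)"
    by (rule order_trans[OF harmonic_lipschitz_average[OF f \<rho> z] mult_left_mono[OF I]]) simp
  also have "\<dots> = ennreal (4 * \<rho> * cmod (z - a) * (B * (4 * \<rho>)\<^sup>2))"
    by (rule ennreal_mult[symmetric]) (use \<rho> B0 in auto)
  finally have "\<rho> ^ 4 * cmod (f z - f a) \<le> 4 * \<rho> * cmod (z - a) * (B * (4 * \<rho>)\<^sup>2)"
    using \<rho> B0 by (subst (asm) ennreal_le_iff) auto
  also have "\<dots> = \<rho> ^ 4 * (64 * B / \<rho> * cmod (z - a))"
    using \<rho> by (simp add: field_simps eval_nat_numeral)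
  finally show ?thesis by (rule mult_left_le_imp_le) (use \<rho> in simp)
qed

lemma has_vector_derivative_slope:
  assumes "(\<phi> has_vector_derivative D) (at 0)"
  shows "((\<lambda>t. (\<phi> t - \<phi> 0) /\<^sub>R t) \<longlongrightarrow> D) (at 0)"
proof -
  have "(\<lambda>h. norm (\<phi> h - \<phi> 0 - h *\<^sub>R D) / norm h) \<midarrow>0\<rightarrow> 0"
    using assms by (simp add: has_vector_derivative_def has_derivative_at)
  moreover have "\<forall>\<^sub>F t in at 0. norm (\<phi> t - \<phi> 0 - t *\<^sub>R D) / norm t = norm ((\<phi> t - \<phi> 0) /\<^sub>R t - D)"
    unfolding eventually_at_filter
  proof (intro always_eventually allI impI)
    fix t :: real assume "t \<noteq> 0"
    then have "(\<phi> t - \<phi> 0) /\<^sub>R t - D = (\<phi> t - \<phi> 0 - t *\<^sub>R D) /\<^sub>R t" by (simp add: scaleR_diff_right)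
    then show "norm (\<phi> t - \<phi> 0 - t *\<^sub>R D) / norm t = norm ((\<phi> t - \<phi> 0) /\<^sub>R t - D)"
      by (simp only: norm_scaleR) (simp add: divide_inverse mult.commute)
  qed
  ultimately have "((\<lambda>t. norm ((\<phi> t - \<phi> 0) /\<^sub>R t - D)) \<longlongrightarrow> 0) (at 0)"
    by (rule Lim_transform_eventually)
  then show ?thesis by (rule LIM_zero_cancel[OF tendsto_norm_zero_cancel])
qed

text \<open>Transfers uniform smallness from \<open>f\<close> to \<open>g\<close>, hence convergence
  from harmonic functions to their holomorphic parts. The derivative of \<open>g\<close> is a
  combination of two directional derivatives of \<open>f\<close>, which the Lipschitz estimate
  bounds. The parts are determined only up to a constant, so \<open>g 0\<close> is
  subtracted.\<close>

lemma harmonic_holomorphic_part_bound: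
  assumes g: "g holomorphic_on disc" and h: "h holomorphic_on disc" and f: "\<And>z. z \<in> disc \<Longrightarrow> f z = g z + cnj (h z)"
    and s: "0 \<le> s" "s < 1" and B: "\<And>w. cmod w \<le> (1 + s) / 2 \<Longrightarrow> cmod (f w) \<le> B" and z: "cmod z \<le> s"
  shows "cmod (g z - g 0) \<le> 512 / (1 - s) * B"
proof -
  \<comment> \<open>The balls of radius \<open>4 * \<rho>\<close> then stay in the region where
    \<open>B\<close> is available, and \<open>64 / \<rho> = 512 / (1 - s)\<close>.\<close>
  define \<rho> where "\<rho> = (1 - s) / 8"
  have \<rho>: "\<rho> > 0" "s + 4 * \<rho> = (1 + s) / 2" using s by (auto simp: \<rho>_def field_simps)
  have harm: "harmonic_on f disc" by (rule harmonic_on_holomorphic_plus_cnj[OF g h f])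
  have B0: "B \<ge> 0" using B[of 0] s by (auto intro: order_trans[OF norm_ge_zero])
  have deriv_bound: "cmod (deriv g a) \<le> 64 * B / \<rho>" if a: "cmod a \<le> s" for a
  proof -
    have ad: "a \<in> disc" using a s by (simp add: disc_def)
    have lip: "cmod (f w - f a) \<le> 64 * B / \<rho> * cmod (w - a)" if "cmod (w - a) < \<rho>" for w
    proof (rule harmonic_lipschitz_sup[OF harm \<rho>(1) _ that])
      show "cmod a + 4 * \<rho> \<le> 1" using a \<rho> s by simp
      fix v assume "v \<in> ball a (4 * \<rho>)"
      then have "cmod v \<le> (1 + s) / 2" using a \<rho>(2) norm_triangle_sub[of v a] by (simp add: dist_norm norm_minus_commute)
      then show "cmod (f v) \<le> B" by (rule B)
    qed
    have dir: "cmod (deriv g a * u + cnj (deriv h a * u)) \<le> 64 * B / \<rho>" if u: "cmod u = 1" for u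
    proof -
      have dk: "((\<lambda>t. k (a + of_real t * u)) has_vector_derivative (deriv k a * u)) (at 0)"
        if "k holomorphic_on disc" for k
      proof -
        have "((\<lambda>w. a + w * u) has_field_derivative u) (at 0)" by (auto intro!: derivative_eq_intros)
        then have "((\<lambda>w. k (a + w * u)) has_field_derivative (deriv k a * u)) (at 0)"
          using DERIV_chain2[of k "deriv k a" "\<lambda>w. a + w * u" 0 u UNIV] holomorphic_derivI[OF that open_disc ad]
          by simp
        then show ?thesis using has_vector_derivative_real_field[of "\<lambda>w. k (a + w * u)" "deriv k a * u" 0] by simp
      qed
      have "((\<lambda>t. g (a + of_real t * u) + cnj (h (a + of_real t * u))) has_vector_derivative
          (deriv g a * u + cnj (deriv h a * u))) (at 0)"
        by (intro has_vector_derivative_add dk g has_vector_derivative_cnj dk h)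
      then have lim: "((\<lambda>t. ((g (a + of_real t * u) + cnj (h (a + of_real t * u))) - (g a + cnj (h a))) /\<^sub>R t) \<longlongrightarrow>
          (deriv g a * u + cnj (deriv h a * u))) (at 0)"
        using has_vector_derivative_slope by fastforce
      show ?thesis
      proof (rule Lim_norm_ubound[OF _ lim])
        have "\<forall>\<^sub>F t in at (0::real). dist t 0 < \<rho>" using \<rho> eventually_at by blast
        moreover have "\<forall>\<^sub>F t in at (0::real). t \<noteq> 0" by (simp add: eventually_at_filter)
        ultimately show "\<forall>\<^sub>F t in at (0::real). cmod (((g (a + of_real t * u) + cnj (h (a + of_real t * u))) - (g a + cnj (h a))) /\<^sub>R t) \<le> 64 * B / \<rho>"
        proof eventually_elim
          case (elim t)
          let ?w = "a + of_real t * u"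
          have w: "cmod (?w - a) = \<bar>t\<bar>" using u by (simp add: norm_mult)
          have "cmod ?w \<le> cmod a + \<bar>t\<bar>" using norm_triangle_ineq[of a "of_real t * u"] u by (simp add: norm_mult)
          then have "?w \<in> disc" using elim a \<rho> s by (simp add: disc_def)
          then have "(g ?w + cnj (h ?w)) - (g a + cnj (h a)) = f ?w - f a" using f ad by simp
          moreover have "cmod (f ?w - f a) \<le> 64 * B / \<rho> * \<bar>t\<bar>" using lip[of ?w] elim w by simp
          moreover have "cmod (X /\<^sub>R t) = cmod X / \<bar>t\<bar>" for X :: complex by (simp add: divide_inverse mult.commute)
          ultimately show ?case using elim by (simp only:) (simp add: divide_le_eq)
        qed
      qed simp
    qed
    \<comment> \<open>The Wirtinger derivative again: the derivative of \<open>f\<close> in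
      direction \<open>1\<close> minus \<open>\<i>\<close> times the one in direction
      \<open>\<i>\<close>; the contributions of \<open>h\<close> cancel.\<close>
    have "2 * deriv g a = (deriv g a * 1 + cnj (deriv h a * 1)) - \<i> * (deriv g a * \<i> + cnj (deriv h a * \<i>))"
      by (simp add: algebra_simps)
    then have "cmod (2 * deriv g a) \<le> cmod (deriv g a * 1 + cnj (deriv h a * 1)) + cmod (\<i> * (deriv g a * \<i> + cnj (deriv h a * \<i>)))"
      using norm_triangle_ineq4 by metis
    also have "\<dots> \<le> 64 * B / \<rho> + 64 * B / \<rho>"
      using dir[of 1] dir[of "\<i>"] by (intro add_mono) (simp_all add: norm_mult)
    finally show ?thesis by (simp add: norm_mult)
  qed
  have "cmod (g z - g 0) \<le> 64 * B / \<rho> * cmod (z - 0)"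
  proof (rule field_differentiable_bound[of "cball 0 s" g "deriv g"])
    fix w :: complex assume w: "w \<in> cball 0 s"
    then have "w \<in> disc" using s by (simp add: disc_def)
    then show "(g has_field_derivative deriv g w) (at w within cball 0 s)"
      using holomorphic_derivI[OF g open_disc] has_field_derivative_at_within by blast
    show "cmod (deriv g w) \<le> 64 * B / \<rho>" using deriv_bound w by simp
  qed (use z s in auto)
  also have "\<dots> \<le> 64 * B / \<rho> * 1" using z s B0 \<rho> by (intro mult_left_mono) auto
  finally show ?thesis by (simp add: \<rho>_def field_simps)
qed

lemma holomorphic_locally_uniform_Cauchy:
  assumes g: "\<And>n. g n holomorphic_on disc" and C: "\<And>s. 0 \<le> s \<Longrightarrow> s < 1 \<Longrightarrow> uniformly_Cauchy_on (cball 0 s) g"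
  obtains G where "G holomorphic_on disc" "\<And>z. z \<in> disc \<Longrightarrow> (\<lambda>n. g n z) \<longlonglongrightarrow> G z"
proof
  let ?G = "\<lambda>z. lim (\<lambda>n. g n z)"
  have u: "uniform_limit (cball 0 s) g ?G sequentially" if "0 \<le> s" "s < 1" for s
    using Cauchy_uniformly_convergent[OF C[OF that]] uniformly_convergent_uniform_limit_iff by blast
  show "?G holomorphic_on disc"
  proof (rule holomorphic_uniform_sequence[OF open_disc g])
    fix x assume x: "x \<in> disc"
    define d where "d = (1 - cmod x) / 2"
    define s where "s = (1 + cmod x) / 2"
    have ds: "d > 0" "0 \<le> s" "s < 1" "cmod x + d = s" using x by (auto simp: d_def s_def disc_def field_simps)
    have sub: "cball x d \<subseteq> cball 0 s"
    proof
      fix w assume "w \<in> cball x d"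
      then show "w \<in> cball 0 s" using norm_triangle_sub[of w x] ds by (simp add: dist_norm norm_minus_commute)
    qed
    moreover have "cball 0 s \<subseteq> disc" using ds by (auto simp: disc_def)
    ultimately show "\<exists>d. 0 < d \<and> cball x d \<subseteq> disc \<and> uniform_limit (cball x d) g ?G sequentially"
      using ds uniform_limit_on_subset[OF u[OF ds(2,3)] sub] by blast
  qed
  show "(\<lambda>n. g n z) \<longlonglongrightarrow> ?G z" if "z \<in> disc" for z
    using tendsto_uniform_limitI[OF u[of "cmod z"]] that by (auto simp: disc_def)
qed

text \<open>The second derivatives of the limit come from Weierstrass' theorem for the holomorphic
  and antiholomorphic parts, once both are known to be locally uniformly Cauchy.\<close>

lemma harmonic_locally_uniform_Cauchy:
  assumes X: "\<And>n. harmonic_on (X n) disc" and C: "\<And>s. 0 \<le> s \<Longrightarrow> s < 1 \<Longrightarrow> uniformly_Cauchy_on (cball 0 s) X"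
  obtains F where "harmonic_on F disc" "\<And>z. z \<in> disc \<Longrightarrow> (\<lambda>n. X n z) \<longlonglongrightarrow> F z"
proof -
  have "\<exists>g h. g holomorphic_on disc \<and> h holomorphic_on disc \<and> (\<forall>z\<in>disc. X n z = g z + cnj (h z))" for n
    using harmonic_decomposition[OF X] by metis
  then obtain g0 h0 where gh0: "\<And>n. g0 n holomorphic_on disc" "\<And>n. h0 n holomorphic_on disc"
    "\<And>n z. z \<in> disc \<Longrightarrow> X n z = g0 n z + cnj (h0 n z)" by metis
  \<comment> \<open>The decompositions are chosen independently for each \<open>n\<close>, so their
    constants need not converge. Normalizing \<open>g n 0 = 0\<close> and moving the constant into
    \<open>h n\<close> removes this freedom.\<close>
  define g where "g n z = g0 n z - g0 n 0" for n z
  define h where "h n z = h0 n z + cnj (g0 n 0)" for n z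
  have g: "g n holomorphic_on disc" and h: "h n holomorphic_on disc" for n
    unfolding g_def h_def by (intro holomorphic_intros gh0)+
  have X_eq: "X n z = g n z + cnj (h n z)" if "z \<in> disc" for n z
    using gh0(3)[OF that] by (simp add: g_def h_def)
  have gC: "uniformly_Cauchy_on (cball 0 s) g" if s: "0 \<le> s" "s < 1" for s
    unfolding uniformly_Cauchy_on_def
  proof (intro allI impI)
    fix e :: real assume "e > 0"
    \<comment> \<open>Half of what the factor \<open>512 / (1 - s)\<close> allows, which leaves room
      for a strict inequality.\<close>
    define e' where "e' = e * (1 - s) / 1024"
    have s': "0 \<le> (1 + s) / 2" "(1 + s) / 2 < 1" using s by simp_all
    have "e' > 0" using s \<open>e > 0\<close> by (simp add: e'_def)
    then obtain M where M: "\<And>x m n. x \<in> cball 0 ((1 + s) / 2) \<Longrightarrow> m \<ge> M \<Longrightarrow> n \<ge> M \<Longrightarrow> dist (X m x) (X n x) < e'"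
      using C[of "(1 + s) / 2"] s unfolding uniformly_Cauchy_on_def by (metis (no_types, opaque_lifting) s')
    show "\<exists>M. \<forall>x\<in>cball 0 s. \<forall>m\<ge>M. \<forall>n\<ge>M. dist (g m x) (g n x) < e"
    proof (intro exI[of _ M] ballI allI impI)
      fix x :: complex and m n assume x: "x \<in> cball 0 s" and mn: "m \<ge> M" "n \<ge> M"
      have "cmod ((g m x - g n x) - (g m 0 - g n 0)) \<le> 512 / (1 - s) * e'"
      proof (rule harmonic_holomorphic_part_bound[where f = "\<lambda>z. X m z - X n z" and h = "\<lambda>z. h m z - h n z"])
        show "cmod (X m w - X n w) \<le> e'" if "cmod w \<le> (1 + s) / 2" for w
          using M[of w m n] that mn by (simp add: dist_norm)
      qed (use x s X_eq in \<open>auto intro!: holomorphic_intros g h\<close>)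
      also have "\<dots> = e / 2" using s by (simp add: e'_def field_simps)
      also have "\<dots> < e" using \<open>e > 0\<close> by simp
      finally show "dist (g m x) (g n x) < e" by (simp add: dist_norm g_def)
    qed
  qed
  have hC: "uniformly_Cauchy_on (cball 0 s) h" if s: "0 \<le> s" "s < 1" for s
    unfolding uniformly_Cauchy_on_def
  proof (intro allI impI)
    fix e :: real assume "e > 0"
    then have e2: "e/2 > 0" by simp
    obtain M1 where M1: "\<And>x m n. x \<in> cball 0 s \<Longrightarrow> m \<ge> M1 \<Longrightarrow> n \<ge> M1 \<Longrightarrow> dist (X m x) (X n x) < e/2"
      using C[OF s] e2 unfolding uniformly_Cauchy_on_def by metis
    obtain M2 where M2: "\<And>x m n. x \<in> cball 0 s \<Longrightarrow> m \<ge> M2 \<Longrightarrow> n \<ge> M2 \<Longrightarrow> dist (g m x) (g n x) < e/2"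
      using gC[OF s] e2 unfolding uniformly_Cauchy_on_def by metis
    show "\<exists>M. \<forall>x\<in>cball 0 s. \<forall>m\<ge>M. \<forall>n\<ge>M. dist (h m x) (h n x) < e"
    proof (intro exI[of _ "max M1 M2"] ballI allI impI)
      fix x :: complex and m n assume x: "x \<in> cball 0 s" and mn: "m \<ge> max M1 M2" "n \<ge> max M1 M2"
      have "x \<in> disc" using x s by (simp add: disc_def)
      then have "cnj (h m x - h n x) = (X m x - X n x) - (g m x - g n x)" using X_eq by simp
      then have "cmod (h m x - h n x) \<le> cmod (X m x - X n x) + cmod (g m x - g n x)"
        by (metis complex_mod_cnj norm_triangle_ineq4)
      then show "dist (h m x) (h n x) < e" using M1[OF x, of m n] M2[OF x, of m n] mn by (simp add: dist_norm)
    qed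
  qed
  obtain G where G: "G holomorphic_on disc" "\<And>z. z \<in> disc \<Longrightarrow> (\<lambda>n. g n z) \<longlonglongrightarrow> G z"
    using holomorphic_locally_uniform_Cauchy[of g] g gC by blast
  obtain H where H: "H holomorphic_on disc" "\<And>z. z \<in> disc \<Longrightarrow> (\<lambda>n. h n z) \<longlonglongrightarrow> H z"
    using holomorphic_locally_uniform_Cauchy[of h] h hC by blast
  show ?thesis
  proof
    show "harmonic_on (\<lambda>z. G z + cnj (H z)) disc" by (rule harmonic_on_holomorphic_plus_cnj[OF G(1) H(1)]) simp
    show "(\<lambda>n. X n z) \<longlonglongrightarrow> G z + cnj (H z)" if "z \<in> disc" for z
      unfolding X_eq[OF that] by (intro tendsto_intros G H that)
  qed
qed

section \<open>The weighted harmonic space and its kernel\<close>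

context A2
begin

lemma mass_eq: "mass f disc = (\<integral>\<^sup>+z. ennreal (norm ((cmod (f z))\<^sup>2 * \<omega> z)) \<partial>dA)"
  using weight_pos AE_space
  by (intro nn_integral_cong_AE) (auto elim!: eventually_elim2)

lemma L2h_iff: "f \<in> L2h \<omega> \<longleftrightarrow> harmonic_on f disc \<and> mass f disc < \<infinity>"
proof -
  have "integrable dA (\<lambda>z. (cmod (f z))\<^sup>2 * \<omega> z) \<longleftrightarrow> mass f disc < \<infinity>" if "harmonic_on f disc"
  proof -
    have [measurable]: "f \<in> borel_measurable dA" by (rule harmonic_measurable[OF that])
    show ?thesis unfolding integrable_iff_bounded mass_eq by simp
  qed
  then show ?thesis by (auto simp: L2h_def)
qed

lemma L2h_harmonic: "f \<in> L2h \<omega> \<Longrightarrow> harmonic_on f disc"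
  by (simp add: L2h_def)

lemma L2h_measurable: "f \<in> L2h \<omega> \<Longrightarrow> f \<in> borel_measurable dA"
  using harmonic_measurable L2h_harmonic by blast

lemma inner_self: "inner_L2 \<omega> f f = of_real (LINT z|dA. (cmod (f z))\<^sup>2 * \<omega> z)"
  unfolding inner_L2_def complex_norm_square[symmetric] by (simp flip: of_real_mult of_real_power add: complex_norm_square[symmetric])

lemma inner_self_nonneg: "0 \<le> Re (inner_L2 \<omega> f f)"
  unfolding inner_self using weight_pos by (simp, intro integral_nonneg_AE) (auto elim!: eventually_mono)

lemma mass_eq_inner: "f \<in> L2h \<omega> \<Longrightarrow> mass f disc = ennreal (Re (inner_L2 \<omega> f f))"
proof -
  assume "f \<in> L2h \<omega>"
  then have i: "integrable dA (\<lambda>z. (cmod (f z))\<^sup>2 * \<omega> z)" by (simp add: L2h_def)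
  have "mass f disc = (\<integral>\<^sup>+z. ennreal ((cmod (f z))\<^sup>2 * \<omega> z) \<partial>dA)"
    by (intro nn_integral_cong) (simp add: indicator_def)
  also have "\<dots> = ennreal (LINT z|dA. (cmod (f z))\<^sup>2 * \<omega> z)"
    using weight_pos by (intro nn_integral_eq_integral i) (auto elim!: eventually_mono)
  finally show ?thesis by (simp add: inner_self)
qed

lemma inner_integrable:
  assumes "f \<in> L2h \<omega>" "g \<in> L2h \<omega>"
  shows "integrable dA (\<lambda>z. f z * cnj (g z) * complex_of_real (\<omega> z))"
proof (rule Bochner_Integration.integrable_bound)
  show "integrable dA (\<lambda>z. (cmod (f z))\<^sup>2 * \<omega> z + (cmod (g z))\<^sup>2 * \<omega> z)"
    using assms by (intro Bochner_Integration.integrable_add) (auto simp: L2h_def)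
  have [measurable]: "f \<in> borel_measurable dA" "g \<in> borel_measurable dA" using assms L2h_measurable by auto
  have "(\<lambda>z. cnj (g z)) \<in> borel_measurable dA"
    by (rule measurable_compose[OF L2h_measurable[OF assms(2)] borel_measurable_continuous_onI])
      (intro continuous_intros)
  then show "(\<lambda>z. f z * cnj (g z) * complex_of_real (\<omega> z)) \<in> borel_measurable dA" by measurable
  have le: "x * y \<le> x\<^sup>2 + y\<^sup>2" if "x \<ge> 0" "y \<ge> 0" for x y :: real
    using sum_squares_bound[of x y] mult_nonneg_nonneg[OF that] by linarith
  show "AE z in dA. norm (f z * cnj (g z) * complex_of_real (\<omega> z)) \<le> norm ((cmod (f z))\<^sup>2 * \<omega> z + (cmod (g z))\<^sup>2 * \<omega> z)"
    using weight_pos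
  proof eventually_elim
    case (elim z)
    have "norm (f z * cnj (g z) * complex_of_real (\<omega> z)) = cmod (f z) * cmod (g z) * \<omega> z"
      using elim by (simp add: norm_mult)
    also have "\<dots> \<le> ((cmod (f z))\<^sup>2 + (cmod (g z))\<^sup>2) * \<omega> z" using elim by (intro mult_right_mono le) auto
    finally show ?case using elim by (simp add: distrib_right)
  qed
qed

lemma mass_add: 
  assumes [measurable]: "f \<in> borel_measurable dA" "g \<in> borel_measurable dA" "E \<in> sets dA"
  shows "mass (\<lambda>z. f z + g z) E \<le> 2 * mass f E + 2 * mass g E"
proof -
  have "mass (\<lambda>z. f z + g z) E \<le> (\<integral>\<^sup>+z. 2 * (ennreal ((cmod (f z))\<^sup>2 * \<omega> z) * indicator E z) + 2 * (ennreal ((cmod (g z))\<^sup>2 * \<omega> z) * indicator E z) \<partial>dA)"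
  proof (rule nn_integral_mono_AE, use weight_pos in eventually_elim)
    case (elim z)
    have "(cmod (f z + g z))\<^sup>2 \<le> (cmod (f z) + cmod (g z))\<^sup>2" by (intro power_mono norm_triangle_ineq) simp
    also have "\<dots> \<le> 2 * (cmod (f z))\<^sup>2 + 2 * (cmod (g z))\<^sup>2"
      using sum_squares_bound[of "cmod (f z)" "cmod (g z)"] by (simp add: power2_sum)
    finally have "(cmod (f z + g z))\<^sup>2 * \<omega> z \<le> (2 * (cmod (f z))\<^sup>2 + 2 * (cmod (g z))\<^sup>2) * \<omega> z"
      using elim by (intro mult_right_mono) auto
    then have "ennreal ((cmod (f z + g z))\<^sup>2 * \<omega> z) \<le> ennreal (2 * ((cmod (f z))\<^sup>2 * \<omega> z) + 2 * ((cmod (g z))\<^sup>2 * \<omega> z))"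
      by (intro ennreal_leI) (simp add: algebra_simps)
    also have "\<dots> = 2 * ennreal ((cmod (f z))\<^sup>2 * \<omega> z) + 2 * ennreal ((cmod (g z))\<^sup>2 * \<omega> z)"
      using elim by (simp add: ennreal_mult)
    finally show ?case by (simp add: indicator_def)
  qed
  also have "\<dots> = 2 * mass f E + 2 * mass g E" by (simp add: nn_integral_add nn_integral_cmult)
  finally show ?thesis .
qed

lemma sets_dA_disc [measurable]: "disc \<in> sets dA"
  using sets.top[of dA] by simp

lemma L2h_add: "f \<in> L2h \<omega> \<Longrightarrow> g \<in> L2h \<omega> \<Longrightarrow> (\<lambda>z. f z + g z) \<in> L2h \<omega>"
  unfolding L2h_iff
  by (auto intro!: harmonic_add le_less_trans[OF mass_add] harmonic_measurable simp: ennreal_mult_less_top sets_dA_disc)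

lemma L2h_scale: "f \<in> L2h \<omega> \<Longrightarrow> (\<lambda>z. c * f z) \<in> L2h \<omega>"
  by (auto simp: L2h_def harmonic_scale norm_mult power_mult_distrib mult.assoc)

lemma L2h_diff: "f \<in> L2h \<omega> \<Longrightarrow> g \<in> L2h \<omega> \<Longrightarrow> (\<lambda>z. f z - g z) \<in> L2h \<omega>"
  using L2h_add[of f "\<lambda>z. (-1) * g z"] L2h_scale[of g "-1"] by simp

text \<open>Bounded point evaluations turn a Cauchy sequence in norm into a locally uniform one,
  whose pointwise limit is harmonic; Fatou's lemma upgrades this to convergence in norm.\<close>

lemma L2h_complete:
  assumes X: "\<And>n. X n \<in> L2h \<omega>"
    and Cauchy: "\<And>e. e > 0 \<Longrightarrow> \<exists>N. \<forall>m\<ge>N. \<forall>n\<ge>N. Re (inner_L2 \<omega> (\<lambda>z. X m z - X n z) (\<lambda>z. X m z - X n z)) < e"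
  shows "\<exists>F\<in>L2h \<omega>. (\<lambda>n. Re (inner_L2 \<omega> (\<lambda>z. X n z - F z) (\<lambda>z. X n z - F z))) \<longlonglongrightarrow> 0"
proof -
  let ?Q = "\<lambda>m n. Re (inner_L2 \<omega> (\<lambda>z. X m z - X n z) (\<lambda>z. X m z - X n z))"
  have mQ: "mass (\<lambda>z. X m z - X n z) disc = ennreal (?Q m n)" for m n
    by (rule mass_eq_inner) (intro L2h_diff X)
  have "uniformly_Cauchy_on (cball 0 s) X" if s: "0 \<le> s" "s < 1" for s
    unfolding uniformly_Cauchy_on_def
  proof (intro allI impI)
    fix e :: real assume e: "e > 0"
    obtain C where C: "C > 0" "\<And>f z. harmonic_on f disc \<Longrightarrow> cmod z \<le> s \<Longrightarrow> ennreal ((cmod (f z))\<^sup>2) \<le> ennreal C * mass f disc"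
      using harmonic_locally_bounded_mass[OF s] by metis
    obtain N where N: "\<And>m n. m \<ge> N \<Longrightarrow> n \<ge> N \<Longrightarrow> ?Q m n < e\<^sup>2 / C"
      using Cauchy[of "e\<^sup>2 / C"] e C(1) by (metis divide_pos_pos zero_less_power)
    show "\<exists>M. \<forall>x\<in>cball 0 s. \<forall>m\<ge>M. \<forall>n\<ge>M. dist (X m x) (X n x) < e"
    proof (intro exI[of _ N] ballI allI impI)
      fix x :: complex and m n assume x: "x \<in> cball 0 s" and mn: "m \<ge> N" "n \<ge> N"
      have "ennreal ((cmod (X m x - X n x))\<^sup>2) \<le> ennreal C * mass (\<lambda>z. X m z - X n z) disc"
        using x by (intro C(2) harmonic_diff L2h_harmonic X) simp
      also have "\<dots> = ennreal (C * ?Q m n)" unfolding mQ using C(1) by (simp add: ennreal_mult inner_self_nonneg)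
      finally have "(cmod (X m x - X n x))\<^sup>2 \<le> C * ?Q m n"
        using C(1) by (subst (asm) ennreal_le_iff) (auto simp: inner_self_nonneg)
      also have "\<dots> < C * (e\<^sup>2 / C)" using N[OF mn] C(1) by (intro mult_strict_left_mono)
      also have "\<dots> = e\<^sup>2" using C(1) by simp
      finally show "dist (X m x) (X n x) < e" using e by (simp add: dist_norm power_less_imp_less_base)
    qed
  qed
  then obtain F where F: "harmonic_on F disc" "\<And>z. z \<in> disc \<Longrightarrow> (\<lambda>n. X n z) \<longlonglongrightarrow> F z"
    using harmonic_locally_uniform_Cauchy[of X] L2h_harmonic[OF X] by blast
  have [measurable]: "X n \<in> borel_measurable dA" for n using L2h_measurable[OF X] .
  have limit_mass: "\<exists>N. \<forall>n\<ge>N. mass (\<lambda>z. X n z - F z) disc \<le> ennreal e" if e: "e > 0" for e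
  proof -
    obtain N where N: "\<And>m n. m \<ge> N \<Longrightarrow> n \<ge> N \<Longrightarrow> ?Q m n < e" using Cauchy[OF e] by blast
    show ?thesis
    proof (intro exI[of _ N] allI impI)
      fix n assume n: "n \<ge> N"
      \<comment> \<open>For fixed \<open>n\<close> the integrand is the pointwise limit of those
        with \<open>X m\<close> in place of \<open>F\<close>, so Fatou bounds its integral by the
        Cauchy estimate.\<close>
      have "mass (\<lambda>z. X n z - F z) disc = (\<integral>\<^sup>+z. liminf (\<lambda>m. ennreal ((cmod (X n z - X m z))\<^sup>2 * \<omega> z) * indicator disc z) \<partial>dA)"
      proof (intro nn_integral_cong)
        fix z assume "z \<in> space dA"
        then have z: "z \<in> disc" by simp
        have "(\<lambda>m. ennreal ((cmod (X n z - X m z))\<^sup>2 * \<omega> z)) \<longlonglongrightarrow> ennreal ((cmod (X n z - F z))\<^sup>2 * \<omega> z)"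
          by (intro tendsto_intros tendsto_ennrealI F(2) z)
        then show "ennreal ((cmod (X n z - F z))\<^sup>2 * \<omega> z) * indicator disc z = liminf (\<lambda>m. ennreal ((cmod (X n z - X m z))\<^sup>2 * \<omega> z) * indicator disc z)"
          using z by (simp add: lim_imp_Liminf)
      qed
      also have "\<dots> \<le> liminf (\<lambda>m. mass (\<lambda>z. X n z - X m z) disc)"
        by (rule nn_integral_liminf) measurable
      also have "\<dots> \<le> ennreal e"
      proof (rule Liminf_le)
        show "\<forall>\<^sub>F m in sequentially. mass (\<lambda>z. X n z - X m z) disc \<le> ennreal e"
          unfolding mQ eventually_sequentially using N n by (intro exI[of _ N] allI impI ennreal_leI less_imp_le) auto
      qed simp
      finally show "mass (\<lambda>z. X n z - F z) disc \<le> ennreal e" .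
    qed
  qed
  obtain N where N: "\<And>n. n \<ge> N \<Longrightarrow> mass (\<lambda>z. X n z - F z) disc \<le> ennreal 1" using limit_mass[of 1] by auto
  have XF: "(\<lambda>z. X N z - F z) \<in> L2h \<omega>"
    unfolding L2h_iff using N[of N] F(1) L2h_harmonic[OF X] by (auto intro!: harmonic_diff le_less_trans[OF N])
  have FL: "F \<in> L2h \<omega>" using L2h_diff[OF X[of N] XF] by simp
  have "(\<lambda>n. Re (inner_L2 \<omega> (\<lambda>z. X n z - F z) (\<lambda>z. X n z - F z))) \<longlonglongrightarrow> 0"
  proof (rule LIMSEQ_I)
    fix r :: real assume r: "r > 0"
    then obtain N where N: "\<And>n. n \<ge> N \<Longrightarrow> mass (\<lambda>z. X n z - F z) disc \<le> ennreal (r / 2)" using limit_mass[of "r/2"] by auto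
    show "\<exists>no. \<forall>n\<ge>no. norm (Re (inner_L2 \<omega> (\<lambda>z. X n z - F z) (\<lambda>z. X n z - F z)) - 0) < r"
    proof (intro exI[of _ N] allI impI)
      fix n assume "n \<ge> N"
      then have "ennreal (Re (inner_L2 \<omega> (\<lambda>z. X n z - F z) (\<lambda>z. X n z - F z))) \<le> ennreal (r / 2)"
        using N mass_eq_inner[OF L2h_diff[OF X FL]] by simp
      then have "Re (inner_L2 \<omega> (\<lambda>z. X n z - F z) (\<lambda>z. X n z - F z)) \<le> r / 2"
        using r by (subst (asm) ennreal_le_iff) auto
      then show "norm (Re (inner_L2 \<omega> (\<lambda>z. X n z - F z) (\<lambda>z. X n z - F z)) - 0) < r"
        using r inner_self_nonneg by simp
    qed
  qed
  with FL show ?thesis by blast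
qed

sublocale L2: complete_function_space "L2h \<omega>" "inner_L2 \<omega>"
proof
  show "(\<lambda>_. 0) \<in> L2h \<omega>" by (simp add: L2h_def harmonic_zero)
  fix f g h c assume f: "f \<in> L2h \<omega>"
  show "0 \<le> Re (inner_L2 \<omega> f f)" by (rule inner_self_nonneg)
  show "(\<lambda>z. c * f z) \<in> L2h \<omega>" by (rule L2h_scale[OF f])
  { assume g: "g \<in> L2h \<omega>"
    show "(\<lambda>z. f z + g z) \<in> L2h \<omega>" by (rule L2h_add[OF f g])
    have "inner_L2 \<omega> g f = (LINT z|dA. cnj (f z * cnj (g z) * complex_of_real (\<omega> z)))"
      unfolding inner_L2_def by (rule Bochner_Integration.integral_cong) (simp_all add: ac_simps)
    then show "inner_L2 \<omega> g f = cnj (inner_L2 \<omega> f g)"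
      using Bochner_Integration.integral_cnj[of dA "\<lambda>z. f z * cnj (g z) * complex_of_real (\<omega> z)"]
      unfolding inner_L2_def by (simp only:)
    assume h: "h \<in> L2h \<omega>"
    have "inner_L2 \<omega> (\<lambda>z. f z + g z) h = (LINT z|dA. f z * cnj (h z) * complex_of_real (\<omega> z) + g z * cnj (h z) * complex_of_real (\<omega> z))"
      unfolding inner_L2_def by (rule Bochner_Integration.integral_cong) (simp_all add: algebra_simps)
    then show "inner_L2 \<omega> (\<lambda>z. f z + g z) h = inner_L2 \<omega> f h + inner_L2 \<omega> g h"
      using inner_integrable f g h unfolding inner_L2_def by simp }
  show "inner_L2 \<omega> (\<lambda>z. c * f z) h = c * inner_L2 \<omega> f h" if "h \<in> L2h \<omega>"
    unfolding inner_L2_def by (simp add: mult.assoc)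
next
  fix X :: "nat \<Rightarrow> complex \<Rightarrow> complex"
  assume "\<And>n. X n \<in> L2h \<omega>"
    "\<And>e. 0 < e \<Longrightarrow> \<exists>N. \<forall>m\<ge>N. \<forall>n\<ge>N. Re (inner_L2 \<omega> (\<lambda>z. X m z - X n z) (\<lambda>z. X m z - X n z)) < e"
  then show "\<exists>f\<in>L2h \<omega>. (\<lambda>n. Re (inner_L2 \<omega> (\<lambda>z. X n z - f z) (\<lambda>z. X n z - f z))) \<longlonglongrightarrow> 0"
    by (rule L2h_complete)
qed

text \<open>The choice in \<open>repr_kernel\<close> is legitimate because evaluation at
  \<open>z\<close> is a bounded functional, so Riesz provides a witness.\<close>

lemma repr_kernel:
  assumes z: "z \<in> disc"
  shows "repr_kernel \<omega> z \<in> L2h \<omega>" "f \<in> L2h \<omega> \<Longrightarrow> f z = inner_L2 \<omega> f (repr_kernel \<omega> z)"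
proof -
  obtain C where C: "C > 0" "\<And>f w. harmonic_on f disc \<Longrightarrow> cmod w \<le> cmod z \<Longrightarrow> ennreal ((cmod (f w))\<^sup>2) \<le> ennreal C * mass f disc"
    using harmonic_locally_bounded_mass[of "cmod z"] z by (auto simp: disc_def)
  have "\<exists>k\<in>L2h \<omega>. \<forall>f\<in>L2h \<omega>. f z = inner_L2 \<omega> f k"
  proof (rule L2.Riesz_representation[where L = "\<lambda>f. f z" and C = C])
    fix f assume f: "f \<in> L2h \<omega>"
    have "ennreal ((cmod (f z))\<^sup>2) \<le> ennreal C * mass f disc" by (rule C(2)[OF L2h_harmonic[OF f]]) simp
    also have "\<dots> = ennreal (C * Re (inner_L2 \<omega> f f))"
      using C(1) by (simp add: mass_eq_inner[OF f] ennreal_mult inner_self_nonneg)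
    finally show "(cmod (f z))\<^sup>2 \<le> C * Re (inner_L2 \<omega> f f)"
      using C(1) by (subst (asm) ennreal_le_iff) (auto simp: inner_self_nonneg)
  qed auto
  then have "\<exists>k. k \<in> L2h \<omega> \<and> (\<forall>f\<in>L2h \<omega>. f z = inner_L2 \<omega> f k)" by blast
  from someI_ex[OF this] show "repr_kernel \<omega> z \<in> L2h \<omega>" "f \<in> L2h \<omega> \<Longrightarrow> f z = inner_L2 \<omega> f (repr_kernel \<omega> z)"
    unfolding repr_kernel_def by blast+
qed

text \<open>Sampling produces values of the kernel based at \<open>z\<close>; the expansion needs
  the kernels based at the lattice points.\<close>

lemma repr_kernel_cnj:
  assumes "z \<in> disc" "a \<in> disc"
  shows "cnj (repr_kernel \<omega> z a) = repr_kernel \<omega> a z"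
  using repr_kernel(2)[OF assms(2) repr_kernel(1)[OF assms(1)]] repr_kernel(2)[OF assms(1) repr_kernel(1)[OF assms(2)]]
    L2.ip_cnj[OF repr_kernel(1)[OF assms(1)] repr_kernel(1)[OF assms(2)]] by simp

end

section \<open>Lattices\<close>

lemma pseudohyperbolic_denominator:
  assumes "a \<in> disc" "z \<in> disc"
  shows "1 - cmod a \<le> cmod (1 - cnj a * z)" "1 - cnj a * z \<noteq> 0"
proof -
  have "cmod (cnj a * z) \<le> cmod a * 1" using assms unfolding norm_mult by (intro mult_mono) (auto simp: disc_def)
  then show "1 - cmod a \<le> cmod (1 - cnj a * z)" using norm_triangle_ineq2[of 1 "cnj a * z"] by simp
  then show "1 - cnj a * z \<noteq> 0" using assms by (auto simp: disc_def)
qed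

lemma pseudohyperbolic_commute: "pseudohyperbolic a b = pseudohyperbolic b a"
proof -
  have "cmod (1 - cnj a * b) = cmod (cnj (1 - cnj a * b))" by (rule complex_mod_cnj[symmetric])
  then show ?thesis by (simp add: pseudohyperbolic_def norm_divide norm_minus_commute mult.commute)
qed

lemma pseudohyperbolic_le:
  assumes "a \<in> disc" "z \<in> disc"
  shows "pseudohyperbolic a z \<le> cmod (z - a) / (1 - cmod a)"
  unfolding pseudohyperbolic_def norm_divide
  using pseudohyperbolic_denominator[OF assms] assms by (intro divide_left_mono) (auto simp: disc_def)

text \<open>The denominator of the pseudohyperbolic distance is at most
  \<open>2 * (1 - cmod a) + cmod (z - a)\<close>. Multiplied by \<open>\<epsilon> \<le> 1/2\<close>,
  its second term is absorbed on the left, which doubles the constant to \<open>4\<close>.\<close>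

lemma pseudo_disc_subset_ball:
  assumes "a \<in> disc" "0 < \<epsilon>" "\<epsilon> \<le> 1 / 2"
  shows "pseudo_disc a \<epsilon> \<subseteq> ball a (4 * \<epsilon> * (1 - cmod a))"
proof
  fix z assume "z \<in> pseudo_disc a \<epsilon>"
  then have z: "z \<in> disc" "pseudohyperbolic a z < \<epsilon>" by (auto simp: pseudo_disc_def)
  let ?d = "cmod (z - a)"
  have "?d < \<epsilon> * cmod (1 - cnj a * z)"
    using z(2) pseudohyperbolic_denominator[OF assms(1) z(1)] by (simp add: pseudohyperbolic_def norm_divide divide_less_eq)
  also have "cmod (1 - cnj a * z) \<le> 2 * (1 - cmod a) + ?d"
  proof -
    have "1 - cnj a * z = of_real (1 - (cmod a)\<^sup>2) - cnj a * (z - a)"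
      using complex_norm_square[of a] by (simp add: algebra_simps)
    then have "cmod (1 - cnj a * z) \<le> cmod (of_real (1 - (cmod a)\<^sup>2)) + cmod (cnj a * (z - a))"
      by (metis norm_triangle_ineq4)
    also have "cmod (of_real (1 - (cmod a)\<^sup>2)) = (1 + cmod a) * (1 - cmod a)"
      using assms(1) by (simp only: norm_of_real) (simp add: disc_def power2_eq_square algebra_simps mult_le_one)
    also have "\<dots> \<le> 2 * (1 - cmod a)" using assms(1) by (intro mult_right_mono) (auto simp: disc_def)
    also have "cmod (cnj a * (z - a)) \<le> 1 * ?d" unfolding norm_mult using assms(1) by (intro mult_right_mono) (auto simp: disc_def)
    finally show ?thesis by simp
  qed
  finally have "?d < \<epsilon> * (2 * (1 - cmod a) + ?d)" using assms by simp
  moreover have "\<epsilon> * ?d \<le> 1 / 2 * ?d" using assms by (intro mult_right_mono) auto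
  ultimately have "?d < 4 * \<epsilon> * (1 - cmod a)" by (simp add: algebra_simps)
  then show "z \<in> ball a (4 * \<epsilon> * (1 - cmod a))" by (simp add: dist_norm norm_minus_commute)
qed

lemma pseudo_disc_measurable:
  assumes "a \<in> disc"
  shows "pseudo_disc a \<epsilon> \<in> sets dA"
proof (rule sets_dA_borel)
  have "continuous_on disc (\<lambda>z. pseudohyperbolic a z)"
    unfolding pseudohyperbolic_def using pseudohyperbolic_denominator(2)[OF assms] by (intro continuous_intros) auto
  then have "open (disc \<inter> (\<lambda>z. pseudohyperbolic a z) -` {..<\<epsilon>})"
    using continuous_open_preimage open_disc open_lessThan by blast
  moreover have "disc \<inter> (\<lambda>z. pseudohyperbolic a z) -` {..<\<epsilon>} = pseudo_disc a \<epsilon>" by (auto simp: pseudo_disc_def)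
  ultimately show "pseudo_disc a \<epsilon> \<in> sets borel" by simp
qed (auto simp: pseudo_disc_def)

text \<open>By symmetry let \<open>a\<close> be the centre nearer to the origin, so that its ball
  has the larger radius. A common point would give
  \<open>cmod (b - a) < \<epsilon> / 2 * (1 - cmod a)\<close>, too close for the separation.\<close>

lemma separated_balls_disjoint:
  assumes "a \<in> disc" "b \<in> disc" and sep: "\<epsilon> / 2 \<le> pseudohyperbolic a b" and "\<epsilon> > 0"
  shows "ball a (\<epsilon> / 4 * (1 - cmod a)) \<inter> ball b (\<epsilon> / 4 * (1 - cmod b)) = {}"
proof -
  have *: "ball a (\<epsilon> / 4 * (1 - cmod a)) \<inter> ball b (\<epsilon> / 4 * (1 - cmod b)) = {}"
    if a: "a \<in> disc" and b: "b \<in> disc" and sep: "\<epsilon> / 2 \<le> pseudohyperbolic a b" and le: "cmod a \<le> cmod b" for a b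
  proof (rule ccontr)
    assume "\<not> ?thesis"
    then obtain x where x: "dist a x < \<epsilon> / 4 * (1 - cmod a)" "dist b x < \<epsilon> / 4 * (1 - cmod b)" by auto
    have "cmod (b - a) \<le> dist a x + dist b x"
      using dist_triangle2[of a b x] by (simp add: dist_norm norm_minus_commute)
    also have "\<dots> < \<epsilon> / 4 * (1 - cmod a) + \<epsilon> / 4 * (1 - cmod b)" using x by simp
    also have "\<epsilon> / 4 * (1 - cmod b) \<le> \<epsilon> / 4 * (1 - cmod a)" using le \<open>\<epsilon> > 0\<close> by (intro mult_left_mono) auto
    finally have "cmod (b - a) < \<epsilon> / 2 * (1 - cmod a)" by simp
    then have "cmod (b - a) / (1 - cmod a) < \<epsilon> / 2" using a by (simp add: disc_def divide_less_eq)
    then show False using pseudohyperbolic_le[OF a b] sep by linarith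
  qed
  show ?thesis
    using *[OF assms(1,2) sep] *[OF assms(2,1)] sep pseudohyperbolic_commute[of a b] by (cases "cmod a \<le> cmod b") auto
qed

text \<open>A maximal separated subset of the disc covers, since an uncovered point could be added
  to it. Disjoint open balls around its points make it countable; it is infinite because finitely
  many of the discs stay away from the unit circle.\<close>

lemma lattice_exists:
  assumes \<epsilon>: "0 < \<epsilon>" "\<epsilon> \<le> 1 / 8"
  obtains a where "is_lattice \<epsilon> a" "\<And>n m. n \<noteq> m \<Longrightarrow> \<epsilon> / 2 \<le> pseudohyperbolic (a n) (a m)"
proof -
  define \<A> where "\<A> = {S. S \<subseteq> disc \<and> (\<forall>x\<in>S. \<forall>y\<in>S. x \<noteq> y \<longrightarrow> \<epsilon> / 2 \<le> pseudohyperbolic x y)}"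
  have "\<exists>M\<in>\<A>. \<forall>X\<in>\<A>. M \<subseteq> X \<longrightarrow> X = M"
  proof (rule subset_Zorn_nonempty)
    show "\<A> \<noteq> {}" by (auto simp: \<A>_def)
    fix \<C> assume C: "\<C> \<noteq> {}" "subset.chain \<A> \<C>"
    show "\<Union>\<C> \<in> \<A>" unfolding \<A>_def
    proof (intro CollectI conjI ballI impI)
      show "\<Union>\<C> \<subseteq> disc" using C by (auto simp: subset.chain_def \<A>_def)
      fix x y assume "x \<in> \<Union>\<C>" "y \<in> \<Union>\<C>" and ne: "x \<noteq> y"
      then obtain S T where ST: "S \<in> \<C>" "T \<in> \<C>" "x \<in> S" "y \<in> T" by blast
      then have "S \<subseteq> T \<or> T \<subseteq> S" using C(2) unfolding subset.chain_def by blast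
      then obtain U where "U \<in> \<C>" "x \<in> U" "y \<in> U" using ST by blast
      then show "\<epsilon> / 2 \<le> pseudohyperbolic x y" using C(2) ne by (auto simp: subset.chain_def \<A>_def)
    qed
  qed
  then obtain M where M: "M \<in> \<A>" and max: "\<And>X. X \<in> \<A> \<Longrightarrow> M \<subseteq> X \<Longrightarrow> X = M" by blast
  have Md: "M \<subseteq> disc" and sep: "\<And>x y. x \<in> M \<Longrightarrow> y \<in> M \<Longrightarrow> x \<noteq> y \<Longrightarrow> \<epsilon> / 2 \<le> pseudohyperbolic x y"
    using M by (auto simp: \<A>_def)
  have cover: "\<exists>x\<in>M. z \<in> pseudo_disc x \<epsilon>" if z: "z \<in> disc" for z
  proof (rule ccontr)
    assume "\<not> ?thesis"
    then have far: "\<And>x. x \<in> M \<Longrightarrow> \<epsilon> / 2 \<le> pseudohyperbolic x z"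
      using z \<epsilon> by (force simp: pseudo_disc_def)
    then have "insert z M \<in> \<A>"
      unfolding \<A>_def
    proof (intro CollectI conjI ballI impI)
      fix x y assume xy: "x \<in> insert z M" "y \<in> insert z M" "x \<noteq> y"
      then consider "x \<in> M" "y \<in> M" | "x \<in> M" "y = z" | "x = z" "y \<in> M" by blast
      then show "\<epsilon> / 2 \<le> pseudohyperbolic x y"
        using sep far pseudohyperbolic_commute[of z y] xy(3) by cases simp_all
    qed (use Md z in simp)
    then have "z \<in> M" using max by blast
    with \<open>\<not> ?thesis\<close> z \<epsilon> show False by (auto simp: pseudo_disc_def pseudohyperbolic_def)
  qed
  let ?b = "\<lambda>x. ball x (\<epsilon> / 4 * (1 - cmod x))"
  have center: "x \<in> ?b x" if "x \<in> M" for x using that Md \<epsilon> by (auto simp: disc_def)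
  have disj: "?b x \<inter> ?b y = {}" if "x \<in> M" "y \<in> M" "x \<noteq> y" for x y
    using separated_balls_disjoint[OF _ _ sep[OF that]] that Md \<epsilon> by blast
  have "countable (?b ` M)"
  proof (rule countable_disjoint_open_subsets)
    show "pairwise disjnt (?b ` M)" using disj by (auto simp: pairwise_def disjnt_def)
  qed auto
  moreover have "inj_on ?b M"
  proof (rule inj_onI, rule ccontr)
    fix x y assume "x \<in> M" "y \<in> M" "?b x = ?b y" "x \<noteq> y"
    then show False using disj center by blast
  qed
  ultimately have countable: "countable M" by (rule countable_image_inj_on)
  \<comment> \<open>Separation is demanded for distinct indices, so the enumeration must be
    injective on all natural numbers.\<close>
  have infinite: "infinite M"
  proof
    assume fin: "finite M"
    \<comment> \<open>Inserting \<open>0\<close> covers an empty \<open>M\<close>. A disc about a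
      point \<open>x\<close> reaches less than halfway from \<open>x\<close> to the circle, so a
      point of modulus \<open>(1 + s) / 2\<close> escapes all of them.\<close>
    define s where "s = Max (insert 0 (cmod ` M))"
    have s: "s \<ge> 0" "s < 1" "\<And>x. x \<in> M \<Longrightarrow> cmod x \<le> s"
      using fin Md by (auto simp: s_def disc_def)
    define z :: complex where "z = of_real ((1 + s) / 2)"
    have cz: "cmod z = (1 + s) / 2" using s unfolding z_def norm_of_real by simp
    then obtain x where x: "x \<in> M" "z \<in> pseudo_disc x \<epsilon>" using cover[of z] s by (auto simp: disc_def)
    then have xd: "x \<in> disc" using Md by blast
    then have "dist x z < 4 * \<epsilon> * (1 - cmod x)" using pseudo_disc_subset_ball[of x \<epsilon>] x \<epsilon> by auto
    also have "\<dots> \<le> 1 / 2 * (1 - cmod x)" using \<epsilon> xd by (intro mult_right_mono) (auto simp: disc_def)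
    finally have "2 * cmod z < 1 + cmod x"
      using norm_triangle_sub[of z x] by (simp add: dist_norm norm_minus_commute)
    then show False using s(3)[OF x(1)] cz by simp
  qed
  define a where "a = from_nat_into M"
  have bij: "bij_betw a UNIV M" unfolding a_def by (rule bij_betw_from_nat_into[OF countable infinite])
  then have range: "range a = M" and inj: "inj a" by (auto simp: bij_betw_def)
  have asep: "\<epsilon> / 2 \<le> pseudohyperbolic (a n) (a m)" if "n \<noteq> m" for n m
    using that sep range inj by (metis injD rangeI)
  have "is_lattice \<epsilon> a" unfolding is_lattice_def
  proof (intro conjI)
    show "range a \<subseteq> disc" using range Md by simp
    show "disc = (\<Union>n. pseudo_disc (a n) \<epsilon>)"
    proof
      show "disc \<subseteq> (\<Union>n. pseudo_disc (a n) \<epsilon>)"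
      proof
        fix z assume "z \<in> disc"
        then obtain x where "x \<in> M" "z \<in> pseudo_disc x \<epsilon>" using cover by blast
        then show "z \<in> (\<Union>n. pseudo_disc (a n) \<epsilon>)" using range by (metis UN_I UNIV_I imageE)
      qed
    qed (auto simp: pseudo_disc_def)
    show "(INF (n, m) \<in> {(n, m). n \<noteq> m}. pseudohyperbolic (a n) (a m)) \<ge> \<epsilon> / 2"
    proof (rule cINF_greatest)
      have "(0, 1) \<in> {(n :: nat, m :: nat). n \<noteq> m}" by simp
      then show "{(n :: nat, m :: nat). n \<noteq> m} \<noteq> {}" by blast
    qed (use asep in auto)
  qed
  then show ?thesis using that asep by blast
qed

section \<open>Sampling and atomic decomposition\<close>

context A2
begin

lemma disjoint_mass_sum:
  assumes "disjoint_family E" "\<And>n. E n \<in> sets dA" "f \<in> borel_measurable dA"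
  shows "(\<Sum>n. mass f (E n)) = mass f (\<Union>n. E n)"
proof -
  have [measurable]: "f \<in> borel_measurable dA" by fact
  let ?M = "density dA (\<lambda>z. ennreal ((cmod (f z))\<^sup>2 * \<omega> z))"
  have eq: "mass f S = emeasure ?M S" if "S \<in> sets dA" for S
    using that by (simp add: emeasure_density)
  have "(\<Sum>n. mass f (E n)) = (\<Sum>n. emeasure ?M (E n))" using assms eq by simp
  also have "\<dots> = emeasure ?M (\<Union>n. E n)" using assms by (intro suminf_emeasure) auto
  also have "\<dots> = mass f (\<Union>n. E n)" using assms by (intro eq[symmetric]) auto
  finally show ?thesis .
qed

lemma disjoint_W_sum_le:
  assumes "disjoint_family E" "\<And>n. E n \<in> sets dA" "\<And>n. E n \<subseteq> B"
  shows "(\<Sum>n. W (E n)) \<le> W B"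
proof -
  have "(\<Sum>n. W (E n)) = (\<Sum>n. emeasure (density dA (\<lambda>z. ennreal (\<omega> z))) (E n))"
    using assms W_eq_emeasure by simp
  also have "\<dots> = emeasure (density dA (\<lambda>z. ennreal (\<omega> z))) (\<Union>n. E n)"
    using assms by (intro suminf_emeasure) auto
  also have "\<dots> = W (\<Union>n. E n)" using assms by (intro W_eq_emeasure[symmetric]) auto
  also have "\<dots> \<le> W B" using assms by (intro W_mono) auto
  finally show ?thesis .
qed

lemma W_ball_nonzero:
  assumes "cmod a + r \<le> 1" "r > 0" shows "W (ball a r) \<noteq> 0" "W (ball a r) \<noteq> \<infinity>"
proof -
  have "W (ball a r) > 0" using assms by (intro W_pos sets_dA_ball) (auto simp: emeasure_dA_ball')
  then show "W (ball a r) \<noteq> 0" "W (ball a r) \<noteq> \<infinity>" using W_finite[of "ball a r"] by auto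
qed

end

text \<open>The constant \<open>2 ^ 17\<close> makes the total oscillation over the cells at most a quarter of the squared
  norm (\<open>oscillation_sum\<close>).\<close>

locale A2_lattice = A2 +
  fixes \<epsilon> :: real and a :: "nat \<Rightarrow> complex"
  assumes eps_pos: "0 < \<epsilon>"
    and eps_small: "\<epsilon> * (2 ^ 17 * (A + 1)) \<le> 1"
    and lattice: "is_lattice \<epsilon> a"
    and separated: "n \<noteq> m \<Longrightarrow> \<epsilon> / 2 \<le> pseudohyperbolic (a n) (a m)"
begin

lemma eps_le: "2 ^ 17 * \<epsilon> \<le> 1" "2 ^ 17 * \<epsilon> * A \<le> 1"
proof -
  have "\<epsilon> * (2 ^ 17 * (A + 1)) = 2 ^ 17 * \<epsilon> * A + 2 ^ 17 * \<epsilon>" by (simp add: algebra_simps)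
  moreover have "0 \<le> 2 ^ 17 * \<epsilon> * A" using eps_pos A_nonneg by simp
  ultimately show "2 ^ 17 * \<epsilon> \<le> 1" "2 ^ 17 * \<epsilon> * A \<le> 1" using eps_small eps_pos by simp_all
qed

lemma a_disc: "a n \<in> disc" using lattice by (auto simp: is_lattice_def)

lemma a_cover: "(\<Union>n. pseudo_disc (a n) \<epsilon>) = disc" using lattice by (simp add: is_lattice_def)

definition r :: "nat \<Rightarrow> real" where "r n = 1 - cmod (a n)"

lemma r_pos: "0 < r n" "r n \<le> 1" "cmod (a n) = 1 - r n"
  using a_disc[of n] by (auto simp: r_def disc_def)

lemma pd_subset: "pseudo_disc (a n) \<epsilon> \<subseteq> ball (a n) (4 * \<epsilon> * r n)"
  unfolding r_def using eps_pos eps_le by (intro pseudo_disc_subset_ball a_disc) auto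

text \<open>With \<open>s\<close> the radius of the disjoint balls of
  \<open>separated_balls_disjoint\<close>, the pseudohyperbolic disc fits into the ball of radius
  \<open>16 * s\<close>. The pointwise estimate with radius ratio \<open>16\<close> costs
  \<open>16^4 = 65536\<close>.\<close>

lemma upper_term:
  assumes f: "harmonic_on f disc"
  shows "ennreal ((cmod (f (a n)))\<^sup>2) * W (pseudo_disc (a n) \<epsilon>) \<le> ennreal (65536 * A) * mass f (ball (a n) (\<epsilon> / 4 * r n))"
proof -
  define s where "s = \<epsilon> / 4 * r n"
  have s: "s > 0" "4 * \<epsilon> * r n = 16 * s" using eps_pos r_pos[of n] by (auto simp: s_def)
  have "16 * s \<le> 1/2 * r n" unfolding s(2)[symmetric] using r_pos[of n] eps_le by (intro mult_right_mono) auto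
  then have s': "16 * s < 1" "cmod (a n) + s < 1" "cmod (a n) + 16 * s \<le> 1" using r_pos[of n] s by simp_all
  have "ennreal (s ^ 4 * (cmod (f (a n)))\<^sup>2) * W (ball (a n) (16 * s)) \<le> ennreal (A * (16 * s) ^ 4) * mass f (ball (a n) s)"
    by (intro harmonic_pointwise_mass f s' subset_ball) (use s in auto)
  then have *: "ennreal (1 / s ^ 4) * (ennreal (s ^ 4 * (cmod (f (a n)))\<^sup>2) * W (ball (a n) (16 * s)))
      \<le> ennreal (1 / s ^ 4) * (ennreal (A * (16 * s) ^ 4) * mass f (ball (a n) s))"
    by (rule mult_left_mono) simp
  have 1: "ennreal (1 / s ^ 4) * (ennreal (s ^ 4 * (cmod (f (a n)))\<^sup>2) * X) = ennreal ((cmod (f (a n)))\<^sup>2) * X" for X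
    using s by (simp add: mult.assoc[symmetric] ennreal_mult[symmetric])
  have 2: "ennreal (1 / s ^ 4) * (ennreal (A * (16 * s) ^ 4) * X) = ennreal (65536 * A) * X" for X
  proof -
    have "1 / s ^ 4 * (A * (16 * s) ^ 4) = 65536 * A" using s by (simp add: power_mult_distrib)
    then show ?thesis using s A_nonneg
      by (subst mult.assoc[symmetric], subst ennreal_mult[symmetric]) (auto simp: mult.commute)
  qed
  have "W (pseudo_disc (a n) \<epsilon>) \<le> W (ball (a n) (16 * s))"
    using pd_subset[of n] by (intro W_mono) (simp add: s)
  then have "ennreal ((cmod (f (a n)))\<^sup>2) * W (pseudo_disc (a n) \<epsilon>) \<le> ennreal ((cmod (f (a n)))\<^sup>2) * W (ball (a n) (16 * s))"
    by (rule mult_left_mono) simp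
  also have "\<dots> \<le> ennreal (65536 * A) * mass f (ball (a n) s)" using * unfolding 1 2 .
  finally show ?thesis unfolding s_def .
qed

lemma upper_bound:
  assumes f: "harmonic_on f disc"
  shows "(\<Sum>n. ennreal ((cmod (f (a n)))\<^sup>2) * W (pseudo_disc (a n) \<epsilon>)) \<le> ennreal (65536 * A) * mass f disc"
proof -
  let ?B = "\<lambda>n. ball (a n) (\<epsilon> / 4 * r n)"
  have sub: "cmod (a n) + \<epsilon> / 4 * r n \<le> 1" for n
    using mult_right_mono[of "\<epsilon> / 4" 1 "r n"] eps_le eps_pos r_pos[of n] by simp
  have "(\<Sum>n. ennreal ((cmod (f (a n)))\<^sup>2) * W (pseudo_disc (a n) \<epsilon>)) \<le> (\<Sum>n. ennreal (65536 * A) * mass f (?B n))"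
    by (intro suminf_le upper_term f) auto
  also have "\<dots> = ennreal (65536 * A) * (\<Sum>n. mass f (?B n))" by simp
  also have "(\<Sum>n. mass f (?B n)) = mass f (\<Union>n. ?B n)"
  proof (rule disjoint_mass_sum)
    show "disjoint_family ?B"
      unfolding disjoint_family_on_def r_def
      using separated_balls_disjoint[OF a_disc a_disc separated eps_pos] by blast
    show "?B n \<in> sets dA" for n by (rule sets_dA_ball[OF sub])
  qed (rule harmonic_measurable[OF f])
  also have "\<dots> \<le> mass f disc"
    by (intro set_nn_integral_mono_set UN_least ball_subset_disc sub)
  finally show ?thesis by (simp add: mult_left_mono)
qed

text \<open>The balls \<open>bigball n\<close> overlap more and more as \<open>\<epsilon>\<close> shrinks, but weighted by
  \<open>W (cell n) / W (bigball n)\<close> they overlap boundedly, by doubling around the common point.\<close>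

definition cell :: "nat \<Rightarrow> complex set" where "cell = disjointed (\<lambda>n. pseudo_disc (a n) \<epsilon>)"

lemma cell_subset: "cell n \<subseteq> pseudo_disc (a n) \<epsilon>"
  unfolding cell_def by (rule disjointed_subset)

lemma cell_measurable [measurable]: "cell n \<in> sets dA"
  unfolding cell_def using pseudo_disc_measurable[OF a_disc] sets.range_disjointed_sets[of "\<lambda>n. pseudo_disc (a n) \<epsilon>" dA] by auto

lemma cell_disjoint: "disjoint_family cell"
  unfolding cell_def by (rule disjoint_family_disjointed)

lemma cell_Union: "(\<Union>n. cell n) = disc"
  unfolding cell_def UN_disjointed_eq by (rule a_cover)

text \<open>The radius is a fixed fraction of the distance to the circle, independent of
  \<open>\<epsilon>\<close>. Relative to it the cell has size of order \<open>\<epsilon>\<close>,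
  which is the source of the small factor in the oscillation.\<close>

definition bigball :: "nat \<Rightarrow> complex set" where "bigball n = ball (a n) (r n / 4)"

lemma bigball_measurable [measurable]: "bigball n \<in> sets dA"
  unfolding bigball_def using r_pos[of n] by (intro sets_dA_ball) simp

lemma W_bigball: "W (bigball n) \<noteq> 0" "W (bigball n) \<noteq> \<infinity>"
  unfolding bigball_def using r_pos[of n] W_ball_nonzero[of "a n" "r n / 4"] by simp_all

lemma cell_bigball: "cell n \<subseteq> bigball n"
proof -
  have "4 * \<epsilon> * r n \<le> 1 / 4 * r n" using r_pos[of n] eps_le by (intro mult_right_mono) auto
  then have "ball (a n) (4 * \<epsilon> * r n) \<subseteq> bigball n" unfolding bigball_def by (intro subset_ball) simp
  then show ?thesis using cell_subset pd_subset by blast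
qed

lemma overlap:
  "(\<Sum>n. indicator (bigball n) w * (W (cell n) / W (bigball n))) \<le> ennreal (124 * A)"
proof (cases "w \<in> disc")
  case False
  have "bigball n \<subseteq> disc" for n using sets.sets_into_space[OF bigball_measurable] by simp
  then have "w \<notin> bigball n" for n using False by blast
  then show ?thesis by simp
next
  case True
  define t where "t = 1 - cmod w"
  have t: "0 < t" "t \<le> 1" "cmod w = 1 - t" using True by (auto simp: t_def disc_def)
  \<comment> \<open>Every \<open>bigball n\<close> containing \<open>w\<close> has
    \<open>3/4 * r n \<le> t\<close> and lies within \<open>r n / 2\<close> of \<open>w\<close>, so
    it is contained in \<open>S\<close>.\<close>
  define S where "S = ball w (2 / 3 * t)"
  have S: "W S \<noteq> 0" "W S \<noteq> \<infinity>" unfolding S_def using t W_ball_nonzero[of w "2/3*t"] by simp_all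
  \<comment> \<open>Doubling replaces the varying \<open>W (bigball n)\<close> by the fixed
    \<open>W S\<close>. As the relevant cells are disjoint subsets of \<open>S\<close>, the
    remaining quotients sum to at most \<open>1\<close>.\<close>
  have tm: "indicator (bigball n) w * (W (cell n) / W (bigball n)) \<le> ennreal (124 * A) * (W (cell n \<inter> S) / W S)" for n
  proof (cases "w \<in> bigball n")
    case True
    then have wd: "cmod (a n - w) < r n / 4" by (simp add: bigball_def dist_norm)
    have tr: "3/4 * r n \<le> t" "t \<le> 5/4 * r n"
      using wd norm_triangle_ineq3[of "a n" w] r_pos[of n] t by simp_all
    have sub: "bigball n \<subseteq> S"
    proof
      fix v assume "v \<in> bigball n"
      then have "dist (a n) v < r n / 4" by (simp add: bigball_def)
      then have "dist w v < r n / 2" using wd dist_triangle[of w v "a n"] by (simp add: dist_norm norm_minus_commute)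
      then show "v \<in> S" using tr by (simp add: S_def)
    qed
    have "ennreal ((r n / 4) ^ 4) * W S \<le> ennreal (A * (2 / 3 * t) ^ 4) * W (bigball n)"
      unfolding S_def bigball_def
      by (rule W_doubling) (use sub t r_pos[of n] in \<open>auto simp: S_def bigball_def\<close>)
    also have "\<dots> \<le> ennreal (A * (124 * (r n / 4) ^ 4)) * W (bigball n)"
    proof (intro mult_right_mono ennreal_leI mult_left_mono)
      have "(2 / 3 * t) ^ 4 \<le> (5 / 6 * r n) ^ 4" using tr t by (intro power_mono) auto
      \<comment> \<open>\<open>(5/6)^4 = (10/3)^4 / 4^4\<close>, and \<open>(10/3)^4\<close> is
        slightly below \<open>124\<close>.\<close>
      also have "\<dots> \<le> 124 * (r n / 4) ^ 4" by (simp add: power_mult_distrib power_divide)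
      finally show "(2 / 3 * t) ^ 4 \<le> 124 * (r n / 4) ^ 4" .
    qed (use A_nonneg in auto)
    also have "\<dots> = ennreal ((r n / 4) ^ 4) * (ennreal (124 * A) * W (bigball n))"
    proof -
      have "ennreal (A * (124 * (r n / 4) ^ 4)) = ennreal ((r n / 4) ^ 4) * ennreal (124 * A)"
        by (subst ennreal_mult[symmetric]) (use A_nonneg r_pos(1)[of n] in \<open>auto simp: ac_simps\<close>)
      then show ?thesis by (simp only: mult.assoc)
    qed
    finally have *: "W S \<le> ennreal (124 * A) * W (bigball n)"
      using r_pos(1)[of n] by (subst (asm) ennreal_mult_le_mult_iff) auto
    have "W (cell n) / W (bigball n) * W S \<le> W (cell n) / W (bigball n) * (ennreal (124 * A) * W (bigball n))"
      by (rule mult_left_mono[OF *]) simp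
    also have "\<dots> = ennreal (124 * A) * W (cell n)"
    proof -
      have "W (cell n) / W (bigball n) * W (bigball n) = W (cell n)"
        using W_bigball[of n] by (simp add: ennreal_divide_times ennreal_divide_self less_top)
      then show ?thesis by (simp only: mult.left_commute)
    qed
    finally have "W (cell n) / W (bigball n) * W S / W S \<le> ennreal (124 * A) * W (cell n) / W S"
      by (rule divide_right_mono_ennreal)
    moreover have "cell n \<inter> S = cell n" using cell_bigball[of n] sub by blast
    ultimately show ?thesis using True S
      by (simp add: ennreal_mult_divide_eq ennreal_times_divide)
  qed simp
  have "(\<Sum>n. indicator (bigball n) w * (W (cell n) / W (bigball n))) \<le> (\<Sum>n. ennreal (124 * A) * (W (cell n \<inter> S) / W S))"
    by (intro suminf_le tm) auto
  also have "\<dots> = ennreal (124 * A) * ((\<Sum>n. W (cell n \<inter> S)) / W S)" by simp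
  also have "\<dots> \<le> ennreal (124 * A) * (W S / W S)"
  proof (intro mult_left_mono divide_right_mono_ennreal disjoint_W_sum_le)
    have "S \<in> sets dA" unfolding S_def using t by (intro sets_dA_ball) simp
    then show "cell n \<inter> S \<in> sets dA" for n by auto
    show "disjoint_family (\<lambda>n. cell n \<inter> S)" using cell_disjoint by (auto simp: disjoint_family_on_def)
  qed auto
  also have "\<dots> = ennreal (124 * A)" using S by (simp add: ennreal_divide_self less_top)
  finally show ?thesis .
qed

text \<open>With \<open>\<rho> = r n / 16\<close> the ball of the oscillation estimate is
  \<open>bigball n\<close>, and the cell lies within \<open>64 * \<epsilon> * \<rho>\<close> of its
  centre. Hence the constant \<open>4096 * 64^2 = 2^24\<close>.\<close>

lemma oscillation_cell:
  assumes f: "harmonic_on f disc"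
  shows "mass (\<lambda>z. f z - f (a n)) (cell n) \<le> ennreal (2 ^ 24 * A * \<epsilon>\<^sup>2) * (mass f (bigball n) * (W (cell n) / W (bigball n)))"
proof -
  define \<rho> where "\<rho> = r n / 16"
  have \<rho>: "\<rho> > 0" "cmod (a n) + 4 * \<rho> \<le> 1" "4 * \<rho> < 1" "r n = 16 * \<rho>" using r_pos[of n] by (simp_all add: \<rho>_def)
  have bb: "bigball n = ball (a n) (4 * \<rho>)" by (simp add: bigball_def \<rho>)
  let ?c = "ennreal (2 ^ 24 * A * \<epsilon>\<^sup>2)"
  have pt: "ennreal ((cmod (f z - f (a n)))\<^sup>2) * W (bigball n) \<le> ?c * mass f (bigball n)" if z: "z \<in> cell n" for z
  proof -
    have "z \<in> ball (a n) (4 * \<epsilon> * r n)" using z cell_subset pd_subset by blast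
    then have d: "cmod (z - a n) < 64 * \<epsilon> * \<rho>" by (simp add: dist_norm norm_minus_commute \<rho>)
    also have "\<dots> \<le> 1 * \<rho>" using eps_le \<rho> by (intro mult_right_mono) auto
    finally have d1: "cmod (z - a n) < \<rho>" by simp
    have "ennreal ((cmod (f z - f (a n)))\<^sup>2) * W (bigball n) \<le> ennreal (4096 * A * (cmod (z - a n) / \<rho>)\<^sup>2) * mass f (bigball n)"
      unfolding bb by (rule harmonic_oscillation_mass[OF f \<rho>(1-3) d1])
    also have "\<dots> \<le> ?c * mass f (bigball n)"
    proof (intro mult_right_mono ennreal_leI)
      have "(cmod (z - a n) / \<rho>)\<^sup>2 \<le> (64 * \<epsilon>)\<^sup>2" using d \<rho> by (intro power_mono) (auto simp: divide_le_eq)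
      then have "4096 * A * (cmod (z - a n) / \<rho>)\<^sup>2 \<le> 4096 * A * (64 * \<epsilon>)\<^sup>2" using A_nonneg by (intro mult_left_mono) auto
      then show "4096 * A * (cmod (z - a n) / \<rho>)\<^sup>2 \<le> 2 ^ 24 * A * \<epsilon>\<^sup>2" by (simp add: power_mult_distrib)
    qed simp
    finally show ?thesis .
  qed
  have pt': "ennreal ((cmod (f z - f (a n)))\<^sup>2) \<le> ?c * mass f (bigball n) / W (bigball n)" if z: "z \<in> cell n" for z
    using divide_right_mono_ennreal[OF pt[OF z], of "W (bigball n)"] W_bigball[of n] by (simp add: ennreal_mult_divide_eq)
  have "mass (\<lambda>z. f z - f (a n)) (cell n) \<le> (\<integral>\<^sup>+z. ?c * mass f (bigball n) / W (bigball n) * (ennreal (\<omega> z) * indicator (cell n) z) \<partial>dA)"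
  proof (rule nn_integral_mono)
    fix z
    show "ennreal ((cmod (f z - f (a n)))\<^sup>2 * \<omega> z) * indicator (cell n) z
       \<le> ?c * mass f (bigball n) / W (bigball n) * (ennreal (\<omega> z) * indicator (cell n) z)"
      using pt'[of z] by (auto simp: indicator_def ennreal_mult'' ennreal_mult' intro!: mult_right_mono)
  qed
  also have "\<dots> = ?c * mass f (bigball n) / W (bigball n) * W (cell n)"
    unfolding weighted_area_def[of _ "cell n"] by (rule nn_integral_cmult) measurable
  finally show ?thesis by (simp add: ennreal_divide_times mult.assoc)
qed

text \<open>Interchanging sum and integral collects, at each point, exactly the weighted overlap of
  the balls \<open>bigball n\<close>, which \<open>overlap\<close> bounds by
  \<open>124 * A\<close>.\<close>

lemma oscillation_sum:
  assumes f: "harmonic_on f disc"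
  shows "(\<Sum>n. mass (\<lambda>z. f z - f (a n)) (cell n)) \<le> ennreal (1 / 4) * mass f disc"
proof -
  let ?c = "ennreal (2 ^ 24 * A * \<epsilon>\<^sup>2)"
  have [measurable]: "f \<in> borel_measurable dA" by (rule harmonic_measurable[OF f])
  let ?F = "\<lambda>z. ennreal ((cmod (f z))\<^sup>2 * \<omega> z)"
  have "(\<Sum>n. mass f (bigball n) * (W (cell n) / W (bigball n)))
      = (\<Sum>n. \<integral>\<^sup>+z. ?F z * (indicator (bigball n) z * (W (cell n) / W (bigball n))) \<partial>dA)"
    by (subst nn_integral_multc[symmetric]) (auto simp: mult.assoc)
  also have "\<dots> = (\<integral>\<^sup>+z. (\<Sum>n. ?F z * (indicator (bigball n) z * (W (cell n) / W (bigball n)))) \<partial>dA)"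
    by (rule nn_integral_suminf[symmetric]) measurable
  also have "\<dots> = (\<integral>\<^sup>+z. ?F z * (\<Sum>n. (indicator (bigball n) z * (W (cell n) / W (bigball n)))) \<partial>dA)"
    by simp
  also have "\<dots> \<le> (\<integral>\<^sup>+z. ?F z * ennreal (124 * A) \<partial>dA)"
    by (intro nn_integral_mono mult_left_mono overlap) auto
  also have "\<dots> = mass f disc * ennreal (124 * A)"
    by (subst nn_integral_multc) (auto intro!: arg_cong2[where f = "(*)"] nn_integral_cong simp: indicator_def)
  finally have sum_le: "(\<Sum>n. mass f (bigball n) * (W (cell n) / W (bigball n))) \<le> mass f disc * ennreal (124 * A)" .
  have "(\<Sum>n. mass (\<lambda>z. f z - f (a n)) (cell n)) \<le> (\<Sum>n. ?c * (mass f (bigball n) * (W (cell n) / W (bigball n))))"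
    by (intro suminf_le oscillation_cell f) auto
  also have "\<dots> = ?c * (\<Sum>n. mass f (bigball n) * (W (cell n) / W (bigball n)))" by simp
  also have "\<dots> \<le> ?c * (mass f disc * ennreal (124 * A))" by (rule mult_left_mono[OF sum_le]) simp
  also have "\<dots> = (?c * ennreal (124 * A)) * mass f disc" by (simp only: ac_simps)
  also have "\<dots> \<le> ennreal (1 / 4) * mass f disc"
  proof (rule mult_right_mono)
    \<comment> \<open>The total constant is quadratic in \<open>\<epsilon> * A\<close>; writing it
      through \<open>2 ^ 17 * \<epsilon> * A \<le> 1\<close> leaves
      \<open>124 / 1024\<close>.\<close>
    have "2 ^ 24 * A * \<epsilon>\<^sup>2 * (124 * A) = 124 / 1024 * (2 ^ 17 * \<epsilon> * A)\<^sup>2" by (simp add: power_mult_distrib power2_eq_square)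
    also have "\<dots> \<le> 124 / 1024 * 1\<^sup>2" using eps_le eps_pos A_nonneg by (intro mult_left_mono power_mono) auto
    also have "(124::real) / 1024 * 1\<^sup>2 \<le> 1 / 4" by simp
    finally have "2 ^ 24 * A * \<epsilon>\<^sup>2 * (124 * A) \<le> 1 / 4" .
    then show "?c * ennreal (124 * A) \<le> ennreal (1 / 4)"
      using A_nonneg by (subst ennreal_mult[symmetric]) (auto intro: ennreal_leI)
  qed simp
  finally show ?thesis .
qed

text \<open>On each cell split \<open>f\<close> into its value at the lattice point and its
  oscillation. The oscillations add up to at most half of the mass of \<open>f\<close> and are
  absorbed on the left.\<close>

lemma lower_bound:
  assumes f: "f \<in> L2h \<omega>"
  shows "mass f disc \<le> 4 * (\<Sum>n. ennreal ((cmod (f (a n)))\<^sup>2) * W (pseudo_disc (a n) \<epsilon>))"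
proof -
  let ?S = "\<Sum>n. ennreal ((cmod (f (a n)))\<^sup>2) * W (pseudo_disc (a n) \<epsilon>)"
  have h: "harmonic_on f disc" by (rule L2h_harmonic[OF f])
  have [measurable]: "f \<in> borel_measurable dA" by (rule L2h_measurable[OF f])
  have cell_le: "mass f (cell n) \<le> 2 * mass (\<lambda>z. f z - f (a n)) (cell n) + 2 * (ennreal ((cmod (f (a n)))\<^sup>2) * W (pseudo_disc (a n) \<epsilon>))" for n
  proof -
    have "mass f (cell n) \<le> 2 * mass (\<lambda>z. f z - f (a n)) (cell n) + 2 * mass (\<lambda>_. f (a n)) (cell n)"
      using mass_add[of "\<lambda>z. f z - f (a n)" "\<lambda>_. f (a n)" "cell n"] by simp
    also have "mass (\<lambda>_. f (a n)) (cell n) = ennreal ((cmod (f (a n)))\<^sup>2) * W (cell n)"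
      unfolding weighted_area_def by (subst nn_integral_cmult[symmetric]) (auto simp: ennreal_mult' mult.assoc)
    also have "\<dots> \<le> ennreal ((cmod (f (a n)))\<^sup>2) * W (pseudo_disc (a n) \<epsilon>)"
      by (intro mult_left_mono W_mono cell_subset) simp
    finally show ?thesis by (simp add: mult_left_mono)
  qed
  have "mass f disc = (\<Sum>n. mass f (cell n))"
    using disjoint_mass_sum[OF cell_disjoint cell_measurable, of f] cell_Union by simp
  also have "\<dots> \<le> (\<Sum>n. 2 * mass (\<lambda>z. f z - f (a n)) (cell n) + 2 * (ennreal ((cmod (f (a n)))\<^sup>2) * W (pseudo_disc (a n) \<epsilon>)))"
    by (intro suminf_le cell_le) auto
  also have "\<dots> = 2 * (\<Sum>n. mass (\<lambda>z. f z - f (a n)) (cell n)) + 2 * ?S"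
    by (subst suminf_add[symmetric]) auto
  also have "\<dots> \<le> 2 * (ennreal (1 / 4) * mass f disc) + 2 * ?S"
    by (intro add_mono mult_left_mono oscillation_sum h) auto
  finally have le: "mass f disc \<le> 2 * (ennreal (1 / 4) * mass f disc) + 2 * ?S" .
  \<comment> \<open>Absorption subtracts the mass from both sides, so it has to be finite; this is
    where membership in \<open>L2h \<omega>\<close> enters.\<close>
  obtain m where m: "mass f disc = ennreal m" "m \<ge> 0"
    using f by (cases "mass f disc") (auto simp: L2h_iff)
  show ?thesis
  proof (cases ?S)
    case (real s)
    have two: "2 * ennreal x = ennreal (2 * x)" if "x \<ge> 0" for x using that by (simp add: ennreal_mult)
    have "ennreal (1 / 4) * ennreal m = ennreal (1 / 4 * m)" by (rule ennreal_mult[symmetric]) (use m(2) in auto)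
    then have "ennreal m \<le> ennreal (2 * (1 / 4 * m)) + ennreal (2 * s)"
      using le two[of "1 / 4 * m"] two[of s] m(2) real(1) unfolding m(1) real(2) by (simp only:)
    also have "\<dots> = ennreal (2 * (1 / 4 * m) + 2 * s)" by (rule ennreal_plus[symmetric]) (use m(2) real(1) in auto)
    finally have "ennreal m \<le> ennreal (2 * (1 / 4 * m) + 2 * s)" .
    then have "m \<le> 2 * (1 / 4 * m) + 2 * s" using m(2) real by (subst (asm) ennreal_le_iff) auto
    then have "ennreal m \<le> ennreal (4 * s)" by (intro ennreal_leI) simp
    then show ?thesis unfolding m(1) real using real by (simp add: ennreal_mult)
  qed (simp add: ennreal_mult_top)
qed

section \<open>The sampled inner product and the atomic decomposition\<close>

definition d :: "nat \<Rightarrow> real" where "d n = enn2real (W (pseudo_disc (a n) \<epsilon>))"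

lemma d_nonneg: "d n \<ge> 0" by (simp add: d_def)

lemma W_eq_d: "W (pseudo_disc (a n) \<epsilon>) = ennreal (d n)"
  using W_finite[of "pseudo_disc (a n) \<epsilon>"] by (simp add: d_def)

lemma sampling:
  assumes f: "f \<in> L2h \<omega>"
  shows "summable (\<lambda>n. (cmod (f (a n)))\<^sup>2 * d n)"
    and "(\<Sum>n. (cmod (f (a n)))\<^sup>2 * d n) \<le> 65536 * A * Re (inner_L2 \<omega> f f)"
    and "Re (inner_L2 \<omega> f f) \<le> 4 * (\<Sum>n. (cmod (f (a n)))\<^sup>2 * d n)"
proof -
  have eq: "ennreal ((cmod (f (a n)))\<^sup>2) * W (pseudo_disc (a n) \<epsilon>) = ennreal ((cmod (f (a n)))\<^sup>2 * d n)" for n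
    unfolding W_eq_d by (simp add: ennreal_mult d_nonneg)
  have up: "(\<Sum>n. ennreal ((cmod (f (a n)))\<^sup>2 * d n)) \<le> ennreal (65536 * A * Re (inner_L2 \<omega> f f))"
  proof -
    have "(\<Sum>n. ennreal ((cmod (f (a n)))\<^sup>2 * d n)) \<le> ennreal (65536 * A) * ennreal (Re (inner_L2 \<omega> f f))"
      using upper_bound[OF L2h_harmonic[OF f]] unfolding eq mass_eq_inner[OF f] .
    also have "\<dots> = ennreal (65536 * A * Re (inner_L2 \<omega> f f))"
      by (rule ennreal_mult[symmetric]) (use A_nonneg inner_self_nonneg[of f] in auto)
    finally show ?thesis .
  qed
  have nn: "0 \<le> (cmod (f (a n)))\<^sup>2 * d n" for n by (simp add: d_nonneg)
  show s: "summable (\<lambda>n. (cmod (f (a n)))\<^sup>2 * d n)"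
    by (rule summable_suminf_not_top[OF nn]) (use up in \<open>auto simp: top_unique\<close>)
  have "(\<Sum>n. ennreal ((cmod (f (a n)))\<^sup>2 * d n)) = ennreal (\<Sum>n. (cmod (f (a n)))\<^sup>2 * d n)"
    by (rule suminf_ennreal2[OF nn s])
  note e = this
  show "(\<Sum>n. (cmod (f (a n)))\<^sup>2 * d n) \<le> 65536 * A * Re (inner_L2 \<omega> f f)"
    using up unfolding e using A_nonneg inner_self_nonneg[of f] by (subst (asm) ennreal_le_iff) auto
  have "ennreal (Re (inner_L2 \<omega> f f)) \<le> ennreal (4 * (\<Sum>n. (cmod (f (a n)))\<^sup>2 * d n))"
    using lower_bound[OF f] unfolding eq e mass_eq_inner[OF f] using suminf_nonneg[OF s nn] by (simp add: ennreal_mult)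
  then show "Re (inner_L2 \<omega> f f) \<le> 4 * (\<Sum>n. (cmod (f (a n)))\<^sup>2 * d n)"
    using suminf_nonneg[OF s nn] by (subst (asm) ennreal_le_iff) auto
qed

definition sampled_inner :: "(complex \<Rightarrow> complex) \<Rightarrow> (complex \<Rightarrow> complex) \<Rightarrow> complex" where
  "sampled_inner f g = (\<Sum>n. f (a n) * cnj (g (a n)) * of_real (d n))"

lemma sampled_summable:
  assumes "f \<in> L2h \<omega>" "g \<in> L2h \<omega>"
  shows "summable (\<lambda>n. f (a n) * cnj (g (a n)) * of_real (d n))"
proof (rule summable_comparison_test')
  show "summable (\<lambda>n. (cmod (f (a n)))\<^sup>2 * d n + (cmod (g (a n)))\<^sup>2 * d n)"
    by (intro summable_add sampling assms)
  fix n
  have le: "x * y \<le> x\<^sup>2 + y\<^sup>2" if "x \<ge> 0" "y \<ge> 0" for x y :: real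
    using sum_squares_bound[of x y] mult_nonneg_nonneg[OF that] by linarith
  have "norm (f (a n) * cnj (g (a n)) * of_real (d n)) = cmod (f (a n)) * cmod (g (a n)) * d n"
    using d_nonneg by (simp add: norm_mult)
  also have "\<dots> \<le> ((cmod (f (a n)))\<^sup>2 + (cmod (g (a n)))\<^sup>2) * d n" using d_nonneg by (intro mult_right_mono le) auto
  finally show "norm (f (a n) * cnj (g (a n)) * of_real (d n)) \<le> (cmod (f (a n)))\<^sup>2 * d n + (cmod (g (a n)))\<^sup>2 * d n"
    by (simp add: distrib_right)
qed

lemma sampled_self:
  assumes "f \<in> L2h \<omega>"
  shows "sampled_inner f f = of_real (\<Sum>n. (cmod (f (a n)))\<^sup>2 * d n)"
proof -
  have "sampled_inner f f = (\<Sum>n. of_real ((cmod (f (a n)))\<^sup>2 * d n))"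
    unfolding sampled_inner_def by (simp flip: complex_norm_square)
  then show ?thesis using suminf_of_real[OF sampling(1)[OF assms]] by metis
qed

sublocale sampled: complete_function_space "L2h \<omega>" sampled_inner
proof
  show "(\<lambda>_. 0) \<in> L2h \<omega>" by (rule L2.zero)
  fix f g h c assume f: "f \<in> L2h \<omega>"
  show "0 \<le> Re (sampled_inner f f)"
    using suminf_nonneg[OF sampling(1)[OF f]] d_nonneg by (simp add: sampled_self[OF f])
  show "(\<lambda>z. c * f z) \<in> L2h \<omega>" by (rule L2.scale[OF f])
  { assume g: "g \<in> L2h \<omega>"
    show "(\<lambda>z. f z + g z) \<in> L2h \<omega>" by (rule L2.add[OF f g])
    have "(\<lambda>n. cnj (f (a n) * cnj (g (a n)) * of_real (d n))) sums cnj (sampled_inner f g)"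
      unfolding sampled_inner_def sums_cnj by (rule summable_sums[OF sampled_summable[OF f g]])
    then show "sampled_inner g f = cnj (sampled_inner f g)"
      unfolding sampled_inner_def[of g f] by (simp add: sums_iff ac_simps)
    assume h: "h \<in> L2h \<omega>"
    show "sampled_inner (\<lambda>z. f z + g z) h = sampled_inner f h + sampled_inner g h"
      unfolding sampled_inner_def
      by (subst suminf_add[OF sampled_summable[OF f h] sampled_summable[OF g h]]) (simp add: algebra_simps) }
  show "sampled_inner (\<lambda>z. c * f z) h = c * sampled_inner f h" if h: "h \<in> L2h \<omega>"
    unfolding sampled_inner_def
    by (subst suminf_mult[OF sampled_summable[OF f h], symmetric]) (simp add: mult.assoc)
next
  fix X :: "nat \<Rightarrow> complex \<Rightarrow> complex"
  assume X: "\<And>n. X n \<in> L2h \<omega>"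
    and C: "\<And>e. 0 < e \<Longrightarrow> \<exists>N. \<forall>m\<ge>N. \<forall>n\<ge>N. Re (sampled_inner (\<lambda>z. X m z - X n z) (\<lambda>z. X m z - X n z)) < e"
  \<comment> \<open>Completeness is transferred from the original norm: the lower sampling bound
    makes the sequence Cauchy there, and the upper bound carries the convergence back.\<close>
  have "\<exists>f\<in>L2h \<omega>. (\<lambda>n. L2.Q (\<lambda>z. X n z - f z)) \<longlonglongrightarrow> 0"
  proof (rule L2.complete[OF X])
    fix e :: real assume "e > 0"
    then obtain N where N: "\<And>m n. m \<ge> N \<Longrightarrow> n \<ge> N \<Longrightarrow> Re (sampled_inner (\<lambda>z. X m z - X n z) (\<lambda>z. X m z - X n z)) < e / 4"
      using C[of "e / 4"] by auto
    show "\<exists>N. \<forall>m\<ge>N. \<forall>n\<ge>N. L2.Q (\<lambda>z. X m z - X n z) < e"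
    proof (intro exI[of _ N] allI impI)
      fix m n assume mn: "m \<ge> N" "n \<ge> N"
      have D: "(\<lambda>z. X m z - X n z) \<in> L2h \<omega>" by (rule L2.diff[OF X X])
      have "L2.Q (\<lambda>z. X m z - X n z) \<le> 4 * Re (sampled_inner (\<lambda>z. X m z - X n z) (\<lambda>z. X m z - X n z))"
        using sampling(3)[OF D] by (simp add: sampled_self[OF D])
      also have "\<dots> < 4 * (e / 4)" using N[OF mn] by (intro mult_strict_left_mono) simp_all
      finally show "L2.Q (\<lambda>z. X m z - X n z) < e" by simp
    qed
  qed
  then obtain f where f: "f \<in> L2h \<omega>" "(\<lambda>n. L2.Q (\<lambda>z. X n z - f z)) \<longlonglongrightarrow> 0" by blast
  have "(\<lambda>n. Re (sampled_inner (\<lambda>z. X n z - f z) (\<lambda>z. X n z - f z))) \<longlonglongrightarrow> 0"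
  proof (rule Lim_null_comparison)
    show "\<forall>\<^sub>F n in sequentially. norm (Re (sampled_inner (\<lambda>z. X n z - f z) (\<lambda>z. X n z - f z))) \<le> 65536 * A * L2.Q (\<lambda>z. X n z - f z)"
    proof (intro always_eventually allI)
      fix n
      have D: "(\<lambda>z. X n z - f z) \<in> L2h \<omega>" by (rule L2.diff[OF X f(1)])
      show "norm (Re (sampled_inner (\<lambda>z. X n z - f z) (\<lambda>z. X n z - f z))) \<le> 65536 * A * L2.Q (\<lambda>z. X n z - f z)"
        using sampling(2)[OF D] suminf_nonneg[OF sampling(1)[OF D]] d_nonneg by (simp add: sampled_self[OF D])
    qed
    show "(\<lambda>n. 65536 * A * L2.Q (\<lambda>z. X n z - f z)) \<longlonglongrightarrow> 0" by (rule tendsto_mult_right_zero[OF f(2)])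
  qed
  with f(1) show "\<exists>f\<in>L2h \<omega>. (\<lambda>n. Re (sampled_inner (\<lambda>z. X n z - f z) (\<lambda>z. X n z - f z))) \<longlonglongrightarrow> 0" by blast
qed

text \<open>The abstract Cauchy-Schwarz inequality concerns real parts only. Applying it to
  \<open>g\<close> and to \<open>- \<i> * g\<close> and adding the squares gives the factor
  \<open>2\<close>, harmless because only boundedness is wanted.\<close>

lemma inner_bound:
  assumes f: "f \<in> L2h \<omega>" and g: "g \<in> L2h \<omega>"
  shows "(cmod (inner_L2 \<omega> g f))\<^sup>2 \<le> 2 * (L2.Q g * L2.Q f)"
proof -
  let ?g = "\<lambda>z. - \<i> * g z"
  have g': "?g \<in> L2h \<omega>" by (rule L2.scale[OF g])
  have "inner_L2 \<omega> ?g ?g = inner_L2 \<omega> g g"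
    using L2.ip_scale[OF g g', of "-\<i>"] L2.ip_cnj[OF g' g] L2.ip_scale[OF g g, of "- \<i>"] L2.ip_cnj[OF g g] by simp
  moreover have "Re (inner_L2 \<omega> ?g f) = Im (inner_L2 \<omega> g f)"
    using L2.ip_scale[OF g f, of "- \<i>"] by simp
  ultimately have "(Im (inner_L2 \<omega> g f))\<^sup>2 \<le> L2.Q g * L2.Q f"
    using L2.Cauchy_Schwarz[OF g' f] by simp
  then show ?thesis using L2.Cauchy_Schwarz[OF g f] by (simp add: cmod_power2)
qed

lemma atomic_decomposition:
  assumes f: "f \<in> L2h \<omega>"
  obtains c :: "nat \<Rightarrow> complex" where "summable (\<lambda>n. (cmod (c n))\<^sup>2)"
    "\<And>z. z \<in> disc \<Longrightarrow> (\<lambda>n. c n * repr_kernel \<omega> (a n) z * complex_of_real (sqrt (d n))) sums f z"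
proof -
  have "\<exists>F\<in>L2h \<omega>. \<forall>g\<in>L2h \<omega>. inner_L2 \<omega> g f = sampled_inner g F"
  \<comment> \<open>The constant \<open>8\<close> combines the \<open>2\<close> of
    \<open>inner_bound\<close> with the \<open>4\<close> of the lower sampling bound.\<close>
  proof (rule sampled.Riesz_representation[where L = "\<lambda>g. inner_L2 \<omega> g f" and C = "8 * L2.Q f"])
    fix g assume g: "g \<in> L2h \<omega>"
    have "(cmod (inner_L2 \<omega> g f))\<^sup>2 \<le> 2 * L2.Q f * L2.Q g" using inner_bound[OF f g] by (simp add: ac_simps)
    also have "\<dots> \<le> 2 * L2.Q f * (4 * sampled.Q g)"
      using sampling(3)[OF g] L2.ip_nonneg[OF f] by (intro mult_left_mono) (simp_all add: sampled_self[OF g])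
    finally show "(cmod (inner_L2 \<omega> g f))\<^sup>2 \<le> 8 * L2.Q f * sampled.Q g" by simp
  qed (use L2.ip_add L2.ip_scale f in auto)
  then obtain F where F: "F \<in> L2h \<omega>" "\<And>g. g \<in> L2h \<omega> \<Longrightarrow> inner_L2 \<omega> g f = sampled_inner g F" by blast
  show ?thesis
  proof
    \<comment> \<open>The weight \<open>d n\<close> is split into two square roots: one goes into
      the coefficient, making its square sum the sampled norm of \<open>F\<close>, and the other is
      the normalizing factor of the kernel.\<close>
    let ?c = "\<lambda>n. F (a n) * of_real (sqrt (d n))"
    show "summable (\<lambda>n. (cmod (?c n))\<^sup>2)"
      using sampling(1)[OF F(1)] d_nonneg by (simp add: norm_mult power_mult_distrib)
    fix z assume z: "z \<in> disc"
    let ?K = "repr_kernel \<omega> z"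
    have K: "?K \<in> L2h \<omega>" by (rule repr_kernel(1)[OF z])
    have "f z = cnj (inner_L2 \<omega> ?K f)"
      using repr_kernel(2)[OF z f] L2.ip_cnj[OF f K] by simp
    also have "\<dots> = cnj (sampled_inner ?K F)" by (simp add: F(2)[OF K])
    finally have fz: "f z = cnj (sampled_inner ?K F)" .
    have "(\<lambda>n. cnj (?K (a n) * cnj (F (a n)) * of_real (d n))) sums f z"
      unfolding fz sampled_inner_def sums_cnj by (rule summable_sums[OF sampled_summable[OF K F(1)]])
    moreover have "cnj (?K (a n) * cnj (F (a n)) * of_real (d n)) = ?c n * repr_kernel \<omega> (a n) z * of_real (sqrt (d n))" for n
    proof -
      have "complex_of_real (d n) = of_real (sqrt (d n)) * of_real (sqrt (d n))"
        using d_nonneg[of n] by (simp flip: of_real_mult)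
      then show ?thesis using repr_kernel_cnj[OF z a_disc, of n] by simp
    qed
    ultimately show "(\<lambda>n. ?c n * repr_kernel \<omega> (a n) z * of_real (sqrt (d n))) sums f z" by (simp only:)
  qed
qed

end

theorem theorem2p10:
  fixes \<omega> :: "complex \<Rightarrow> real"
  assumes "A2_weight \<omega>"
  shows "\<exists>(\<epsilon>::real) (a :: nat \<Rightarrow> complex). 0 < \<epsilon> \<and> \<epsilon> < 1 \<and> is_lattice \<epsilon> a \<and>
    (\<forall>f \<in> L2h \<omega>. \<exists>c :: nat \<Rightarrow> complex. summable (\<lambda>n. (cmod (c n))\<^sup>2) \<and>
      (\<forall>z \<in> disc.
        (\<lambda>n. c n * repr_kernel \<omega> (a n) z
              * complex_of_real (sqrt (enn2real (weighted_area \<omega> (pseudo_disc (a n) \<epsilon>))))) sums f z))"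
proof -
  interpret A2 \<omega> by unfold_locales fact
  \<comment> \<open>Adding \<open>1\<close> to \<open>A\<close> gives
    \<open>\<epsilon> \<le> 2^(-17)\<close> as well as
    \<open>\<epsilon> * A \<le> 2^(-17)\<close>.\<close>
  define \<epsilon> where "\<epsilon> = 1 / (2 ^ 17 * (A + 1))"
  have pos: "0 < \<epsilon>" using A_nonneg by (simp add: \<epsilon>_def)
  have small: "\<epsilon> * (2 ^ 17 * (A + 1)) \<le> 1" using A_nonneg by (simp add: \<epsilon>_def)
  have le: "\<epsilon> \<le> 1 / 8" using A_nonneg by (simp add: \<epsilon>_def divide_simps)
  obtain a where a: "is_lattice \<epsilon> a" "\<And>n m. n \<noteq> m \<Longrightarrow> \<epsilon> / 2 \<le> pseudohyperbolic (a n) (a m)"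
    using lattice_exists[OF pos le] by blast
  interpret A2_lattice \<omega> \<epsilon> a
    by unfold_locales (use pos small a in auto)
  show ?thesis
  proof (rule exI[of _ \<epsilon>], rule exI[of _ a], intro conjI ballI)
    show "0 < \<epsilon>" "\<epsilon> < 1" "is_lattice \<epsilon> a" using pos le a by auto
    fix f assume "f \<in> L2h \<omega>"
    then obtain c :: "nat \<Rightarrow> complex" where "summable (\<lambda>n. (cmod (c n))\<^sup>2)"
      "\<And>z. z \<in> disc \<Longrightarrow> (\<lambda>n. c n * repr_kernel \<omega> (a n) z * complex_of_real (sqrt (d n))) sums f z"
      by (rule atomic_decomposition) blast
    then show "\<exists>c :: nat \<Rightarrow> complex. summable (\<lambda>n. (cmod (c n))\<^sup>2) \<and>
      (\<forall>z \<in> disc.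
        (\<lambda>n. c n * repr_kernel \<omega> (a n) z
              * complex_of_real (sqrt (enn2real (weighted_area \<omega> (pseudo_disc (a n) \<epsilon>))))) sums f z)"
      unfolding d_def by blast
  qed
qed

end
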